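(* Let $(M_i,\Omega_i)$, $i=1,2$, be two locally homogeneous multisymplectic manifolds of degree $k$, and let $\varphi\colon M_1\to M_2$ be a diffeomorphism. Then $\varphi$ is a special conformal multisymplectic diffeomorphism (i.e. $\varphi^*\Omega_2=c\,\Omega_1$ for some $c\in\mathbb{R}$) if and only if the differential map $\varphi_*$ (acting on multivector fields) induces an isomorphism between the graded Lie algebras $\mathcal{V}_H^*(M_1,\Omega_1)$ and $\mathcal{V}_H^*(M_2,\Omega_2)$. In this case, with $\varphi^*\Omega_2=c\,\Omega_1$: (a) $\varphi_*X_\xi=c\,X_{(\varphi^{*})^{-1}\xi}$ (modulo characteristic multivector fields) for every Hamiltonian multivector field $X_\xi$ on $M_1$ with Hamiltonian form $\xi$. (b) If $X_1$ is any Hamiltonian (resp. locally Hamiltonian) $m$-vector field on $M_1$ with $\xi_1$ a Hamiltonian $(k-m-1)$-form for $X_1$ (resp. a local Hamiltonian form on some open $U_1\subset M_1$), and $\varphi_*X_1=X_2$ is the locally Hamiltonian $m$-vector field on $M_2$ with Hamiltonian $(k-m-1)$-form $\xi_2$ (resp. local Hamiltonian form on $U_2=\varphi(U_1)\subset M_2$), then $$c\,\xi_1=\varphi^*\xi_2+\eta,$$ where $\eta$ is a closed $(k-m-1)$-form on $M_1$ (resp. on $U_1$). In other words, $\varphi^*$ induces an isomorphism between classes of Hamiltonian forms (Hamiltonian forms modulo closed forms).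
   Context: All manifolds are real, paracompact, connected and $C^\infty$; $\dim M=n$. A multisymplectic manifold of degree $k\ge 2$ is a pair $(M,\Omega)$ where $\Omega$ is a closed $k$-form on $M$ that is $1$-nondegenerate, i.e. for every $x\in M$ the map $T_xM\to\Lambda^{k-1}(T_x^*M)$, $v\mapsto i(v)\Omega_x$, is injective. An $m$-vector field is a smooth section of $\Lambda^m(TM)$; contraction is determined by $i(v_1\wedge\dots\wedge v_m)=i(v_1)\cdots i(v_m)$, and $L(X)=d\,i(X)-(-1)^m i(X)\,d$ for an $m$-vector field $X$. The Schouten–Nijenhuis bracket $[X,Y]$ of an $i$-vector field $X$ and a $j$-vector field $Y$ is the $(i+j-1)$-vector field with $L([X,Y])=[L(X),L(Y)]$ (graded commutator). An $m$-vector field $X$ is Hamiltonian if $i(X)\Omega=d\zeta$ for some $(k-m-1)$-form $\zeta$ on $M$, called a Hamiltonian form for $X$ (determined modulo closed forms); given such a $\zeta$, $X_\zeta$ denotes a multivector field with $i(X_\zeta)\Omega=d\zeta$, determined modulo $\ker^m\Omega$. $X$ is locally Hamiltonian if $i(X)\Omega$ is closed, in which case around each point there are local Hamiltonian forms $\zeta$ with $i(X)\Omega=d\zeta$. (For $m=0$, $X$ is a function and $i(X)\Omega=X\Omega$.) $\ker^m\Omega$ is the set of $m$-vector fields with $i(X)\Omega=0$; its elements are called characteristic. $\mathfrak{X}^m_{lh}(M)$ denotes the set of locally Hamiltonian $m$-vector fields. The graded Lie algebra of infinitesimal automorphisms is $\mathcal{V}_H^*(M,\Omega)=\bigoplus_{m=0}^k\mathfrak{X}^m_{lh}(M)/\ker^m\Omega$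 with the bracket induced by the Schouten–Nijenhuis bracket. Local Euler-like vector field: let $x\in M$ and let $K$ be a compact set with $x$ in the interior of $K$. A local Euler-like vector field at $x$ with respect to $K$ is a vector field $\Delta^x$ on $M$ such that $\operatorname{supp}\Delta^x=\overline{\{y\in M: \Delta^x(y)\neq 0\}}\subset K$, and such that there is a diffeomorphism $\psi$ from the interior of $\operatorname{supp}\Delta^x$ onto $\mathbb{R}^n$ with $\psi(x)=0$ and $\psi_*\Delta^x=x^i\,\partial/\partial x^i$ (the standard dilation vector field on $\mathbb{R}^n$). Locally homogeneous: a differential form $\Omega$ on $M$ is locally homogeneous at $x\in M$ if for every open set $U$ containing $x$ there exist a compact set $K\subset U$ and a local Euler-like vector field $\Delta^x$ at $x$ with respect to $K$ such that $L(\Delta^x)\Omega=f\,\Omega$ on $U$ for some $f\in C^\infty(U)$. $\Omega$ is locally homogeneous if this holds at every $x\in M$. A locally homogeneous multisymplectic manifold is a multisymplectic manifold $(M,\Omega)$ with $\Omega$ locally homogeneous. *)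

theory Defs
  imports "HOL-Analysis.Analysis"
begin

section \<open>Smooth manifolds\<close>

fun Ck_on :: "nat \<Rightarrow> 'a::real_normed_vector set \<Rightarrow> ('a \<Rightarrow> 'b::real_normed_vector) \<Rightarrow> bool" where
  "Ck_on 0 S f \<longleftrightarrow> continuous_on S f"
| "Ck_on (Suc r) S f \<longleftrightarrow>
     (\<forall>x\<in>S. f differentiable (at x)) \<and> (\<forall>v. Ck_on r S (\<lambda>x. frechet_derivative f (at x) v))"

text \<open>Only used for open \<open>S\<close> in a finite-dimensional space.\<close>

definition smooth_on :: "'a::real_normed_vector set \<Rightarrow> ('a \<Rightarrow> 'b::real_normed_vector) \<Rightarrow> bool" where
  "smooth_on S f \<longleftrightarrow> (\<forall>r. Ck_on r S f)"

text \<open>A chart is a domain together with a coordinate map, which is meaningful on the domain only.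
  The smooth structure is the one generated by the given, not necessarily maximal, atlas; the
  dimension is the dimension of the model space \<open>'v\<close>.\<close>

type_synonym ('a, 'v) chart = "'a set \<times> ('a \<Rightarrow> 'v)"

record ('a, 'v) manifold =
  mtop :: "'a topology"
  atlas :: "('a, 'v) chart set"

abbreviation points :: "('a, 'v) manifold \<Rightarrow> 'a set" where
  "points M \<equiv> topspace (mtop M)"

abbreviation chart_inv :: "('a, 'v) chart \<Rightarrow> 'v \<Rightarrow> 'a" where
  "chart_inv c \<equiv> inv_into (fst c) (snd c)"

definition is_chart :: "'a topology \<Rightarrow> ('a, 'v::euclidean_space) chart \<Rightarrow> bool" where
  "is_chart T c \<longleftrightarrow> openin T (fst c) \<and> open (snd c ` fst c) \<and>
     homeomorphic_map (subtopology T (fst c)) (top_of_set (snd c ` fst c)) (snd c)"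

definition paracompact_space :: "'a topology \<Rightarrow> bool" where
  "paracompact_space T \<longleftrightarrow>
     (\<forall>\<U>. (\<forall>U\<in>\<U>. openin T U) \<and> \<Union>\<U> = topspace T \<longrightarrow>
       (\<exists>\<V>. (\<forall>V\<in>\<V>. openin T V \<and> (\<exists>U\<in>\<U>. V \<subseteq> U)) \<and> \<Union>\<V> = topspace T \<and>
            locally_finite_in T \<V>))"

definition smooth_manifold :: "('a, 'v::euclidean_space) manifold \<Rightarrow> bool" where
  "smooth_manifold M \<longleftrightarrow>
     Hausdorff_space (mtop M) \<and> paracompact_space (mtop M) \<and> connected_space (mtop M) \<and>
     (\<forall>c\<in>atlas M. is_chart (mtop M) c) \<and> (\<Union>c\<in>atlas M. fst c) = points M \<and>
     (\<forall>c\<in>atlas M. \<forall>c'\<in>atlas M. smooth_on (snd c ` (fst c \<inter> fst c')) (snd c' \<circ> chart_inv c))"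

definition euclid :: "('v::euclidean_space, 'v) manifold" where
  "euclid = \<lparr>mtop = euclidean, atlas = {(UNIV, id)}\<rparr>"

text \<open>The tangent space at \<open>p\<close> is identified with the model space \<open>'v\<close> through a chart
  around \<open>p\<close> that is chosen once and for all.\<close>

definition chart_at :: "('a, 'v) manifold \<Rightarrow> 'a \<Rightarrow> ('a, 'v) chart" where
  "chart_at M p = (SOME c. c \<in> atlas M \<and> p \<in> fst c)"

text \<open>The differential at \<open>p\<close> of a map \<open>\<phi>\<close> defined near \<open>p\<close>, as a map from the tangent space at
  \<open>p\<close> to the tangent space at \<open>\<phi> p\<close>.\<close>

definition mderiv ::
  "('a, 'v::euclidean_space) manifold \<Rightarrow> ('b, 'w::euclidean_space) manifold \<Rightarrow> ('a \<Rightarrow> 'b) \<Rightarrow> 'a \<Rightarrow> 'v \<Rightarrow> 'w"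
  where
  "mderiv M N \<phi> p =
     frechet_derivative (snd (chart_at N (\<phi> p)) \<circ> \<phi> \<circ> chart_inv (chart_at M p))
       (at (snd (chart_at M p) p))"

definition smooth_map_on ::
  "('a, 'v::euclidean_space) manifold \<Rightarrow> 'a set \<Rightarrow> ('b, 'w::euclidean_space) manifold \<Rightarrow> ('a \<Rightarrow> 'b) \<Rightarrow> bool"
  where
  "smooth_map_on M U N \<phi> \<longleftrightarrow>
     continuous_map (subtopology (mtop M) U) (mtop N) \<phi> \<and>
     (\<forall>c\<in>atlas M. \<forall>c'\<in>atlas N.
        smooth_on (snd c ` {p \<in> U \<inter> fst c. \<phi> p \<in> fst c'}) (snd c' \<circ> \<phi> \<circ> chart_inv c))"

definition diffeo_on ::
  "('a, 'v::euclidean_space) manifold \<Rightarrow> 'a set \<Rightarrow> ('b, 'w::euclidean_space) manifold \<Rightarrow> 'b set \<Rightarrow> ('a \<Rightarrow> 'b) \<Rightarrow> bool"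
  where
  "diffeo_on M U N V \<phi> \<longleftrightarrow>
     openin (mtop M) U \<and> openin (mtop N) V \<and> bij_betw \<phi> U V \<and>
     smooth_map_on M U N \<phi> \<and> smooth_map_on N V M (inv_into U \<phi>)"

abbreviation diffeomorphism ::
  "('a, 'v::euclidean_space) manifold \<Rightarrow> ('b, 'w::euclidean_space) manifold \<Rightarrow> ('a \<Rightarrow> 'b) \<Rightarrow> bool"
  where
  "diffeomorphism M N \<phi> \<equiv> diffeo_on M (points M) N (points N) \<phi>"


section \<open>Differential forms and multivector fields\<close>

text \<open>An alternating \<open>r\<close>-linear form is a function on lists of length \<open>r\<close>, extended by \<open>0\<close> to lists
  of other lengths. An \<open>m\<close>-vector is encoded as the alternating \<open>m\<close>-linear form it induces on
  covectors, a covector \<open>\<lambda>v. a \<bullet> v\<close> being written as \<open>a\<close>. Thus \<open>v\<^sub>1 \<and> \<dots> \<and> v\<^sub>m\<close> is the function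
  \<open>[a\<^sub>1, \<dots>, a\<^sub>m] \<mapsto> det (a\<^sub>i \<bullet> v\<^sub>j)\<close>. In degree \<open>0\<close> both notions are real numbers, namely the value
  on the empty list.\<close>

definition alternating :: "nat \<Rightarrow> ('v::real_vector list \<Rightarrow> real) \<Rightarrow> bool" where
  "alternating r t \<longleftrightarrow>
     (\<forall>vs. length vs \<noteq> r \<longrightarrow> t vs = 0) \<and>
     (\<forall>vs i. length vs = r \<longrightarrow> i < r \<longrightarrow> linear (\<lambda>u. t (vs[i := u]))) \<and>
     (\<forall>vs. \<not> distinct vs \<longrightarrow> t vs = 0)"

type_synonym ('a, 'v) tfield = "'a \<Rightarrow> 'v list \<Rightarrow> real"

definition pullback ::
  "('a, 'v::euclidean_space) manifold \<Rightarrow> ('b, 'w::euclidean_space) manifold \<Rightarrow> ('a \<Rightarrow> 'b) \<Rightarrow>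
     ('b, 'w) tfield \<Rightarrow> ('a, 'v) tfield" where
  "pullback M N \<phi> \<omega> = (\<lambda>p vs. \<omega> (\<phi> p) (map (mderiv M N \<phi> p) vs))"

text \<open>Push-forward of a multivector field on \<open>U\<close> under a diffeomorphism \<open>\<phi>\<close> of \<open>U\<close> onto its image;
  on covectors the differential acts by its adjoint.\<close>

definition pushforward ::
  "('a, 'v::euclidean_space) manifold \<Rightarrow> 'a set \<Rightarrow> ('b, 'w::euclidean_space) manifold \<Rightarrow> ('a \<Rightarrow> 'b) \<Rightarrow>
     ('a, 'v) tfield \<Rightarrow> ('b, 'w) tfield" where
  "pushforward M U N \<phi> X =
     (\<lambda>q as. let p = inv_into U \<phi> q in X p (map (adjoint (mderiv M N \<phi> p)) as))"

text \<open>Fields are total functions, but only their values at the points of their domain \<open>U\<close> matter.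
  Smoothness is smoothness of the components of the local representatives in all charts.\<close>

definition local_form ::
  "('a, 'v::euclidean_space) manifold \<Rightarrow> ('a, 'v) chart \<Rightarrow> ('a, 'v) tfield \<Rightarrow> ('v, 'v) tfield" where
  "local_form M c \<omega> = pullback euclid M (chart_inv c) \<omega>"

definition local_mvf ::
  "('a, 'v::euclidean_space) manifold \<Rightarrow> ('a, 'v) chart \<Rightarrow> ('a, 'v) tfield \<Rightarrow> ('v, 'v) tfield" where
  "local_mvf M c X = pushforward M (fst c) euclid (snd c) X"

definition form_on ::
  "('a, 'v::euclidean_space) manifold \<Rightarrow> 'a set \<Rightarrow> nat \<Rightarrow> ('a, 'v) tfield \<Rightarrow> bool" where
  "form_on M U r \<omega> \<longleftrightarrow>
     (\<forall>p\<in>U. alternating r (\<omega> p)) \<and>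
     (\<forall>c\<in>atlas M. \<forall>vs. smooth_on (snd c ` (U \<inter> fst c)) (\<lambda>y. local_form M c \<omega> y vs))"

definition mvf_on ::
  "('a, 'v::euclidean_space) manifold \<Rightarrow> 'a set \<Rightarrow> nat \<Rightarrow> ('a, 'v) tfield \<Rightarrow> bool" where
  "mvf_on M U m X \<longleftrightarrow>
     (\<forall>p\<in>U. alternating m (X p)) \<and>
     (\<forall>c\<in>atlas M. \<forall>as. smooth_on (snd c ` (U \<inter> fst c)) (\<lambda>y. local_mvf M c X y as))"

definition ext_deriv_flat :: "('v::euclidean_space, 'v) tfield \<Rightarrow> ('v, 'v) tfield" where
  "ext_deriv_flat \<omega> = (\<lambda>y vs. \<Sum>j<length vs.
     (-1) ^ j * frechet_derivative (\<lambda>z. \<omega> z (take j vs @ drop (Suc j) vs)) (at y) (vs ! j))"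

definition ext_deriv :: "('a, 'v::euclidean_space) manifold \<Rightarrow> ('a, 'v) tfield \<Rightarrow> ('a, 'v) tfield" where
  "ext_deriv M \<omega> =
     (\<lambda>p. ext_deriv_flat (local_form M (chart_at M p) \<omega>) (snd (chart_at M p) p))"

text \<open>Contraction with an \<open>m\<close>-vector field
  \<open>X = 1/m! \<Sum> X(b\<^sub>1,\<dots>,b\<^sub>m) b\<^sub>1 \<and> \<dots> \<and> b\<^sub>m\<close>, the sum being over all lists of basis vectors. The
  reversal comes from \<open>i(v\<^sub>1 \<and> \<dots> \<and> v\<^sub>m) = i(v\<^sub>1) \<cdots> i(v\<^sub>m)\<close>, that is,
  \<open>i(v\<^sub>1 \<and> \<dots> \<and> v\<^sub>m) \<omega> = \<omega>(v\<^sub>m, \<dots>, v\<^sub>1, \<dots>)\<close>.\<close>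

definition contr ::
  "nat \<Rightarrow> ('a, 'v::euclidean_space) tfield \<Rightarrow> ('a, 'v) tfield \<Rightarrow> ('a, 'v) tfield" where
  "contr m X \<omega> = (\<lambda>p ws.
     (\<Sum>bs\<in>{bs. set bs \<subseteq> Basis \<and> length bs = m}. X p bs * \<omega> p (rev bs @ ws)) / fact m)"

definition lie ::
  "('a, 'v::euclidean_space) manifold \<Rightarrow> nat \<Rightarrow> ('a, 'v) tfield \<Rightarrow> ('a, 'v) tfield \<Rightarrow> ('a, 'v) tfield" where
  "lie M m X \<alpha> =
     (\<lambda>p ws. ext_deriv M (contr m X \<alpha>) p ws - (-1) ^ m * contr m X (ext_deriv M \<alpha>) p ws)"

text \<open>The Schouten--Nijenhuis bracket of an \<open>i\<close>-vector field and a \<open>j\<close>-vector field, as the set of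
  all \<open>(i+j-1)\<close>-vector fields representing it; they agree at all points of \<open>M\<close>. The operator
  \<open>L(X)\<close> has degree \<open>1 - i\<close>, whence the sign in the graded commutator. If \<open>i + j = 1\<close>, the bracket
  is a function and \<open>L\<close> determines it up to a constant only; it is then normalised in the usual way,
  \<open>[X,f] = X f = - [f,X]\<close>. The bracket of two functions is \<open>0\<close> (degree \<open>-1\<close>); this definition is
  used for \<open>i + j \<ge> 1\<close> only.\<close>

definition schouten ::
  "('a, 'v::euclidean_space) manifold \<Rightarrow> nat \<Rightarrow> nat \<Rightarrow> ('a, 'v) tfield \<Rightarrow> ('a, 'v) tfield \<Rightarrow>
     ('a, 'v) tfield set" where
  "schouten M i j X Y = {Z. mvf_on M (points M) (i + j - 1) Z \<and>
     (\<forall>r \<alpha>. form_on M (points M) r \<alpha> \<longrightarrow>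
        (\<forall>p\<in>points M. \<forall>ws. lie M (i + j - 1) Z \<alpha> p ws =
           lie M i X (lie M j Y \<alpha>) p ws -
           (-1) ^ ((i + 1) * (j + 1)) * lie M j Y (lie M i X \<alpha>) p ws)) \<and>
     (i = 1 \<and> j = 0 \<longrightarrow> (\<forall>p\<in>points M. Z p [] = contr 1 X (ext_deriv M Y) p [])) \<and>
     (i = 0 \<and> j = 1 \<longrightarrow> (\<forall>p\<in>points M. Z p [] = - contr 1 Y (ext_deriv M X) p []))}"


section \<open>Locally homogeneous multisymplectic manifolds\<close>

definition multisymplectic :: "('a, 'v::euclidean_space) manifold \<Rightarrow> nat \<Rightarrow> ('a, 'v) tfield \<Rightarrow> bool" where
  "multisymplectic M k \<Omega> \<longleftrightarrow>
     smooth_manifold M \<and> 2 \<le> k \<and> form_on M (points M) k \<Omega> \<and>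
     (\<forall>p\<in>points M. \<forall>vs. ext_deriv M \<Omega> p vs = 0) \<and>
     (\<forall>p\<in>points M. inj (\<lambda>v ws. \<Omega> p (v # ws)))"

definition supp :: "('a, 'v::euclidean_space) manifold \<Rightarrow> ('a, 'v) tfield \<Rightarrow> 'a set" where
  "supp M X = mtop M closure_of {y \<in> points M. \<exists>as. X y as \<noteq> 0}"

definition vector_mv :: "'v::real_inner \<Rightarrow> 'v list \<Rightarrow> real" where
  "vector_mv v as = (case as of [a] \<Rightarrow> a \<bullet> v | _ \<Rightarrow> 0)"

text \<open>The dilation field on the model space is \<open>\<lambda>y. vector_mv y\<close>.\<close>

definition local_euler ::
  "('a, 'v::euclidean_space) manifold \<Rightarrow> 'a \<Rightarrow> 'a set \<Rightarrow> ('a, 'v) tfield \<Rightarrow> bool" where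
  "local_euler M x K \<Delta> \<longleftrightarrow>
     compactin (mtop M) K \<and> x \<in> mtop M interior_of K \<and>
     mvf_on M (points M) 1 \<Delta> \<and> supp M \<Delta> \<subseteq> K \<and>
     (let S = mtop M interior_of supp M \<Delta> in
        x \<in> S \<and>
        (\<exists>\<psi>. diffeo_on M S (euclid :: ('v, 'v) manifold) UNIV \<psi> \<and> \<psi> x = 0 \<and>
             (\<forall>y. pushforward M S euclid \<psi> \<Delta> y = vector_mv y)))"

definition locally_homogeneous_at ::
  "('a, 'v::euclidean_space) manifold \<Rightarrow> ('a, 'v) tfield \<Rightarrow> 'a \<Rightarrow> bool" where
  "locally_homogeneous_at M \<Omega> x \<longleftrightarrow>
     (\<forall>U. openin (mtop M) U \<and> x \<in> U \<longrightarrow>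
       (\<exists>K \<Delta> (f :: 'a \<Rightarrow> real). K \<subseteq> U \<and> local_euler M x K \<Delta> \<and> smooth_map_on M U euclid f \<and>
          (\<forall>p\<in>U. \<forall>vs. lie M 1 \<Delta> \<Omega> p vs = f p * \<Omega> p vs)))"

definition lh_multisymplectic ::
  "('a, 'v::euclidean_space) manifold \<Rightarrow> nat \<Rightarrow> ('a, 'v) tfield \<Rightarrow> bool" where
  "lh_multisymplectic M k \<Omega> \<longleftrightarrow>
     multisymplectic M k \<Omega> \<and> (\<forall>x\<in>points M. locally_homogeneous_at M \<Omega> x)"


section \<open>Hamiltonian multivector fields and infinitesimal automorphisms\<close>

definition locally_hamiltonian ::
  "('a, 'v::euclidean_space) manifold \<Rightarrow> ('a, 'v) tfield \<Rightarrow> nat \<Rightarrow> ('a, 'v) tfield set" where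
  "locally_hamiltonian M \<Omega> m = {X. mvf_on M (points M) m X \<and>
     (\<forall>p\<in>points M. \<forall>ws. ext_deriv M (contr m X \<Omega>) p ws = 0)}"

definition characteristic ::
  "('a, 'v::euclidean_space) manifold \<Rightarrow> ('a, 'v) tfield \<Rightarrow> nat \<Rightarrow> ('a, 'v) tfield set" where
  "characteristic M \<Omega> m = {X. mvf_on M (points M) m X \<and>
     (\<forall>p\<in>points M. \<forall>ws. contr m X \<Omega> p ws = 0)}"

text \<open>\<open>\<zeta>\<close> is a Hamiltonian form on \<open>U\<close> for the \<open>m\<close>-vector field \<open>X\<close>, where \<open>m < k\<close>.\<close>

definition hamiltonian_form ::
  "('a, 'v::euclidean_space) manifold \<Rightarrow> nat \<Rightarrow> ('a, 'v) tfield \<Rightarrow> 'a set \<Rightarrow> nat \<Rightarrow>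
     ('a, 'v) tfield \<Rightarrow> ('a, 'v) tfield \<Rightarrow> bool" where
  "hamiltonian_form M k \<Omega> U m X \<zeta> \<longleftrightarrow>
     form_on M U (k - m - 1) \<zeta> \<and> (\<forall>p\<in>U. \<forall>ws. contr m X \<Omega> p ws = ext_deriv M \<zeta> p ws)"

text \<open>A map \<open>f\<close> respecting the relations acts on classes by \<open>induced s f\<close>, where \<open>s\<close> is the
  relation on the target.\<close>

definition induced :: "('y \<times> 'y) set \<Rightarrow> ('x \<Rightarrow> 'y) \<Rightarrow> 'x set \<Rightarrow> 'y set" where
  "induced s f A = (\<Union>x\<in>A. s `` {f x})"

definition field_add :: "('a, 'v) tfield \<Rightarrow> ('a, 'v) tfield \<Rightarrow> ('a, 'v) tfield" where
  "field_add X Y = (\<lambda>p vs. X p vs + Y p vs)"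

definition field_scale :: "real \<Rightarrow> ('a, 'v) tfield \<Rightarrow> ('a, 'v) tfield" where
  "field_scale r X = (\<lambda>p vs. r * X p vs)"

text \<open>A graded Lie algebra given by its homogeneous components in degrees \<open>degs\<close>. The bracket of
  degrees \<open>i, j\<close> has values in degree \<open>i + j - 1\<close>, and is \<open>0\<close> if that is not one of the degrees.\<close>

record 'x graded_lie =
  degs :: "nat set"
  component :: "nat \<Rightarrow> 'x set"
  gadd :: "nat \<Rightarrow> 'x \<Rightarrow> 'x \<Rightarrow> 'x"
  gscale :: "nat \<Rightarrow> real \<Rightarrow> 'x \<Rightarrow> 'x"
  gbracket :: "nat \<Rightarrow> nat \<Rightarrow> 'x \<Rightarrow> 'x \<Rightarrow> 'x"

definition graded_lie_iso :: "'x graded_lie \<Rightarrow> 'y graded_lie \<Rightarrow> (nat \<Rightarrow> 'x \<Rightarrow> 'y) \<Rightarrow> bool" where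
  "graded_lie_iso G H F \<longleftrightarrow> degs G = degs H \<and>
     (\<forall>m\<in>degs G. bij_betw (F m) (component G m) (component H m) \<and>
        (\<forall>a\<in>component G m. \<forall>b\<in>component G m. F m (gadd G m a b) = gadd H m (F m a) (F m b)) \<and>
        (\<forall>a\<in>component G m. \<forall>r. F m (gscale G m r a) = gscale H m r (F m a))) \<and>
     (\<forall>i\<in>degs G. \<forall>j\<in>degs G. 1 \<le> i + j \<longrightarrow> i + j - 1 \<in> degs G \<longrightarrow>
        (\<forall>a\<in>component G i. \<forall>b\<in>component G j.
           F (i + j - 1) (gbracket G i j a b) = gbracket H i j (F i a) (F j b)))"

definition mod_char ::
  "('a, 'v::euclidean_space) manifold \<Rightarrow> ('a, 'v) tfield \<Rightarrow> nat \<Rightarrow> (('a, 'v) tfield \<times> ('a, 'v) tfield) set"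
  where
  "mod_char M \<Omega> m = {(X, Y). X \<in> locally_hamiltonian M \<Omega> m \<and> Y \<in> locally_hamiltonian M \<Omega> m \<and>
     (\<lambda>p as. X p as - Y p as) \<in> characteristic M \<Omega> m}"

definition VH ::
  "('a, 'v::euclidean_space) manifold \<Rightarrow> nat \<Rightarrow> ('a, 'v) tfield \<Rightarrow> ('a, 'v) tfield set graded_lie" where
  "VH M k \<Omega> = \<lparr>
     degs = {0..k},
     component = (\<lambda>m. locally_hamiltonian M \<Omega> m // mod_char M \<Omega> m),
     gadd = (\<lambda>m A B. \<Union>X\<in>A. \<Union>Y\<in>B. mod_char M \<Omega> m `` {field_add X Y}),
     gscale = (\<lambda>m r A. \<Union>X\<in>A. mod_char M \<Omega> m `` {field_scale r X}),
     gbracket = (\<lambda>i j A B. \<Union>X\<in>A. \<Union>Y\<in>B. mod_char M \<Omega> (i + j - 1) `` schouten M i j X Y)\<rparr>"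

definition induces_VH_iso ::
  "('a, 'v::euclidean_space) manifold \<Rightarrow> ('b, 'v) manifold \<Rightarrow> nat \<Rightarrow> ('a, 'v) tfield \<Rightarrow> ('b, 'v) tfield \<Rightarrow>
     ('a \<Rightarrow> 'b) \<Rightarrow> bool" where
  "induces_VH_iso M1 M2 k \<Omega>1 \<Omega>2 \<phi> \<longleftrightarrow>
     (let push = pushforward M1 (points M1) M2 \<phi> in
      (\<forall>m\<le>k. push ` locally_hamiltonian M1 \<Omega>1 m \<subseteq> locally_hamiltonian M2 \<Omega>2 m \<and>
              push ` characteristic M1 \<Omega>1 m \<subseteq> characteristic M2 \<Omega>2 m) \<and>
      graded_lie_iso (VH M1 k \<Omega>1) (VH M2 k \<Omega>2) (\<lambda>m. induced (mod_char M2 \<Omega>2 m) push))"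

definition conformal_with ::
  "('a, 'v::euclidean_space) manifold \<Rightarrow> ('b, 'v) manifold \<Rightarrow> ('a, 'v) tfield \<Rightarrow> ('b, 'v) tfield \<Rightarrow>
     ('a \<Rightarrow> 'b) \<Rightarrow> real \<Rightarrow> bool" where
  "conformal_with M1 M2 \<Omega>1 \<Omega>2 \<phi> c \<longleftrightarrow>
     (\<forall>p\<in>points M1. \<forall>vs. pullback M1 M2 \<phi> \<Omega>2 p vs = c * \<Omega>1 p vs)"

text \<open>Classes, modulo closed forms, of the forms on \<open>U\<close> that are Hamiltonian forms on \<open>U\<close> of some
  locally Hamiltonian \<open>m\<close>-vector field on \<open>M\<close>. For \<open>U = points M\<close> these are the Hamiltonian forms
  on \<open>M\<close>.\<close>

definition ham_forms ::
  "('a, 'v::euclidean_space) manifold \<Rightarrow> nat \<Rightarrow> ('a, 'v) tfield \<Rightarrow> 'a set \<Rightarrow> nat \<Rightarrow> ('a, 'v) tfield set" where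
  "ham_forms M k \<Omega> U m =
     {\<zeta>. \<exists>X\<in>locally_hamiltonian M \<Omega> m. hamiltonian_form M k \<Omega> U m X \<zeta>}"

definition closed_form_on ::
  "('a, 'v::euclidean_space) manifold \<Rightarrow> 'a set \<Rightarrow> nat \<Rightarrow> ('a, 'v) tfield \<Rightarrow> bool" where
  "closed_form_on M U r \<eta> \<longleftrightarrow> form_on M U r \<eta> \<and> (\<forall>p\<in>U. \<forall>ws. ext_deriv M \<eta> p ws = 0)"

definition mod_closed ::
  "('a, 'v::euclidean_space) manifold \<Rightarrow> nat \<Rightarrow> ('a, 'v) tfield \<Rightarrow> 'a set \<Rightarrow> nat \<Rightarrow>
     (('a, 'v) tfield \<times> ('a, 'v) tfield) set" where
  "mod_closed M k \<Omega> U m = {(\<zeta>, \<xi>). \<zeta> \<in> ham_forms M k \<Omega> U m \<and> \<xi> \<in> ham_forms M k \<Omega> U m \<and>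
     closed_form_on M U (k - m - 1) (\<lambda>p ws. \<zeta> p ws - \<xi> p ws)}"

text \<open>\<open>\<phi>\<^sup>*\<close> induces a linear isomorphism from the classes on \<open>\<phi> ` U\<close> to those on \<open>U\<close>.\<close>

definition induces_form_iso ::
  "('a, 'v::euclidean_space) manifold \<Rightarrow> ('b, 'v) manifold \<Rightarrow> nat \<Rightarrow> ('a, 'v) tfield \<Rightarrow> ('b, 'v) tfield \<Rightarrow>
     ('a \<Rightarrow> 'b) \<Rightarrow> 'a set \<Rightarrow> nat \<Rightarrow> bool" where
  "induces_form_iso M1 M2 k \<Omega>1 \<Omega>2 \<phi> U m \<longleftrightarrow>
     (let pull = pullback M1 M2 \<phi>;
          H1 = ham_forms M1 k \<Omega>1 U m; r1 = mod_closed M1 k \<Omega>1 U m;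
          H2 = ham_forms M2 k \<Omega>2 (\<phi> ` U) m; r2 = mod_closed M2 k \<Omega>2 (\<phi> ` U) m;
          F = induced r1 pull
      in pull ` H2 \<subseteq> H1 \<and>
         (\<forall>\<eta>. closed_form_on M2 (\<phi> ` U) (k - m - 1) \<eta> \<longrightarrow> closed_form_on M1 U (k - m - 1) (pull \<eta>)) \<and>
         bij_betw F (H2 // r2) (H1 // r1) \<and>
         (\<forall>A\<in>H2 // r2. \<forall>B\<in>H2 // r2.
            F (\<Union>\<zeta>\<in>A. \<Union>\<xi>\<in>B. r2 `` {field_add \<zeta> \<xi>}) =
            (\<Union>\<zeta>\<in>F A. \<Union>\<xi>\<in>F B. r1 `` {field_add \<zeta> \<xi>})) \<and>
         (\<forall>A\<in>H2 // r2. \<forall>s.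
            F (\<Union>\<zeta>\<in>A. r2 `` {field_scale s \<zeta>}) = (\<Union>\<zeta>\<in>F A. r1 `` {field_scale s \<zeta>})))"

end

theory Submission
  imports Defs
begin

text \<open>The theorem has an easy direction, which is transport of structure, and a converse, in which the
  multiple \<open>c\<close> has to be recovered from the behaviour of \<open>\<phi>\<close> on locally Hamiltonian fields.

  Transport of structure rests on the naturality of all operations involved. The exterior derivative
  commutes with pull-backs (\<open>ext_deriv_pullback\<close>), by the product rule and the symmetry of second
  derivatives. Contraction is compatible with push-forward of multivectors and pull-back of forms
  (\<open>contr_pullback\<close>), since multivectors are transported by adjoints. Hence Lie derivatives and the
  Schouten--Nijenhuis bracket are natural (\<open>lie_pullback\<close>, \<open>schouten_push\<close>). If \<open>\<phi>\<^sup>*\<Omega>2 = c \<Omega>1\<close>, then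
  \<open>\<phi>\<^sup>* (i(\<phi>\<^sub>* X) \<Omega>2) = c i(X) \<Omega>1\<close> (\<open>pull_contr_push\<close>), where \<open>c\<close> is nonzero, unless the manifolds are
  empty, because \<open>\<Omega>2\<close> is. From this identity follow the isomorphism of graded Lie algebras (\<open>VH_iso\<close>), the relations between Hamiltonian
  fields and forms in (a) and (b) (\<open>push_hamiltonian\<close>, \<open>hamiltonian_unique\<close>, \<open>difference_closed\<close>), and
  the isomorphism of classes of Hamiltonian forms (\<open>form_iso\<close>).

  For the converse put \<open>\<Omega>' = \<phi>\<^sup>*\<Omega>2\<close>. By naturality, every locally Hamiltonian (characteristic) field of
  \<open>\<Omega>1\<close> is locally Hamiltonian (characteristic) for \<open>\<Omega>'\<close>. Two degrees suffice.

  In degree \<open>k\<close>, consider in a chart the field dual, for the Euclidean inner product, to the form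
  \<open>\<langle>\<Omega>1, \<Omega>1\<rangle> \<Omega>' - \<langle>\<Omega>1, \<Omega>'\<rangle> \<Omega>1\<close>, cut off by a bump function. Its contraction with \<open>\<Omega>1\<close> vanishes, so it is
  characteristic, and its contraction with \<open>\<Omega>'\<close> vanishes too. This is equality in the Cauchy--Schwarz
  inequality; therefore \<open>\<Omega>' = h \<Omega>1\<close> for a function \<open>h\<close> (\<open>proportional\<close>).

  In degree \<open>k - 1\<close>, 1-nondegeneracy of \<open>\<Omega>1\<close> says that contraction with \<open>\<Omega>1\<close> maps \<open>(k-1)\<close>-vectors onto
  all covectors; a right inverse that depends smoothly on the point is obtained by
  orthogonalisation (\<open>smooth_solve\<close>). So each function \<open>g\<close> with compact support in a chart has a
  Hamiltonian \<open>(k-1)\<close>-vector field. This field is locally Hamiltonian for \<open>\<Omega>'\<close>, that is, \<open>h dg\<close> is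
  closed and \<open>dh \<and> dg = 0\<close> (\<open>H_wedge\<close>). The differentials \<open>dg\<close> exhaust the covectors at a point and the
  dimension is at least 2, so \<open>dh = 0\<close>. As the manifold is connected, \<open>h\<close> is constant.\<close>

section \<open>Calculus of smooth maps\<close>

lemma frechet_derivative_cong_open:
  assumes "open S" "x \<in> S" "\<And>y. y \<in> S \<Longrightarrow> f y = g y"
  shows "frechet_derivative f (at x) = frechet_derivative g (at x)"
proof -
  have "(f has_derivative D) (at x) \<longleftrightarrow> (g has_derivative D) (at x)" for D
    using assms has_derivative_transform_within_open[of f D x UNIV S g]
      has_derivative_transform_within_open[of g D x UNIV S f] by auto
  then show ?thesis unfolding frechet_derivative_def by simp
qed

lemma differentiable_cong_open:
  assumes "open S" "x \<in> S" "\<And>y. y \<in> S \<Longrightarrow> f y = g y" "f differentiable (at x)"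
  shows "g differentiable (at x)"
  using assms has_derivative_transform_within_open[of f _ x UNIV S g]
  unfolding differentiable_def by blast

lemma frechet_derivative_eqI:
  "(f has_derivative D) (at x) \<Longrightarrow> frechet_derivative f (at x) v = D v"
  using frechet_derivative_at by metis

lemma Ck_on_has_derivative:
  "Ck_on (Suc r) S f \<Longrightarrow> x \<in> S \<Longrightarrow> (f has_derivative frechet_derivative f (at x)) (at x)"
  using frechet_derivative_works by auto

lemma Ck_on_mono: "Ck_on (Suc r) S f \<Longrightarrow> Ck_on r S f"
proof (induction r arbitrary: f)
  case 0
  then show ?case
    by (auto intro!: continuous_at_imp_continuous_on differentiable_imp_continuous_within)
next
  case (Suc r)
  then show ?case by (metis Ck_on.simps(2))
qed

lemma Ck_on_subset: "Ck_on r S f \<Longrightarrow> T \<subseteq> S \<Longrightarrow> Ck_on r T f"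
  by (induction r arbitrary: f) (auto intro: continuous_on_subset)

lemma Ck_on_cong:
  "open S \<Longrightarrow> (\<And>x. x \<in> S \<Longrightarrow> f x = g x) \<Longrightarrow> Ck_on r S f \<Longrightarrow> Ck_on r S g"
proof (induction r arbitrary: f g)
  case 0
  then show ?case using continuous_on_cong by (metis Ck_on.simps(1))
next
  case (Suc r)
  have "Ck_on r S (\<lambda>x. frechet_derivative g (at x) v)" for v
  proof (rule Suc.IH[OF Suc.prems(1)])
    show "Ck_on r S (\<lambda>x. frechet_derivative f (at x) v)" using Suc.prems by simp
    show "frechet_derivative f (at x) v = frechet_derivative g (at x) v" if "x \<in> S" for x
      using frechet_derivative_cong_open[OF Suc.prems(1) that] Suc.prems(2) by metis
  qed
  moreover have "g differentiable (at x)" if "x \<in> S" for x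
    using differentiable_cong_open[OF Suc.prems(1) that] Suc.prems(2,3) that
    by (metis Ck_on.simps(2))
  ultimately show ?case by simp
qed

lemma Ck_on_local:
  "(\<And>x. x \<in> S \<Longrightarrow> \<exists>T. open T \<and> x \<in> T \<and> Ck_on r T f) \<Longrightarrow> Ck_on r S f"
proof (induction r arbitrary: f)
  case 0
  then show ?case
    by (auto intro!: continuous_at_imp_continuous_on) (metis continuous_on_eq_continuous_at)
next
  case (Suc r)
  have "Ck_on r S (\<lambda>x. frechet_derivative f (at x) v)" for v
    by (rule Suc.IH) (use Suc.prems in \<open>fastforce simp: Ball_def\<close>)
  moreover have "f differentiable (at x)" if "x \<in> S" for x
    using Suc.prems[OF that] by auto
  ultimately show ?case by simp
qed

lemma Ck_on_const: "Ck_on r S (\<lambda>x. c)"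
  by (induction r arbitrary: c) auto

lemma Ck_on_bounded_linear:
  assumes "bounded_linear f" shows "Ck_on r S f"
proof (cases r)
  case 0
  then show ?thesis using assms linear_continuous_on by auto
next
  case (Suc r')
  have D: "(f has_derivative f) (at x)" for x
    using assms by (simp add: bounded_linear_imp_has_derivative)
  then have "frechet_derivative f (at x) = f" for x using frechet_derivative_at by metis
  with D show ?thesis by (auto simp: Suc Ck_on_const differentiable_def)
qed

lemma Ck_on_add: "open S \<Longrightarrow> Ck_on r S f \<Longrightarrow> Ck_on r S g \<Longrightarrow> Ck_on r S (\<lambda>x. f x + g x)"
proof (induction r arbitrary: f g)
  case 0
  then show ?case by (auto intro: continuous_on_add)
next
  case (Suc r)
  have D: "((\<lambda>x. f x + g x) has_derivative
      (\<lambda>v. frechet_derivative f (at x) v + frechet_derivative g (at x) v)) (at x)" if "x \<in> S" for x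
    by (intro has_derivative_add Ck_on_has_derivative[OF Suc.prems(2) that]
        Ck_on_has_derivative[OF Suc.prems(3) that])
  have "Ck_on r S (\<lambda>x. frechet_derivative (\<lambda>x. f x + g x) (at x) v)" for v
    by (rule Ck_on_cong[OF Suc.prems(1) _ Suc.IH])
      (use Suc.prems in \<open>auto simp: frechet_derivative_eqI[OF D]\<close>)
  then show ?case using D by (auto simp: differentiable_def)
qed

lemma (in bounded_bilinear) Ck_on:
  "open S \<Longrightarrow> Ck_on r S f \<Longrightarrow> Ck_on r S g \<Longrightarrow> Ck_on r S (\<lambda>x. prod (f x) (g x))"
proof (induction r arbitrary: f g)
  case 0
  then show ?case by (auto intro: continuous_on)
next
  case (Suc r)
  have D: "((\<lambda>x. prod (f x) (g x)) has_derivative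
      (\<lambda>v. prod (f x) (frechet_derivative g (at x) v) + prod (frechet_derivative f (at x) v) (g x))) (at x)"
    if "x \<in> S" for x
    by (intro FDERIV Ck_on_has_derivative[OF Suc.prems(2) that]
        Ck_on_has_derivative[OF Suc.prems(3) that])
  have "Ck_on r S (\<lambda>x. prod (f x) (frechet_derivative g (at x) v) + prod (frechet_derivative f (at x) v) (g x))"
    for v
    by (intro Ck_on_add Suc.IH Suc.prems(1) Ck_on_mono[OF Suc.prems(2)] Ck_on_mono[OF Suc.prems(3)])
      (use Suc.prems in auto)
  then have "Ck_on r S (\<lambda>x. frechet_derivative (\<lambda>x. prod (f x) (g x)) (at x) v)" for v
    by (rule Ck_on_cong[rotated 2, OF _ Suc.prems(1)]) (auto simp: frechet_derivative_eqI[OF D])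
  then show ?case using D by (auto simp: differentiable_def)
qed

lemma Ck_on_sum:
  assumes "open S" "\<And>i. i \<in> A \<Longrightarrow> Ck_on r S (f i)"
  shows "Ck_on r S (\<lambda>x. \<Sum>i\<in>A. f i x)"
  using assms by (induction A rule: infinite_finite_induct) (auto simp: Ck_on_const intro!: Ck_on_add)

lemma linear_expand_Basis:
  fixes L :: "'v::euclidean_space \<Rightarrow> 'c::real_normed_vector"
  assumes "linear L" shows "L v = (\<Sum>b\<in>Basis. (v \<bullet> b) *\<^sub>R L b)"
  using assms by (metis (no_types, lifting) euclidean_representation linear_scale linear_sum sum.cong)

text \<open>By the chain rule, a directional derivative of \<open>g \<circ> f\<close> is a finite sum of products of directional
  derivatives of \<open>f\<close> with directional derivatives of \<open>g\<close> along basis vectors, the latter composed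
  with \<open>f\<close>. Each factor is one degree less differentiable, so the induction on the order closes.\<close>

lemma Ck_on_comp:
  fixes g :: "'v::euclidean_space \<Rightarrow> 'c::real_normed_vector" and f :: "'a::real_normed_vector \<Rightarrow> 'v"
  shows "open S \<Longrightarrow> open T \<Longrightarrow> f ` S \<subseteq> T \<Longrightarrow> Ck_on r S f \<Longrightarrow> Ck_on r T g \<Longrightarrow> Ck_on r S (\<lambda>x. g (f x))"
proof (induction r arbitrary: g)
  case 0
  then show ?case by (auto intro: continuous_on_compose2)
next
  case (Suc r)
  let ?Df = "\<lambda>x. frechet_derivative f (at x)" and ?Dg = "\<lambda>y. frechet_derivative g (at y)"
  have gd: "g differentiable (at (f x))" if "x \<in> S" for x using Suc.prems that by auto
  have D: "((\<lambda>x. g (f x)) has_derivative (\<lambda>v. ?Dg (f x) (?Df x v))) (at x)" if "x \<in> S" for x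
    using diff_chain_at[OF Ck_on_has_derivative[OF Suc.prems(4) that]
        gd[OF that, unfolded frechet_derivative_works]] by (simp add: o_def)
  have E: "?Dg (f x) (?Df x v) = (\<Sum>b\<in>Basis. (?Df x v \<bullet> b) *\<^sub>R ?Dg (f x) b)" if "x \<in> S" for x v
    by (rule linear_expand_Basis) (use gd[OF that] in \<open>rule linear_frechet_derivative\<close>)
  have "Ck_on r S (\<lambda>x. frechet_derivative (\<lambda>x. g (f x)) (at x) v)" for v
  proof (rule Ck_on_cong[OF Suc.prems(1)])
    show "Ck_on r S (\<lambda>x. \<Sum>b\<in>Basis. (?Df x v \<bullet> b) *\<^sub>R ?Dg (f x) b)"
    proof (intro Ck_on_sum bounded_bilinear.Ck_on[OF bounded_bilinear_scaleR] Suc.prems(1))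
      fix b :: 'v
      show "Ck_on r S (\<lambda>x. ?Df x v \<bullet> b)"
        by (rule bounded_bilinear.Ck_on[OF bounded_bilinear_inner])
          (use Suc.prems in \<open>auto simp: Ck_on_const\<close>)
      show "Ck_on r S (\<lambda>x. ?Dg (f x) b)"
        by (rule Suc.IH[OF Suc.prems(1-3) Ck_on_mono[OF Suc.prems(4)]]) (use Suc.prems in auto)
    qed
  qed (auto simp: frechet_derivative_eqI[OF D] E)
  then show ?case using D by (auto simp: differentiable_def)
qed

lemma Ck_on_inverse:
  fixes f :: "'a::real_normed_vector \<Rightarrow> real"
  shows "open S \<Longrightarrow> (\<And>x. x \<in> S \<Longrightarrow> f x \<noteq> 0) \<Longrightarrow> Ck_on r S f \<Longrightarrow> Ck_on r S (\<lambda>x. inverse (f x))"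
proof (induction r)
  case 0
  then show ?case by (auto intro!: continuous_on_inverse)
next
  case (Suc r)
  have D: "((\<lambda>x. inverse (f x)) has_derivative
      (\<lambda>v. - (inverse (f x) * frechet_derivative f (at x) v * inverse (f x)))) (at x)" if "x \<in> S" for x
    by (rule Deriv.has_derivative_inverse[OF Suc.prems(2)[OF that] Ck_on_has_derivative[OF Suc.prems(3) that]])
  have I: "Ck_on r S (\<lambda>x. inverse (f x))"
    using Suc Ck_on_mono by blast
  have "Ck_on r S (\<lambda>x. (-1) * (inverse (f x) * frechet_derivative f (at x) v * inverse (f x)))" for v
    by (intro bounded_bilinear.Ck_on[OF bounded_bilinear_mult] I Suc.prems(1) Ck_on_const)
      (use Suc.prems in auto)
  then have "Ck_on r S (\<lambda>x. frechet_derivative (\<lambda>x. inverse (f x)) (at x) v)" for v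
    by (rule Ck_on_cong[rotated 2, OF _ Suc.prems(1)]) (auto simp: frechet_derivative_eqI[OF D])
  then show ?case using D by (auto simp: differentiable_def)
qed

lemma smooth_on_subset: "smooth_on S f \<Longrightarrow> T \<subseteq> S \<Longrightarrow> smooth_on T f"
  unfolding smooth_on_def using Ck_on_subset by blast

lemma smooth_on_cong:
  "open S \<Longrightarrow> (\<And>x. x \<in> S \<Longrightarrow> f x = g x) \<Longrightarrow> smooth_on S f \<Longrightarrow> smooth_on S g"
  unfolding smooth_on_def using Ck_on_cong by blast

lemma smooth_on_local:
  assumes "\<And>x. x \<in> S \<Longrightarrow> \<exists>T. open T \<and> x \<in> T \<and> smooth_on T f"
  shows "smooth_on S f"
  unfolding smooth_on_def
proof
  fix r show "Ck_on r S f"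
    by (rule Ck_on_local) (use assms in \<open>auto simp: smooth_on_def\<close>)
qed

lemma smooth_on_const [simp]: "smooth_on S (\<lambda>x. c)"
  by (simp add: smooth_on_def Ck_on_const)

lemma smooth_on_bounded_linear: "bounded_linear f \<Longrightarrow> smooth_on S f"
  by (simp add: smooth_on_def Ck_on_bounded_linear)

lemma smooth_on_add:
  "open S \<Longrightarrow> smooth_on S f \<Longrightarrow> smooth_on S g \<Longrightarrow> smooth_on S (\<lambda>x. f x + g x)"
  by (simp add: smooth_on_def Ck_on_add)

lemma smooth_on_mult:
  fixes f g :: "'a::real_normed_vector \<Rightarrow> real"
  shows "open S \<Longrightarrow> smooth_on S f \<Longrightarrow> smooth_on S g \<Longrightarrow> smooth_on S (\<lambda>x. f x * g x)"
  by (simp add: smooth_on_def bounded_bilinear.Ck_on[OF bounded_bilinear_mult])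

lemma smooth_on_scaleR:
  "open S \<Longrightarrow> smooth_on S f \<Longrightarrow> smooth_on S g \<Longrightarrow> smooth_on S (\<lambda>x. f x *\<^sub>R g x)"
  by (simp add: smooth_on_def bounded_bilinear.Ck_on[OF bounded_bilinear_scaleR])

lemma smooth_on_inner:
  "open S \<Longrightarrow> smooth_on S f \<Longrightarrow> smooth_on S g \<Longrightarrow> smooth_on S (\<lambda>x. f x \<bullet> g x)"
  by (simp add: smooth_on_def bounded_bilinear.Ck_on[OF bounded_bilinear_inner])

lemma smooth_on_sum:
  "open S \<Longrightarrow> (\<And>i. i \<in> A \<Longrightarrow> smooth_on S (f i)) \<Longrightarrow> smooth_on S (\<lambda>x. \<Sum>i\<in>A. f i x)"
  by (simp add: smooth_on_def Ck_on_sum)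

lemma smooth_on_prod:
  fixes f :: "'i \<Rightarrow> 'a::real_normed_vector \<Rightarrow> real"
  assumes "open S" "\<And>i. i \<in> A \<Longrightarrow> smooth_on S (f i)"
  shows "smooth_on S (\<lambda>x. \<Prod>i\<in>A. f i x)"
  using assms by (induction A rule: infinite_finite_induct) (auto intro!: smooth_on_mult)

lemma smooth_on_diff:
  fixes f g :: "'a::real_normed_vector \<Rightarrow> real"
  shows "open S \<Longrightarrow> smooth_on S f \<Longrightarrow> smooth_on S g \<Longrightarrow> smooth_on S (\<lambda>x. f x - g x)"
  using smooth_on_add[of S f "\<lambda>x. (-1) * g x"] smooth_on_mult[of S "\<lambda>x. -1" g] by simp

lemma smooth_on_inverse:
  fixes f :: "'a::real_normed_vector \<Rightarrow> real"
  shows "open S \<Longrightarrow> (\<And>x. x \<in> S \<Longrightarrow> f x \<noteq> 0) \<Longrightarrow> smooth_on S f \<Longrightarrow> smooth_on S (\<lambda>x. inverse (f x))"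
  by (simp add: smooth_on_def Ck_on_inverse)

lemma smooth_on_comp:
  fixes g :: "'v::euclidean_space \<Rightarrow> 'c::real_normed_vector" and f :: "'a::real_normed_vector \<Rightarrow> 'v"
  shows "open S \<Longrightarrow> open T \<Longrightarrow> f ` S \<subseteq> T \<Longrightarrow> smooth_on S f \<Longrightarrow> smooth_on T g \<Longrightarrow> smooth_on S (\<lambda>x. g (f x))"
  unfolding smooth_on_def using Ck_on_comp by blast

lemma smooth_on_differentiable: "smooth_on S f \<Longrightarrow> x \<in> S \<Longrightarrow> f differentiable (at x)"
  unfolding smooth_on_def by (metis Ck_on.simps(2))

lemma smooth_on_has_derivative:
  "smooth_on S f \<Longrightarrow> x \<in> S \<Longrightarrow> (f has_derivative frechet_derivative f (at x)) (at x)"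
  using smooth_on_differentiable frechet_derivative_works by blast

lemma smooth_on_deriv: "smooth_on S f \<Longrightarrow> smooth_on S (\<lambda>x. frechet_derivative f (at x) v)"
  unfolding smooth_on_def by (metis Ck_on.simps(2))

lemma smooth_on_continuous: "smooth_on S f \<Longrightarrow> continuous_on S f"
  unfolding smooth_on_def by (metis Ck_on.simps(1))

text \<open>Both second-order mixed derivatives are the limit of the same second difference quotient,
  by two applications of the mean value theorem.\<close>

lemma second_difference_mvt:
  fixes f :: "'v::euclidean_space \<Rightarrow> real"
  assumes f: "smooth_on S f" and s: "0 < s"
    and seg: "\<And>a b. 0 \<le> a \<Longrightarrow> a \<le> s \<Longrightarrow> 0 \<le> b \<Longrightarrow> b \<le> s \<Longrightarrow> p + a *\<^sub>R v + b *\<^sub>R w \<in> S"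
  obtains a b where "0 \<le> a" "a \<le> s" "0 \<le> b" "b \<le> s"
    "f (p + s *\<^sub>R v + s *\<^sub>R w) - f (p + s *\<^sub>R v) - f (p + s *\<^sub>R w) + f p =
     s^2 * frechet_derivative (\<lambda>x. frechet_derivative f (at x) v) (at (p + a *\<^sub>R v + b *\<^sub>R w)) w"
proof -
  let ?D = "\<lambda>x. frechet_derivative f (at x)"
  let ?g = "\<lambda>a. f (p + a *\<^sub>R v + s *\<^sub>R w) - f (p + a *\<^sub>R v)"
  have der: "((\<lambda>a. f (p + a *\<^sub>R v + b *\<^sub>R w)) has_real_derivative ?D (p + a *\<^sub>R v + b *\<^sub>R w) v) (at a)"
    if "0 \<le> a" "a \<le> s" "0 \<le> b" "b \<le> s" for a b
  proof -
    have h: "(f has_derivative ?D (p + a *\<^sub>R v + b *\<^sub>R w)) (at (p + a *\<^sub>R v + b *\<^sub>R w))"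
      using smooth_on_has_derivative[OF f seg] that by blast
    have "((\<lambda>a. p + a *\<^sub>R v + b *\<^sub>R w) has_derivative (\<lambda>h. h *\<^sub>R v)) (at a)"
      by (auto intro!: derivative_eq_intros)
    from has_derivative_compose[OF this, of f] h
    have "((\<lambda>a. f (p + a *\<^sub>R v + b *\<^sub>R w)) has_derivative (\<lambda>h. ?D (p + a *\<^sub>R v + b *\<^sub>R w) (h *\<^sub>R v))) (at a)"
      by blast
    moreover have "?D (p + a *\<^sub>R v + b *\<^sub>R w) (h *\<^sub>R v) = ?D (p + a *\<^sub>R v + b *\<^sub>R w) v * h" for h
      using linear_scale[OF has_derivative_linear[OF h]] by (simp add: mult.commute)
    ultimately show ?thesis by (simp add: has_field_derivative_def)
  qed
  have der2: "((\<lambda>b. ?D (p + a *\<^sub>R v + b *\<^sub>R w) v) has_real_derivative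
      frechet_derivative (\<lambda>x. ?D x v) (at (p + a *\<^sub>R v + b *\<^sub>R w)) w) (at b)"
    if "0 \<le> a" "a \<le> s" "0 \<le> b" "b \<le> s" for a b
  proof -
    let ?D2 = "frechet_derivative (\<lambda>x. ?D x v) (at (p + a *\<^sub>R v + b *\<^sub>R w))"
    have h: "((\<lambda>x. ?D x v) has_derivative ?D2) (at (p + a *\<^sub>R v + b *\<^sub>R w))"
      using smooth_on_has_derivative[OF smooth_on_deriv[OF f] seg] that by simp
    have "((\<lambda>b. p + a *\<^sub>R v + b *\<^sub>R w) has_derivative (\<lambda>h. h *\<^sub>R w)) (at b)"
      by (auto intro!: derivative_eq_intros)
    from has_derivative_compose[OF this, of "\<lambda>x. ?D x v"] h
    have "((\<lambda>b. ?D (p + a *\<^sub>R v + b *\<^sub>R w) v) has_derivative (\<lambda>h. ?D2 (h *\<^sub>R w))) (at b)"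
      by blast
    moreover have "?D2 (h *\<^sub>R w) = ?D2 w * h" for h
      using linear_scale[OF has_derivative_linear[OF h]] by (simp add: mult.commute)
    ultimately show ?thesis by (simp add: has_field_derivative_def)
  qed
  have "\<exists>z>0. z < s \<and> ?g s - ?g 0 = (s - 0) * (?D (p + z *\<^sub>R v + s *\<^sub>R w) v - ?D (p + z *\<^sub>R v) v)"
    by (rule MVT2[OF s]) (use der[where b=s] der[where b=0] s in \<open>auto intro!: DERIV_diff\<close>)
  then obtain a where a: "0 < a" "a < s"
    "?g s - ?g 0 = s * (?D (p + a *\<^sub>R v + s *\<^sub>R w) v - ?D (p + a *\<^sub>R v) v)" by auto
  have "\<exists>z>0. z < s \<and> ?D (p + a *\<^sub>R v + s *\<^sub>R w) v - ?D (p + a *\<^sub>R v + 0 *\<^sub>R w) v =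
      (s - 0) * frechet_derivative (\<lambda>x. ?D x v) (at (p + a *\<^sub>R v + z *\<^sub>R w)) w"
    by (rule MVT2[OF s]) (use der2[of a] a in auto)
  then obtain b where b: "0 < b" "b < s" "?D (p + a *\<^sub>R v + s *\<^sub>R w) v - ?D (p + a *\<^sub>R v) v =
      s * frechet_derivative (\<lambda>x. ?D x v) (at (p + a *\<^sub>R v + b *\<^sub>R w)) w" by auto
  show ?thesis
    by (rule that[of a b]) (use a b in \<open>auto simp: power2_eq_square algebra_simps\<close>)
qed

lemma mixed_derivatives_symmetric_real:
  fixes f :: "'v::euclidean_space \<Rightarrow> real"
  assumes "open S" "p \<in> S" and f: "smooth_on S f"
  shows "frechet_derivative (\<lambda>x. frechet_derivative f (at x) v) (at p) w =
    frechet_derivative (\<lambda>x. frechet_derivative f (at x) w) (at p) v" (is "?A v w p = ?A w v p")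
proof (rule ccontr)
  assume ne: "?A v w p \<noteq> ?A w v p"
  define e where "e = \<bar>?A v w p - ?A w v p\<bar> / 2"
  have e: "0 < e" using ne by (simp add: e_def)
  have cont: "isCont (?A v w) p" for v w
    using smooth_on_continuous[OF smooth_on_deriv[OF smooth_on_deriv[OF f]]] assms
      continuous_on_eq_continuous_at by blast
  obtain d1 where d1: "0 < d1" "\<And>x. dist x p < d1 \<Longrightarrow> \<bar>?A v w x - ?A v w p\<bar> < e"
    using cont[of v w] e unfolding continuous_at_eps_delta dist_real_def by blast
  obtain d2 where d2: "0 < d2" "\<And>x. dist x p < d2 \<Longrightarrow> \<bar>?A w v x - ?A w v p\<bar> < e"
    using cont[of w v] e unfolding continuous_at_eps_delta dist_real_def by blast
  obtain d3 where d3: "0 < d3" "ball p d3 \<subseteq> S" using assms openE by blast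
  define d where "d = min d1 (min d2 d3)"
  \<comment> \<open>a parallelogram with sides \<open>s v\<close> and \<open>s w\<close> stays within distance \<open>d\<close> of \<open>p\<close>\<close>
  define s where "s = d / (2 * (norm v + norm w + 1))"
  have s: "0 < s" using d1 d2 d3 by (auto simp: s_def d_def add_nonneg_pos)
  have near: "dist (p + a *\<^sub>R v + b *\<^sub>R w) p < d" if "0 \<le> a" "a \<le> s" "0 \<le> b" "b \<le> s" for a b
  proof -
    have "norm (a *\<^sub>R v + b *\<^sub>R w) \<le> a * norm v + b * norm w"
      using norm_triangle_ineq[of "a *\<^sub>R v" "b *\<^sub>R w"] that by simp
    also have "\<dots> \<le> s * norm v + s * norm w"
      using that by (intro add_mono mult_right_mono) auto
    also have "\<dots> \<le> s * (norm v + norm w + 1)" using s by (simp add: algebra_simps)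
    also have "\<dots> = d / 2"
    proof -
      have "norm v + norm w + 1 \<noteq> 0" using norm_ge_zero[of v] norm_ge_zero[of w] by linarith
      then show ?thesis by (simp add: s_def divide_simps)
    qed
    also have "\<dots> < d" using d1 d2 d3 by (auto simp: d_def)
    finally show ?thesis by (simp add: dist_norm add.assoc)
  qed
  have in_S: "p + a *\<^sub>R v + b *\<^sub>R w \<in> S" if "0 \<le> a" "a \<le> s" "0 \<le> b" "b \<le> s" for a b
    using near[OF that] d3 by (auto simp: d_def dist_commute)
  obtain a b where ab: "0 \<le> a" "a \<le> s" "0 \<le> b" "b \<le> s"
    and 1: "f (p + s *\<^sub>R v + s *\<^sub>R w) - f (p + s *\<^sub>R v) - f (p + s *\<^sub>R w) + f p =
      s^2 * ?A v w (p + a *\<^sub>R v + b *\<^sub>R w)"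
    by (rule second_difference_mvt[OF f s in_S])
  have in_S': "p + a *\<^sub>R w + b *\<^sub>R v \<in> S" if "0 \<le> a" "a \<le> s" "0 \<le> b" "b \<le> s" for a b
    using in_S[of b a] that by (simp add: algebra_simps)
  obtain a' b' where ab': "0 \<le> a'" "a' \<le> s" "0 \<le> b'" "b' \<le> s"
    and 2: "f (p + s *\<^sub>R w + s *\<^sub>R v) - f (p + s *\<^sub>R w) - f (p + s *\<^sub>R v) + f p =
      s^2 * ?A w v (p + a' *\<^sub>R w + b' *\<^sub>R v)"
    by (rule second_difference_mvt[OF f s in_S'])
  have "s^2 * ?A v w (p + a *\<^sub>R v + b *\<^sub>R w) = s^2 * ?A w v (p + b' *\<^sub>R v + a' *\<^sub>R w)"
    using 1 2 by (simp add: algebra_simps)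
  then have "?A v w (p + a *\<^sub>R v + b *\<^sub>R w) = ?A w v (p + b' *\<^sub>R v + a' *\<^sub>R w)" using s by simp
  moreover have "\<bar>?A v w (p + a *\<^sub>R v + b *\<^sub>R w) - ?A v w p\<bar> < e"
    using near[OF ab] by (intro d1) (simp add: d_def)
  moreover have "\<bar>?A w v (p + b' *\<^sub>R v + a' *\<^sub>R w) - ?A w v p\<bar> < e"
    using near[of b' a'] ab' by (intro d2) (simp add: d_def)
  ultimately have "\<bar>?A v w p - ?A w v p\<bar> < e + e" by linarith
  then show False by (simp add: e_def)
qed

lemma mixed_derivatives_symmetric:
  fixes f :: "'v::euclidean_space \<Rightarrow> 'w::euclidean_space"
  assumes S: "open S" "p \<in> S" and f: "smooth_on S f"
  shows "frechet_derivative (\<lambda>x. frechet_derivative f (at x) v) (at p) w =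
    frechet_derivative (\<lambda>x. frechet_derivative f (at x) w) (at p) v"
proof (rule euclidean_eqI)
  fix b :: 'w
  have D1: "frechet_derivative (\<lambda>x. f x \<bullet> b) (at x) u = frechet_derivative f (at x) u \<bullet> b" if "x \<in> S" for x u
    by (rule frechet_derivative_eqI[OF has_derivative_inner_left[OF smooth_on_has_derivative[OF f that]]])
  have D2: "frechet_derivative (\<lambda>x. frechet_derivative (\<lambda>x. f x \<bullet> b) (at x) u) (at p) u' =
    frechet_derivative (\<lambda>x. frechet_derivative f (at x) u) (at p) u' \<bullet> b" for u u'
  proof -
    have "frechet_derivative (\<lambda>x. frechet_derivative (\<lambda>x. f x \<bullet> b) (at x) u) (at p) u' =
        frechet_derivative (\<lambda>x. frechet_derivative f (at x) u \<bullet> b) (at p) u'"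
      by (rule fun_cong[OF frechet_derivative_cong_open[OF S]]) (rule D1)
    also have "\<dots> = frechet_derivative (\<lambda>x. frechet_derivative f (at x) u) (at p) u' \<bullet> b"
      by (rule frechet_derivative_eqI[OF has_derivative_inner_left[OF
          smooth_on_has_derivative[OF smooth_on_deriv[OF f] S(2)]]])
    finally show ?thesis .
  qed
  have "smooth_on S (\<lambda>x. f x \<bullet> b)" by (intro smooth_on_inner S f) simp
  from mixed_derivatives_symmetric_real[OF S this] D2
  show "frechet_derivative (\<lambda>x. frechet_derivative f (at x) v) (at p) w \<bullet> b =
    frechet_derivative (\<lambda>x. frechet_derivative f (at x) w) (at p) v \<bullet> b" by simp
qed

section \<open>Multilinear functions of lists\<close>

definition multilinear :: "nat \<Rightarrow> ('v::real_vector list \<Rightarrow> real) \<Rightarrow> bool" where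
  "multilinear m t \<longleftrightarrow> (\<forall>vs i. length vs = m \<longrightarrow> i < m \<longrightarrow> linear (\<lambda>u. t (vs[i := u])))"

lemma alternating_multilinear: "alternating r t \<Longrightarrow> multilinear r t"
  by (simp add: alternating_def multilinear_def)

lemma alternating_wrong_length: "alternating r t \<Longrightarrow> length vs \<noteq> r \<Longrightarrow> t vs = 0"
  by (simp add: alternating_def)

lemma alternating_not_distinct: "alternating r t \<Longrightarrow> \<not> distinct vs \<Longrightarrow> t vs = 0"
  by (simp add: alternating_def)

lemma alternating_slot: "alternating r t \<Longrightarrow> length vs = r \<Longrightarrow> i < r \<Longrightarrow> linear (\<lambda>u. t (vs[i := u]))"
  by (simp add: alternating_def)

lemma alternating_zero: "alternating r (\<lambda>vs. 0)"
  by (simp add: alternating_def linear_zero)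

lemma alternating_linear_map:
  fixes L :: "'v::real_vector \<Rightarrow> 'w::real_vector"
  assumes "alternating r t" "linear L"
  shows "alternating r (\<lambda>vs. t (map L vs))"
  unfolding alternating_def
proof (intro conjI allI impI)
  fix vs :: "'v list" assume "length vs \<noteq> r"
  then show "t (map L vs) = 0" by (intro alternating_wrong_length[OF assms(1)]) simp
next
  fix vs :: "'v list" and i assume vs: "length vs = r" "i < r"
  have "linear ((\<lambda>u. t ((map L vs)[i := u])) \<circ> L)"
    by (rule linear_compose[OF assms(2) alternating_slot[OF assms(1)]]) (use vs in auto)
  then show "linear (\<lambda>u. t (map L (vs[i := u])))" by (simp add: map_update o_def)
next
  fix vs :: "'v list" assume "\<not> distinct vs"
  then show "t (map L vs) = 0" by (intro alternating_not_distinct[OF assms(1)]) (auto simp: distinct_map)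
qed

lemma alternating_add:
  assumes "alternating r s" "alternating r t" shows "alternating r (\<lambda>vs. s vs + t vs)"
  using assms unfolding alternating_def by (auto intro!: linear_compose_add)

lemma alternating_cmult:
  assumes "alternating r t" shows "alternating r (\<lambda>vs. c * t vs)"
proof -
  have "linear (\<lambda>u. c * t (vs[i := u]))" if "length vs = r" "i < r" for vs i
    using linear_compose_scale_right[OF alternating_slot[OF assms that], of c] by simp
  then show ?thesis using assms unfolding alternating_def by auto
qed

lemma alternating_diff:
  assumes "alternating r s" "alternating r t" shows "alternating r (\<lambda>vs. s vs - t vs)"
  using alternating_add[OF assms(1) alternating_cmult[OF assms(2), of "-1"]] by simp

text \<open>Polarisation of the fact that the form vanishes on a list with two equal adjacent entries.\<close>

lemma alternating_swap_adjacent: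
  assumes "alternating r t" "length xs + length ys + 2 = r"
  shows "t (xs @ a # b # ys) = - t (xs @ b # a # ys)"
proof -
  let ?g = "\<lambda>u v. t (xs @ u # v # ys)"
  let ?n = "length xs"
  have u1: "(xs @ u # v # ys)[?n := w] = xs @ w # v # ys" for u v w by (simp add: list_update_append)
  have u2: "(xs @ u # v # ys)[Suc ?n := w] = xs @ u # w # ys" for u v w by (simp add: list_update_append)
  have l1: "linear (\<lambda>u. ?g u v)" for v
    using alternating_slot[OF assms(1), of "xs @ a # v # ys" ?n] assms(2) by (simp add: u1)
  have l2: "linear (\<lambda>v. ?g u v)" for u
    using alternating_slot[OF assms(1), of "xs @ u # b # ys" "Suc ?n"] assms(2) by (simp add: u2)
  have diag: "?g u u = 0" for u by (rule alternating_not_distinct[OF assms(1)]) simp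
  have "?g (a + b) (a + b) = ?g a a + ?g a b + (?g b a + ?g b b)"
    using linear_add[OF l1] linear_add[OF l2] by simp
  then show ?thesis by (simp add: diag)
qed

lemma alternating_move:
  assumes "alternating r t" "length xs + length ys + length zs + 1 = r"
  shows "t (xs @ v # ys @ zs) = (-1) ^ length ys * t (xs @ ys @ v # zs)"
  using assms(2)
proof (induction ys arbitrary: xs)
  case (Cons y ys)
  have "t (xs @ v # y # ys @ zs) = - t (xs @ y # v # ys @ zs)"
    by (rule alternating_swap_adjacent[OF assms(1)]) (use Cons.prems in auto)
  also have "t (xs @ y # v # ys @ zs) = (-1) ^ length ys * t (xs @ y # ys @ v # zs)"
    using Cons.IH[of "xs @ [y]"] Cons.prems by simp
  finally show ?case by simp
qed simp

definition basis_lists :: "nat \<Rightarrow> 'v::euclidean_space list set" where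
  "basis_lists m = {bs. set bs \<subseteq> Basis \<and> length bs = m}"

text \<open>The coefficient of \<open>cs\<close> in the expansion of a multilinear function at \<open>vs\<close>, that is, the value of
  the tensor product of the entries of \<open>vs\<close> on \<open>cs\<close>.\<close>

definition list_inner :: "'v::real_inner list \<Rightarrow> 'v list \<Rightarrow> real" where
  "list_inner vs cs = (\<Prod>i<length cs. vs ! i \<bullet> cs ! i)"

lemma finite_basis_lists [simp]: "finite (basis_lists m)"
  unfolding basis_lists_def by (rule finite_lists_length_eq) simp

lemma length_basis_lists: "cs \<in> basis_lists m \<Longrightarrow> length cs = m"
  by (simp add: basis_lists_def)

lemma basis_lists_0 [simp]: "basis_lists 0 = {[]}"
  by (auto simp: basis_lists_def)

lemma sum_basis_lists_Suc:
  "(\<Sum>cs\<in>basis_lists (Suc m). g cs) = (\<Sum>b\<in>Basis. \<Sum>cs\<in>basis_lists m. g (b # cs))"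
proof -
  have "bij_betw (\<lambda>(b, cs). b # cs) (Basis \<times> basis_lists m) (basis_lists (Suc m))"
    unfolding bij_betw_def basis_lists_def
    by (auto simp: inj_on_def image_iff length_Suc_conv)
  from sum.reindex_bij_betw[OF this, of g]
  have "(\<Sum>cs\<in>basis_lists (Suc m). g cs) = (\<Sum>(b, cs)\<in>Basis \<times> basis_lists m. g (b # cs))"
    by (simp add: case_prod_unfold)
  then show ?thesis by (simp add: sum.cartesian_product)
qed

lemma multilinear_Cons: "multilinear (Suc m) t \<Longrightarrow> multilinear m (\<lambda>vs. t (v # vs))"
  unfolding multilinear_def
proof (intro allI impI)
  fix vs :: "'a list" and i
  assume t: "\<forall>vs i. length vs = Suc m \<longrightarrow> i < Suc m \<longrightarrow> linear (\<lambda>u. t (vs[i := u]))"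
    and "length vs = m" "i < m"
  then have "linear (\<lambda>u. t ((v # vs)[Suc i := u]))" by (intro t[rule_format]) auto
  then show "linear (\<lambda>u. t (v # vs[i := u]))" by simp
qed

text \<open>This reduces the calculus of fields of multilinear functions to finitely many component
  functions.\<close>

lemma multilinear_expand:
  assumes "multilinear m t" "length vs = m"
  shows "t vs = (\<Sum>cs\<in>basis_lists m. list_inner vs cs * t cs)"
  using assms
proof (induction m arbitrary: t vs)
  case 0
  then show ?case by (simp add: list_inner_def)
next
  case (Suc m)
  then obtain v vs' where vs: "vs = v # vs'" "length vs' = m" by (auto simp: length_Suc_conv)
  have "linear (\<lambda>u. t (vs[0 := u]))" using Suc.prems unfolding multilinear_def by blast
  then have lin: "linear (\<lambda>u. t (u # vs'))" by (simp add: vs)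
  have "t vs = (\<Sum>b\<in>Basis. (v \<bullet> b) * t (b # vs'))"
    using linear_expand_Basis[OF lin, of v] vs by simp
  also have "\<dots> = (\<Sum>b\<in>Basis. (v \<bullet> b) * (\<Sum>cs\<in>basis_lists m. list_inner vs' cs * t (b # cs)))"
    by (simp add: Suc.IH[OF multilinear_Cons[OF Suc.prems(1)] vs(2)])
  also have "\<dots> = (\<Sum>b\<in>Basis. \<Sum>cs\<in>basis_lists m. list_inner vs (b # cs) * t (b # cs))"
    by (simp add: sum_distrib_left list_inner_def vs prod.lessThan_Suc_shift mult.assoc del: prod.lessThan_Suc)
  finally show ?case by (simp add: sum_basis_lists_Suc)
qed

lemma list_inner_update:
  assumes "i < length cs" "length vs = length cs"
  shows "list_inner (vs[i := u]) cs = (u \<bullet> cs ! i) * (\<Prod>j\<in>{..<length cs} - {i}. vs ! j \<bullet> cs ! j)"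
proof -
  have "list_inner (vs[i := u]) cs =
      (vs[i := u] ! i \<bullet> cs ! i) * (\<Prod>j\<in>{..<length cs} - {i}. vs[i := u] ! j \<bullet> cs ! j)"
    unfolding list_inner_def using assms by (subst prod.remove[of _ i]) auto
  also have "(\<Prod>j\<in>{..<length cs} - {i}. vs[i := u] ! j \<bullet> cs ! j) = (\<Prod>j\<in>{..<length cs} - {i}. vs ! j \<bullet> cs ! j)"
    by (rule prod.cong) auto
  finally show ?thesis using assms by simp
qed

text \<open>Product rule: one term for the dependence of \<open>t\<close> on the point, and one for each slot. As \<open>t\<close> is
  determined by its values on basis lists, only these have to be differentiable; the first term is
  written as their expansion.\<close>

lemma multilinear_has_derivative:
  fixes t :: "'x::real_normed_vector \<Rightarrow> 'w::euclidean_space list \<Rightarrow> real"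
  assumes S: "open S" "x \<in> S" and ml: "\<And>z. z \<in> S \<Longrightarrow> multilinear m (t z)"
    and T: "\<And>cs. cs \<in> basis_lists m \<Longrightarrow> ((\<lambda>z. t z cs) has_derivative t' cs) (at x)"
    and m: "length ls = m" and L: "\<And>i. i < m \<Longrightarrow> (ls ! i has_derivative l' i) (at x)"
  defines "us \<equiv> map (\<lambda>l. l x) ls"
  shows "((\<lambda>z. t z (map (\<lambda>l. l z) ls)) has_derivative
    (\<lambda>h. (\<Sum>cs\<in>basis_lists m. list_inner us cs * t' cs h) + (\<Sum>i<m. t x (us[i := l' i h])))) (at x)"
proof -
  have us: "length us = m" using m by (simp add: us_def)
  have li: "((\<lambda>z. list_inner (map (\<lambda>l. l z) ls) cs) has_derivative
      (\<lambda>h. \<Sum>i<m. list_inner (us[i := l' i h]) cs)) (at x)" if "cs \<in> basis_lists m" for cs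
  proof -
    have cs: "length cs = m" using that length_basis_lists by blast
    have "((\<lambda>z. \<Prod>i<m. (ls ! i) z \<bullet> cs ! i) has_derivative
        (\<lambda>h. \<Sum>i<m. (l' i h \<bullet> cs ! i) * (\<Prod>j\<in>{..<m} - {i}. (ls ! j) x \<bullet> cs ! j))) (at x)"
      by (rule has_derivative_prod) (auto intro!: has_derivative_inner_left L)
    moreover have "(\<Prod>i<m. (ls ! i) z \<bullet> cs ! i) = list_inner (map (\<lambda>l. l z) ls) cs" for z
      unfolding list_inner_def cs using m by (intro prod.cong) auto
    moreover have "(l' i h \<bullet> cs ! i) * (\<Prod>j\<in>{..<m} - {i}. (ls ! j) x \<bullet> cs ! j) =
        list_inner (us[i := l' i h]) cs" if "i < m" for i h
      using that m cs us by (subst list_inner_update) (auto simp: us_def)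
    ultimately show ?thesis by simp
  qed
  have "((\<lambda>z. \<Sum>cs\<in>basis_lists m. list_inner (map (\<lambda>l. l z) ls) cs * t z cs) has_derivative
      (\<lambda>h. \<Sum>cs\<in>basis_lists m. list_inner us cs * t' cs h + (\<Sum>i<m. list_inner (us[i := l' i h]) cs) * t x cs)) (at x)"
    unfolding us_def by (rule has_derivative_sum, rule has_derivative_mult[OF li[unfolded us_def] T])
  also have "(\<lambda>h. \<Sum>cs\<in>basis_lists m. list_inner us cs * t' cs h + (\<Sum>i<m. list_inner (us[i := l' i h]) cs) * t x cs) =
      (\<lambda>h. (\<Sum>cs\<in>basis_lists m. list_inner us cs * t' cs h) + (\<Sum>i<m. t x (us[i := l' i h])))"
  proof
    fix h
    have "(\<Sum>cs\<in>basis_lists m. (\<Sum>i<m. list_inner (us[i := l' i h]) cs) * t x cs) =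
        (\<Sum>i<m. \<Sum>cs\<in>basis_lists m. list_inner (us[i := l' i h]) cs * t x cs)"
      by (simp add: sum_distrib_right) (rule sum.swap)
    also have "\<dots> = (\<Sum>i<m. t x (us[i := l' i h]))"
      using us by (intro sum.cong refl multilinear_expand[OF ml[OF S(2)], symmetric]) simp
    finally show "(\<Sum>cs\<in>basis_lists m. list_inner us cs * t' cs h + (\<Sum>i<m. list_inner (us[i := l' i h]) cs) * t x cs) =
      (\<Sum>cs\<in>basis_lists m. list_inner us cs * t' cs h) + (\<Sum>i<m. t x (us[i := l' i h]))"
      by (simp add: sum.distrib)
  qed
  finally show ?thesis
    by (rule has_derivative_transform_within_open[OF _ S])
      (rule multilinear_expand[OF ml, symmetric], simp_all add: m)
qed

lemma smooth_on_multilinear: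
  fixes t :: "'x::real_normed_vector \<Rightarrow> 'w::euclidean_space list \<Rightarrow> real"
  assumes S: "open S" and ml: "\<And>z. z \<in> S \<Longrightarrow> multilinear m (t z)"
    and T: "\<And>cs. cs \<in> basis_lists m \<Longrightarrow> smooth_on S (\<lambda>z. t z cs)"
    and m: "length ls = m" and L: "\<And>l. l \<in> set ls \<Longrightarrow> smooth_on S l"
  shows "smooth_on S (\<lambda>z. t z (map (\<lambda>l. l z) ls))"
proof (rule smooth_on_cong[OF S])
  show "smooth_on S (\<lambda>z. \<Sum>cs\<in>basis_lists m. (\<Prod>i<m. (ls ! i) z \<bullet> cs ! i) * t z cs)"
    by (intro smooth_on_sum smooth_on_mult smooth_on_prod smooth_on_inner S T L smooth_on_const)
      (use m in auto)
  show "(\<Sum>cs\<in>basis_lists m. (\<Prod>i<m. (ls ! i) z \<bullet> cs ! i) * t z cs) = t z (map (\<lambda>l. l z) ls)"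
    if "z \<in> S" for z
    using m by (subst multilinear_expand[OF ml[OF that], of "map (\<lambda>l. l z) ls"])
      (auto simp: list_inner_def length_basis_lists intro!: sum.cong prod.cong)
qed

section \<open>The exterior derivative in a vector space\<close>

definition del_nth :: "nat \<Rightarrow> 'x list \<Rightarrow> 'x list" where
  "del_nth j vs = take j vs @ drop (Suc j) vs"

lemma length_del_nth: "j < length vs \<Longrightarrow> length (del_nth j vs) = length vs - 1"
  by (simp add: del_nth_def)

lemma map_del_nth: "map f (del_nth j vs) = del_nth j (map f vs)"
  by (simp add: del_nth_def take_map drop_map)

lemma del_nth_append1: "del_nth (length xs) (xs @ v # ys) = xs @ ys"
  by (simp add: del_nth_def)

lemma split_at_two:
  assumes "a < b" "b < length vs"
  obtains xs u ys v zs where "vs = xs @ u # ys @ v # zs" "vs ! a = u" "vs ! b = v"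
    "length xs = a" "length ys = b - a - 1"
proof (rule that)
  have "vs = take b vs @ vs ! b # drop (Suc b) vs" using assms by (intro id_take_nth_drop)
  moreover have "take b vs = take a (take b vs) @ take b vs ! a # drop (Suc a) (take b vs)"
    using assms by (intro id_take_nth_drop) simp
  ultimately show "vs = take a vs @ vs ! a # drop (Suc a) (take b vs) @ vs ! b # drop (Suc b) vs"
    using assms by (metis append.assoc append_Cons nth_take take_take min.absorb3)
qed (use assms in auto)

lemma del_nth_update:
  assumes "i < length vs" "j < length vs"
  shows "del_nth j (vs[i := u]) =
    (if i < j then (del_nth j vs)[i := u] else if i = j then del_nth j vs else (del_nth j vs)[i - 1 := u])"
proof -
  consider "i < j" | "i = j" | "j < i" by linarith
  then show ?thesis
  proof cases
    case 1
    then show ?thesis using assms by (simp add: del_nth_def take_update_swap list_update_append)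
  next
    case 2
    then show ?thesis using assms by (simp add: del_nth_def)
  next
    case 3
    then obtain d where "i = j + Suc d" using less_iff_Suc_add by auto
    then show ?thesis using assms by (simp add: del_nth_def drop_update_swap list_update_append)
  qed
qed

lemma ext_deriv_flat_del_nth:
  "ext_deriv_flat \<omega> y vs = (\<Sum>j<length vs. (-1) ^ j * frechet_derivative (\<lambda>z. \<omega> z (del_nth j vs)) (at y) (vs ! j))"
  by (simp add: ext_deriv_flat_def del_nth_def)

definition flat_form :: "'v::euclidean_space set \<Rightarrow> nat \<Rightarrow> ('v, 'v) tfield \<Rightarrow> bool" where
  "flat_form V r \<omega> \<longleftrightarrow> (\<forall>y\<in>V. alternating r (\<omega> y)) \<and> (\<forall>vs. smooth_on V (\<lambda>y. \<omega> y vs))"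

lemma ext_deriv_flat_cong:
  assumes "open V" "y \<in> V" "\<And>z vs. z \<in> V \<Longrightarrow> \<omega> z vs = \<omega>' z vs"
  shows "ext_deriv_flat \<omega> y vs = ext_deriv_flat \<omega>' y vs"
  unfolding ext_deriv_flat_del_nth
  by (intro sum.cong refl arg_cong2[where f="(*)"] fun_cong[OF frechet_derivative_cong_open[OF assms(1,2)]]) (rule assms(3))

lemma flat_form_has_derivative:
  "flat_form V r \<omega> \<Longrightarrow> y \<in> V \<Longrightarrow>
    ((\<lambda>z. \<omega> z vs) has_derivative frechet_derivative (\<lambda>z. \<omega> z vs) (at y)) (at y)"
  unfolding flat_form_def using smooth_on_has_derivative by blast

lemma ext_deriv_flat_wrong_length:
  assumes "open V" "flat_form V r \<omega>" "y \<in> V" "length vs \<noteq> Suc r"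
  shows "ext_deriv_flat \<omega> y vs = 0"
  unfolding ext_deriv_flat_del_nth
proof (rule sum.neutral, rule ballI)
  fix j assume j: "j \<in> {..<length vs}"
  have "frechet_derivative (\<lambda>z. \<omega> z (del_nth j vs)) (at y) = frechet_derivative (\<lambda>z. 0::real) (at y)"
    by (rule frechet_derivative_cong_open[OF assms(1,3)])
      (use assms j in \<open>auto simp: flat_form_def length_del_nth intro!: alternating_wrong_length\<close>)
  then show "(-1) ^ j * frechet_derivative (\<lambda>z. \<omega> z (del_nth j vs)) (at y) (vs ! j) = 0" by simp
qed

text \<open>If two entries agree, deleting any other entry leaves a repetition, on which the form vanishes. The
  two remaining terms differ by moving the repeated vector past the entries in between; the sign of
  this move is opposite to the quotient of the signs of the two terms.\<close>

lemma alternating_ext_deriv_flat: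
  assumes V: "open V" and \<omega>: "flat_form V r \<omega>" and y: "y \<in> V"
  shows "alternating (Suc r) (ext_deriv_flat \<omega> y)"
  unfolding alternating_def
proof (intro conjI allI impI)
  have alt: "alternating r (\<omega> z)" if "z \<in> V" for z using \<omega> that by (simp add: flat_form_def)
  let ?D = "\<lambda>us. frechet_derivative (\<lambda>z. \<omega> z us) (at y)"
  note D = flat_form_has_derivative[OF \<omega> y]
  fix vs :: "'a list"
  show "ext_deriv_flat \<omega> y vs = 0" if "length vs \<noteq> Suc r"
    using ext_deriv_flat_wrong_length[OF V \<omega> y that] .
  show "linear (\<lambda>u. ext_deriv_flat \<omega> y (vs[i := u]))" if vs: "length vs = Suc r" "i < Suc r" for i
  proof -
    have slot: "linear (\<lambda>u. ?D (us[k := u]) v)" if us: "length us = r" "k < r" for us k v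
    proof -
      have lin: "linear (\<lambda>u. \<omega> z (us[k := u]))" if "z \<in> V" for z
        by (rule alternating_slot[OF alt[OF that] us])
      show ?thesis
      proof (rule linearI)
        fix a b c
        have "?D (us[k := a + b]) = frechet_derivative (\<lambda>z. \<omega> z (us[k := a]) + \<omega> z (us[k := b])) (at y)"
          by (rule frechet_derivative_cong_open[OF V y]) (simp add: linear_add[OF lin])
        then show "?D (us[k := a + b]) v = ?D (us[k := a]) v + ?D (us[k := b]) v"
          using frechet_derivative_eqI[OF has_derivative_add[OF D D]] by metis
        have "?D (us[k := c *\<^sub>R a]) = frechet_derivative (\<lambda>z. c * \<omega> z (us[k := a])) (at y)"
          by (rule frechet_derivative_cong_open[OF V y]) (simp add: linear_scale[OF lin])
        then show "?D (us[k := c *\<^sub>R a]) v = c *\<^sub>R ?D (us[k := a]) v"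
          using frechet_derivative_eqI[OF has_derivative_mult_right[OF D, of c]] by (metis real_scaleR_def)
      qed
    qed
    have "linear (\<lambda>u. (-1) ^ j * ?D (del_nth j (vs[i := u])) (vs[i := u] ! j))" if j: "j < Suc r" for j
    proof -
      have len: "length (del_nth j vs) = r" using j vs by (simp add: length_del_nth)
      have "linear (\<lambda>u. ?D (del_nth j (vs[i := u])) (vs[i := u] ! j))"
      proof (cases "i = j")
        case True
        then show ?thesis using vs linear_frechet_derivative[of "\<lambda>z. \<omega> z (del_nth j vs)"] D
          by (auto simp: del_nth_update differentiable_def)
      next
        case False
        then show ?thesis using slot[OF len] vs j by (cases "i < j") (auto simp: del_nth_update)
      qed
      from linear_compose_scale_right[OF this, of "(-1) ^ j"] show ?thesis by simp
    qed
    then show ?thesis unfolding ext_deriv_flat_del_nth length_list_update vs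
      by (intro linear_compose_sum) auto
  qed
  show "ext_deriv_flat \<omega> y vs = 0" if nd: "\<not> distinct vs"
  proof (cases "length vs = Suc r")
    case False
    then show ?thesis using ext_deriv_flat_wrong_length[OF V \<omega> y] by simp
  next
    case len: True
    obtain a b where ab: "a < b" "b < length vs" "vs ! a = vs ! b"
      using nd unfolding distinct_conv_nth by (metis linorder_neqE_nat)
    obtain xs v ys v' zs where s0: "vs = xs @ v # ys @ v' # zs" "vs ! a = v" "vs ! b = v'"
      and s: "length xs = a" "length ys = b - a - 1"
      using split_at_two[OF ab(1,2)] .
    have v': "v' = v" using s0(2,3) ab(3) by simp
    have s': "vs = xs @ v # ys @ v # zs" using s0(1) unfolding v' .
    have rmb: "del_nth b vs = xs @ v # ys @ zs"
      using del_nth_append1[of "xs @ v # ys" v zs] s ab(1) unfolding s' by simp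
    have rma: "del_nth a vs = xs @ ys @ v # zs"
      using del_nth_append1[of xs v "ys @ v # zs"] s unfolding s' by simp
    have zero: "?D (del_nth j vs) (vs ! j) = 0" if j: "j < Suc r" "j \<noteq> a" "j \<noteq> b" for j
    proof -
      have "\<not> distinct (del_nth j vs)"
      proof -
        define a' b' where "a' = (if a < j then a else a - 1)" and "b' = (if b < j then b else b - 1)"
        have "a' < length (del_nth j vs)" "b' < length (del_nth j vs)" "a' \<noteq> b'"
          using j ab len by (auto simp: length_del_nth a'_def b'_def)
        moreover have "del_nth j vs ! a' = vs ! a" "del_nth j vs ! b' = vs ! b"
          using j ab len by (auto simp: del_nth_def nth_append a'_def b'_def)
        ultimately show ?thesis using ab(3) nth_eq_iff_index_eq[of "del_nth j vs" a' b'] by auto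
      qed
      then have "?D (del_nth j vs) = frechet_derivative (\<lambda>z. 0::real) (at y)"
        by (intro frechet_derivative_cong_open[OF V y]) (auto intro: alternating_not_distinct[OF alt])
      then show ?thesis by simp
    qed
    have "?D (del_nth b vs) = frechet_derivative (\<lambda>z. (-1) ^ length ys * \<omega> z (del_nth a vs)) (at y)"
      unfolding rma rmb
      by (intro frechet_derivative_cong_open[OF V y] alternating_move[OF alt])
        (use len in \<open>auto simp: s'\<close>)
    then have b: "?D (del_nth b vs) v = (-1) ^ length ys * ?D (del_nth a vs) v"
      using frechet_derivative_eqI[OF has_derivative_mult_right[OF D]] by metis
    have "ext_deriv_flat \<omega> y vs = (\<Sum>j\<in>{a, b}. (-1) ^ j * ?D (del_nth j vs) (vs ! j))"
      unfolding ext_deriv_flat_del_nth using ab len zero by (intro sum.mono_neutral_right) auto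
    also have "\<dots> = (-1) ^ a * ?D (del_nth a vs) v + (-1) ^ b * ?D (del_nth b vs) v"
      using ab(1) s0(2,3) v' by simp
    also have "\<dots> = 0"
    proof -
      have "(-1::real) ^ b * (-1) ^ length ys = - ((-1) ^ a)"
      proof -
        have "b + length ys = a + 2 * length ys + 1" using s ab by simp
        then show ?thesis by (simp flip: power_add) (simp add: power_add power_mult)
      qed
      then show ?thesis unfolding b by (simp flip: mult.assoc)
    qed
    finally show ?thesis .
  qed
qed

lemma flat_form_ext_deriv:
  assumes "open V" "flat_form V r \<omega>" shows "flat_form V (Suc r) (ext_deriv_flat \<omega>)"
  unfolding flat_form_def
proof (intro conjI ballI allI)
  show "alternating (Suc r) (ext_deriv_flat \<omega> y)" if "y \<in> V" for y
    by (rule alternating_ext_deriv_flat[OF assms that])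
  show "smooth_on V (\<lambda>y. ext_deriv_flat \<omega> y vs)" for vs
    unfolding ext_deriv_flat_del_nth
    by (intro smooth_on_sum smooth_on_mult smooth_on_const smooth_on_deriv assms(1))
      (use assms(2) in \<open>auto simp: flat_form_def\<close>)
qed

text \<open>Cancellation in pairs: deleting entry \<open>b\<close> and then marking entry \<open>a < b\<close> of what remains is
  paired with deleting entry \<open>a\<close> and then marking the former entry \<open>b\<close>.\<close>

lemma sum_delete_mark_cancel:
  fixes g :: "nat \<Rightarrow> nat \<Rightarrow> real"
  assumes "\<And>a b. a < b \<Longrightarrow> b \<le> r \<Longrightarrow> g b a + g a (b - 1) = 0"
  shows "(\<Sum>j<Suc r. \<Sum>i<r. g j i) = 0"
proof -
  let ?P = "{..<Suc r} \<times> {..<r}"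
  let ?P1 = "{(j, i). i < j \<and> j < Suc r}" and ?P2 = "{(j, i). j \<le> i \<and> i < r}"
  have P: "?P = ?P1 \<union> ?P2" "?P1 \<inter> ?P2 = {}" by auto
  have fin: "finite ?P1" "finite ?P2" by (rule finite_subset[of _ ?P], use P(1) in blast, simp)+
  have "(\<Sum>(j, i)\<in>?P2. g j i) = (\<Sum>(j, i)\<in>?P1. g i (j - 1))"
    by (rule sum.reindex_bij_witness[where i="\<lambda>(j, i). (i, j - 1)" and j="\<lambda>(j, i). (Suc i, j)"]) auto
  then have "(\<Sum>(j, i)\<in>?P. g j i) = (\<Sum>(j, i)\<in>?P1. g j i + g i (j - 1))"
    using fin P by (simp add: sum.union_disjoint sum.distrib case_prod_unfold)
  also have "\<dots> = 0" by (rule sum.neutral) (use assms in auto)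
  finally show ?thesis by (simp add: sum.cartesian_product)
qed

text \<open>Deleting two entries in either order gives the same list, with opposite signs, and the second
  derivative is symmetric.\<close>

lemma ext_deriv_flat_twice:
  assumes V: "open V" and \<omega>: "flat_form V r \<omega>" and y: "y \<in> V"
  shows "ext_deriv_flat (ext_deriv_flat \<omega>) y vs = 0"
proof (cases "length vs = Suc (Suc r)")
  case False
  then show ?thesis by (rule ext_deriv_flat_wrong_length[OF V flat_form_ext_deriv[OF V \<omega>] y])
next
  case len: True
  define D where "D ws a b = frechet_derivative (\<lambda>z. frechet_derivative (\<lambda>x. \<omega> x ws) (at z) a) (at y) b" for ws a b
  have sm: "smooth_on V (\<lambda>x. \<omega> x ws)" for ws using \<omega> by (simp add: flat_form_def)
  have D_sym: "D ws a b = D ws b a" for ws a b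
    unfolding D_def by (rule mixed_derivatives_symmetric_real[OF V y sm])
  let ?g = "\<lambda>j i. (-1) ^ j * ((-1) ^ i * D (del_nth i (del_nth j vs)) (del_nth j vs ! i) (vs ! j))"
  have term_j: "frechet_derivative (\<lambda>z. ext_deriv_flat \<omega> z (del_nth j vs)) (at y) (vs ! j) =
      (\<Sum>i<Suc r. (-1) ^ i * D (del_nth i (del_nth j vs)) (del_nth j vs ! i) (vs ! j))" if "j < Suc (Suc r)" for j
  proof -
    have l: "length (del_nth j vs) = Suc r" using that len by (simp add: length_del_nth)
    show ?thesis unfolding ext_deriv_flat_del_nth l D_def
      by (rule frechet_derivative_eqI, rule has_derivative_sum, rule has_derivative_mult_right)
        (rule smooth_on_has_derivative[OF smooth_on_deriv[OF sm] y])
  qed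
  have "(\<Sum>j<Suc (Suc r). \<Sum>i<Suc r. ?g j i) = 0"
  proof (rule sum_delete_mark_cancel)
    fix a b assume ab: "a < b" "b \<le> Suc r"
    then have bl: "b < length vs" using len by simp
    obtain xs u ys v zs where s: "vs = xs @ u # ys @ v # zs" "vs ! a = u" "vs ! b = v"
      and l: "length xs = a" "length ys = b - a - 1"
      using split_at_two[OF ab(1) bl] .
    have b1: "b - 1 = length (xs @ ys)" using l ab by simp
    have rb: "del_nth b vs = xs @ u # ys @ zs"
      using del_nth_append1[of "xs @ u # ys" v zs] l ab(1) unfolding s(1) by simp
    have ra: "del_nth a vs = xs @ ys @ v # zs"
      using del_nth_append1[of xs u "ys @ v # zs"] l unfolding s(1) by simp
    have "del_nth a (del_nth b vs) = xs @ ys @ zs" "del_nth b vs ! a = u"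
      using del_nth_append1[of xs u "ys @ zs"] l unfolding rb by auto
    moreover have "del_nth (b - 1) (del_nth a vs) = xs @ ys @ zs" "del_nth a vs ! (b - 1) = v"
      unfolding ra b1 using del_nth_append1[of "xs @ ys" v zs] nth_append_length[of "xs @ ys" v zs] by auto
    moreover have "(-1::real) ^ b = - ((-1) ^ (b - 1))" using ab(1) by (cases b) auto
    ultimately show "?g b a + ?g a (b - 1) = 0" using s(2,3) D_sym[of _ u v] by simp
  qed
  then have "(\<Sum>j<Suc (Suc r). (-1) ^ j * (\<Sum>i<Suc r. (-1) ^ i * D (del_nth i (del_nth j vs)) (del_nth j vs ! i) (vs ! j))) = 0"
    by (simp only: sum_distrib_left)
  moreover have "ext_deriv_flat (ext_deriv_flat \<omega>) y vs =
      (\<Sum>j<Suc (Suc r). (-1) ^ j * (\<Sum>i<Suc r. (-1) ^ i * D (del_nth i (del_nth j vs)) (del_nth j vs ! i) (vs ! j)))"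
    unfolding ext_deriv_flat_del_nth[of "ext_deriv_flat \<omega>"] len
    by (intro sum.cong refl arg_cong2[where f="(*)"] term_j) simp
  ultimately show ?thesis by simp
qed

definition flat_pull :: "('v::euclidean_space \<Rightarrow> 'w::euclidean_space) \<Rightarrow> ('w, 'w) tfield \<Rightarrow> ('v, 'v) tfield" where
  "flat_pull F \<omega> = (\<lambda>y vs. \<omega> (F y) (map (frechet_derivative F (at y)) vs))"

lemma flat_form_pull:
  fixes F :: "'v::euclidean_space \<Rightarrow> 'w::euclidean_space"
  assumes V: "open V" and W: "open W" and FV: "F ` V \<subseteq> W" and F: "smooth_on V F" and \<omega>: "flat_form W r \<omega>"
  shows "flat_form V r (flat_pull F \<omega>)"
  unfolding flat_form_def
proof (intro conjI ballI allI)
  have alt: "alternating r (\<omega> (F y))" if "y \<in> V" for y using that FV \<omega> by (auto simp: flat_form_def)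
  show a: "alternating r (flat_pull F \<omega> y)" if "y \<in> V" for y unfolding flat_pull_def
    by (intro alternating_linear_map alt that linear_frechet_derivative smooth_on_differentiable[OF F])
  show "smooth_on V (\<lambda>y. flat_pull F \<omega> y vs)" for vs
  proof (cases "length vs = r")
    case True
    have "smooth_on V (\<lambda>y. \<omega> (F y) (map (\<lambda>l. l y) (map (\<lambda>v y. frechet_derivative F (at y) v) vs)))"
      by (rule smooth_on_multilinear[OF V alternating_multilinear[OF alt]])
        (use True \<omega> in \<open>auto intro!: smooth_on_deriv F
          smooth_on_comp[OF V W FV F] simp: flat_form_def\<close>)
    then show ?thesis by (simp add: flat_pull_def o_def)
  next
    case False
    show ?thesis
      by (rule smooth_on_cong[OF V _ smooth_on_const[of _ 0]]) (use alternating_wrong_length[OF a False] in simp)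
  qed
qed

text \<open>The pull-back commutes with \<open>d\<close>: by the product rule, the terms that contain no second
  derivative of \<open>F\<close> give the claim, and those that do cancel in pairs, because the second derivative
  is symmetric and the form is alternating.\<close>

lemma ext_deriv_flat_pull:
  fixes F :: "'v::euclidean_space \<Rightarrow> 'w::euclidean_space"
  assumes V: "open V" and W: "open W" and FV: "F ` V \<subseteq> W" and F: "smooth_on V F" and \<omega>: "flat_form W r \<omega>"
    and y: "y \<in> V"
  shows "ext_deriv_flat (flat_pull F \<omega>) y vs = ext_deriv_flat \<omega> (F y) (map (frechet_derivative F (at y)) vs)"
proof (cases "length vs = Suc r")
  case False
  then show ?thesis
    using ext_deriv_flat_wrong_length[OF V flat_form_pull[OF V W FV F \<omega>] y]
      ext_deriv_flat_wrong_length[OF W \<omega>, of "F y" "map (frechet_derivative F (at y)) vs"] FV y by auto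
next
  case len: True
  let ?DF = "frechet_derivative F (at y)"
  let ?us = "map ?DF vs"
  define H where "H v u = frechet_derivative (\<lambda>z. frechet_derivative F (at z) u) (at y) v" for v u
  have H: "H v u = H u v" for u v
    unfolding H_def by (rule mixed_derivatives_symmetric[OF V y F])
  have alt: "alternating r (\<omega> (F z))" if "z \<in> V" for z using that FV \<omega> by (auto simp: flat_form_def)
  have Fy: "F y \<in> W" using FV y by auto
  let ?B = "\<lambda>j i. \<omega> (F y) ((del_nth j ?us)[i := H (vs ! j) (del_nth j vs ! i)])"
  have term_j: "frechet_derivative (\<lambda>z. flat_pull F \<omega> z (del_nth j vs)) (at y) (vs ! j) =
      frechet_derivative (\<lambda>w. \<omega> w (del_nth j ?us)) (at (F y)) (?us ! j) + (\<Sum>i<r. ?B j i)"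
    if j: "j < Suc r" for j
  proof -
    define ws where "ws = del_nth j vs"
    have ws: "length ws = r" using j len by (simp add: ws_def length_del_nth)
    define t' where "t' cs h = frechet_derivative (\<lambda>w. \<omega> w cs) (at (F y)) (?DF h)" for cs h
    have T: "((\<lambda>z. \<omega> (F z) cs) has_derivative t' cs) (at y)" for cs
      unfolding t'_def
      using has_derivative_compose[OF smooth_on_has_derivative[OF F y], of "\<lambda>w. \<omega> w cs"]
        flat_form_has_derivative[OF \<omega> Fy] by blast
    have "((\<lambda>z. \<omega> (F z) (map (\<lambda>l. l z) (map (\<lambda>u z. frechet_derivative F (at z) u) ws))) has_derivative
       (\<lambda>h. (\<Sum>cs\<in>basis_lists r. list_inner (map (\<lambda>l. l y) (map (\<lambda>u z. frechet_derivative F (at z) u) ws)) cs * t' cs h) +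
         (\<Sum>i<r. \<omega> (F y) ((map (\<lambda>l. l y) (map (\<lambda>u z. frechet_derivative F (at z) u) ws))[i := H h (ws ! i)])))) (at y)"
      by (rule multilinear_has_derivative[OF V y alternating_multilinear[OF alt]])
        (use ws in \<open>auto intro!: T smooth_on_has_derivative[OF smooth_on_deriv[OF F] y]
          simp: H_def\<close>)
    then have 1: "frechet_derivative (\<lambda>z. flat_pull F \<omega> z ws) (at y) (vs ! j) =
        (\<Sum>cs\<in>basis_lists r. list_inner (map ?DF ws) cs * t' cs (vs ! j)) +
        (\<Sum>i<r. \<omega> (F y) ((map ?DF ws)[i := H (vs ! j) (ws ! i)]))"
      by (simp add: frechet_derivative_eqI flat_pull_def o_def)
    have "((\<lambda>w. \<omega> w (map (\<lambda>l. l w) (map (\<lambda>u w. ?DF u) ws))) has_derivative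
       (\<lambda>h. (\<Sum>cs\<in>basis_lists r. list_inner (map (\<lambda>l. l (F y)) (map (\<lambda>u w. ?DF u) ws)) cs *
            frechet_derivative (\<lambda>w. \<omega> w cs) (at (F y)) h) +
         (\<Sum>i<r. \<omega> (F y) ((map (\<lambda>l. l (F y)) (map (\<lambda>u w. ?DF u) ws))[i := 0])))) (at (F y))"
      by (rule multilinear_has_derivative[OF W Fy])
        (use ws \<omega> in \<open>auto intro!: alternating_multilinear flat_form_has_derivative[OF \<omega> Fy] simp: flat_form_def\<close>)
    moreover have "\<omega> (F y) ((map ?DF ws)[i := 0]) = 0" if "i < r" for i
      using linear_0[OF alternating_slot[OF alt[OF y]]] that ws by (metis length_map)
    ultimately have 2: "frechet_derivative (\<lambda>w. \<omega> w (map ?DF ws)) (at (F y)) (?DF (vs ! j)) =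
        (\<Sum>cs\<in>basis_lists r. list_inner (map ?DF ws) cs * t' cs (vs ! j))"
      by (simp add: frechet_derivative_eqI t'_def o_def)
    have 3: "map ?DF ws = del_nth j ?us" by (simp add: ws_def map_del_nth)
    show ?thesis using 1 2 j len unfolding 3 by (simp add: ws_def)
  qed
  have "(\<Sum>j<Suc r. \<Sum>i<r. (-1) ^ j * ?B j i) = 0"
  proof (rule sum_delete_mark_cancel)
    fix a b assume ab: "a < b" "b \<le> r"
    then have bl: "b < length vs" using len by simp
    obtain xs u ys v zs where s: "vs = xs @ u # ys @ v # zs" "vs ! a = u" "vs ! b = v"
      and l: "length xs = a" "length ys = b - a - 1"
      using split_at_two[OF ab(1) bl] .
    have rmb: "del_nth b vs = xs @ u # ys @ zs"
      using del_nth_append1[of "xs @ u # ys" v zs] l ab(1) unfolding s(1) by simp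
    have rma: "del_nth a vs = xs @ ys @ v # zs"
      using del_nth_append1[of xs u "ys @ v # zs"] l unfolding s(1) by simp
    have "del_nth b vs ! a = u" unfolding rmb using l(1) by (metis nth_append_length)
    moreover have "del_nth a vs ! (b - 1) = v"
    proof -
      have "b - 1 = length (xs @ ys)" using l ab by simp
      then show ?thesis unfolding rma by (metis append.assoc nth_append_length)
    qed
    moreover have "(map ?DF (del_nth b vs))[a := h] = map ?DF xs @ h # map ?DF ys @ map ?DF zs" for h
      unfolding rmb using l by (simp add: list_update_append)
    moreover have "(map ?DF (del_nth a vs))[b - 1 := h] = map ?DF xs @ map ?DF ys @ h # map ?DF zs" for h
    proof -
      have "b - 1 = length (map ?DF xs @ map ?DF ys)" using l ab by simp
      then show ?thesis
        unfolding rma using list_update_length[of "map ?DF xs @ map ?DF ys" "?DF v" "map ?DF zs" h] by simp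
    qed
    ultimately have B: "?B b a = \<omega> (F y) (map ?DF xs @ H v u # map ?DF ys @ map ?DF zs)"
      "?B a (b - 1) = \<omega> (F y) (map ?DF xs @ map ?DF ys @ H v u # map ?DF zs)"
      by (simp_all add: map_del_nth s(2,3) H[of u v])
    have "?B b a = (-1) ^ length ys * ?B a (b - 1)"
      unfolding B using alternating_move[OF alt[OF y], of "map ?DF xs" "map ?DF ys" "map ?DF zs"]
        len unfolding s(1) by simp
    moreover have "(-1::real) ^ b * (-1) ^ length ys = - ((-1) ^ a)"
    proof -
      have "b + length ys = a + 2 * length ys + 1" using l ab by simp
      then show ?thesis by (simp flip: power_add) (simp add: power_add power_mult)
    qed
    moreover have "b' * x + a' * y = 0" if "x = l' * y" "b' * l' = - a'" for x y a' b' l' :: real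
      using that by (simp flip: mult.assoc)
    ultimately show "(-1) ^ b * ?B b a + (-1) ^ a * ?B a (b - 1) = 0" by blast
  qed
  then have "(\<Sum>j<Suc r. (-1) ^ j * (\<Sum>i<r. ?B j i)) = 0" by (simp only: sum_distrib_left)
  moreover have "ext_deriv_flat (flat_pull F \<omega>) y vs =
      (\<Sum>j<Suc r. (-1) ^ j * frechet_derivative (\<lambda>w. \<omega> w (del_nth j ?us)) (at (F y)) (?us ! j)) +
      (\<Sum>j<Suc r. (-1) ^ j * (\<Sum>i<r. ?B j i))"
    unfolding ext_deriv_flat_del_nth len by (simp add: term_j distrib_left sum.distrib del: sum.lessThan_Suc)
  ultimately have "ext_deriv_flat (flat_pull F \<omega>) y vs =
      (\<Sum>j<Suc r. (-1) ^ j * frechet_derivative (\<lambda>w. \<omega> w (del_nth j ?us)) (at (F y)) (?us ! j))"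
    by linarith
  then show ?thesis unfolding ext_deriv_flat_del_nth[of \<omega>] length_map len .
qed

text \<open>Expanding \<open>s (map L bs)\<close> over basis lists gives a double sum whose coefficients are products of
  \<open>L b \<bullet> c = b \<bullet> adjoint L c\<close>; summing over \<open>bs\<close> first gives the right-hand side.\<close>

lemma multilinear_contraction_adjoint:
  fixes L :: "'v::euclidean_space \<Rightarrow> 'w::euclidean_space"
  assumes L: "linear L" and t: "multilinear m t" and s: "multilinear m s"
  shows "(\<Sum>bs\<in>basis_lists m. t bs * s (map L bs)) = (\<Sum>cs\<in>basis_lists m. t (map (adjoint L) cs) * s cs)"
proof -
  have "list_inner (map L bs) cs = list_inner (map (adjoint L) cs) bs"
    if "bs \<in> basis_lists m" "cs \<in> basis_lists m" for bs cs
    using that adjoint_works[OF L] unfolding list_inner_def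
    by (intro prod.cong) (auto simp: length_basis_lists inner_commute)
  then have "(\<Sum>bs\<in>basis_lists m. t bs * s (map L bs)) =
      (\<Sum>bs\<in>basis_lists m. \<Sum>cs\<in>basis_lists m. list_inner (map (adjoint L) cs) bs * t bs * s cs)"
    by (intro sum.cong refl, subst multilinear_expand[OF s])
      (auto simp: length_basis_lists sum_distrib_left algebra_simps intro!: sum.cong)
  also have "\<dots> = (\<Sum>cs\<in>basis_lists m. \<Sum>bs\<in>basis_lists m. list_inner (map (adjoint L) cs) bs * t bs * s cs)"
    by (rule sum.swap)
  also have "\<dots> = (\<Sum>cs\<in>basis_lists m. t (map (adjoint L) cs) * s cs)"
    by (intro sum.cong refl, subst (2) multilinear_expand[OF t])
      (auto simp: length_basis_lists sum_distrib_right)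
  finally show ?thesis .
qed

section \<open>Charts and differentials\<close>

text \<open>The part of the definition of a manifold that concerns charts. It holds for the model space as well,
  without any discussion of paracompactness, so that charts and their inverses are instances of
  smooth maps between charted spaces.\<close>

definition charted :: "('a, 'v::euclidean_space) manifold \<Rightarrow> bool" where
  "charted M \<longleftrightarrow> (\<forall>c\<in>atlas M. is_chart (mtop M) c) \<and> (\<Union>c\<in>atlas M. fst c) = points M \<and>
     (\<forall>c\<in>atlas M. \<forall>c'\<in>atlas M. smooth_on (snd c ` (fst c \<inter> fst c')) (snd c' \<circ> chart_inv c))"

lemma smooth_manifold_charted: "smooth_manifold M \<Longrightarrow> charted M"
  by (simp add: smooth_manifold_def charted_def)

lemma charted_euclid: "charted (euclid :: ('v::euclidean_space, 'v) manifold)"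
  using homeomorphic_map_id[of euclidean euclidean]
  by (simp add: charted_def euclid_def is_chart_def smooth_on_bounded_linear o_def id_def)

lemma euclid_simps [simp]: "atlas euclid = {(UNIV, id)}" "mtop euclid = euclidean" "chart_at euclid y = (UNIV, id)"
  unfolding euclid_def chart_at_def by (auto intro!: some_equality)

context
  fixes M :: "('a, 'v::euclidean_space) manifold" and c
  assumes M: "charted M" and c: "c \<in> atlas M"
begin

lemma is_chart: "is_chart (mtop M) c"
  using M c by (simp add: charted_def)

lemma openin_chart: "openin (mtop M) (fst c)"
  using is_chart by (simp add: is_chart_def)

lemma open_chart_image: "open (snd c ` fst c)"
  using is_chart by (simp add: is_chart_def)

lemma chart_homeo: "homeomorphic_map (subtopology (mtop M) (fst c)) (top_of_set (snd c ` fst c)) (snd c)"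
  using is_chart by (simp add: is_chart_def)

lemma chart_subset: "fst c \<subseteq> points M"
  using openin_chart openin_subset by blast

lemma topspace_chart: "topspace (subtopology (mtop M) (fst c)) = fst c"
  using chart_subset by auto

lemma chart_inj: "inj_on (snd c) (fst c)"
  using chart_homeo topspace_chart by (metis homeomorphic_imp_injective_map)

lemma chart_inv_left: "p \<in> fst c \<Longrightarrow> chart_inv c (snd c p) = p"
  using chart_inj by simp

lemma chart_inv_right: "y \<in> snd c ` fst c \<Longrightarrow> snd c (chart_inv c y) = y"
  by (rule f_inv_into_f)

lemma chart_inv_mem: "y \<in> snd c ` fst c \<Longrightarrow> chart_inv c y \<in> fst c"
  by (rule inv_into_into)

lemma open_chart_image_subset:
  assumes "openin (mtop M) W" "W \<subseteq> fst c" shows "open (snd c ` W)"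
proof -
  have "openin (subtopology (mtop M) (fst c)) W"
    using assms openin_chart by (simp add: openin_open_subtopology)
  then have "openin (top_of_set (snd c ` fst c)) (snd c ` W)"
    using homeomorphic_imp_open_map[OF chart_homeo] by (simp add: open_map_def)
  then show ?thesis using open_chart_image by (simp add: openin_open_eq)
qed

lemma continuous_chart: "continuous_map (subtopology (mtop M) (fst c)) euclidean (snd c)"
  using homeomorphic_imp_continuous_map[OF chart_homeo] continuous_map_in_subtopology by blast

lemma continuous_chart_inv: "continuous_map (top_of_set (snd c ` fst c)) (mtop M) (chart_inv c)"
proof -
  obtain g where g: "homeomorphic_maps (subtopology (mtop M) (fst c)) (top_of_set (snd c ` fst c)) (snd c) g"
    using chart_homeo homeomorphic_map_maps by blast
  then have "continuous_map (top_of_set (snd c ` fst c)) (mtop M) g"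
    unfolding homeomorphic_maps_def continuous_map_in_subtopology by blast
  moreover have "g y = chart_inv c y" if "y \<in> snd c ` fst c" for y
    using g that chart_inv_left topspace_chart unfolding homeomorphic_maps_def by auto
  ultimately show ?thesis
    by (rule continuous_map_eq) simp
qed

end

lemma chart_at:
  assumes "charted M" "p \<in> points M"
  shows "chart_at M p \<in> atlas M" "p \<in> fst (chart_at M p)"
proof -
  have "\<exists>c. c \<in> atlas M \<and> p \<in> fst c" using assms unfolding charted_def by blast
  from someI_ex[OF this] show "chart_at M p \<in> atlas M" "p \<in> fst (chart_at M p)"
    unfolding chart_at_def by auto
qed

lemma openin_preimage:
  assumes "openin T U" "continuous_map (subtopology T U) T' f" "openin T' W"
  shows "openin T {p \<in> U. f p \<in> W}"
proof -
  have "openin (subtopology T U) {p \<in> topspace (subtopology T U). f p \<in> W}"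
    by (rule openin_continuous_map_preimage[OF assms(2,3)])
  moreover have "topspace (subtopology T U) = U" using openin_subset[OF assms(1)] by auto
  ultimately have "openin (subtopology T U) {p \<in> U. f p \<in> W}" by (simp only:)
  then show ?thesis using assms(1) by (simp add: openin_open_subtopology)
qed

abbreviation crep :: "('a, 'v) chart \<Rightarrow> ('b, 'w) chart \<Rightarrow> ('a \<Rightarrow> 'b) \<Rightarrow> 'v \<Rightarrow> 'w" where
  "crep c d \<phi> \<equiv> snd d \<circ> \<phi> \<circ> chart_inv c"

lemma crep_smooth:
  assumes "smooth_map_on M U N \<phi>" "c \<in> atlas M" "d \<in> atlas N"
  shows "smooth_on (snd c ` {p \<in> U \<inter> fst c. \<phi> p \<in> fst d}) (crep c d \<phi>)"
  using assms by (simp add: smooth_map_on_def)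

lemma crep_open:
  assumes M: "charted M" and N: "charted N" and U: "openin (mtop M) U" and \<phi>: "smooth_map_on M U N \<phi>"
    and c: "c \<in> atlas M" and d: "d \<in> atlas N" and W: "openin (mtop N) W"
  shows "open (snd c ` {p \<in> U \<inter> fst c. \<phi> p \<in> fst d \<inter> W})"
proof -
  have "openin (mtop M) {p \<in> U. \<phi> p \<in> fst d \<inter> W}"
    using openin_preimage[OF U] \<phi> W openin_chart[OF N d] unfolding smooth_map_on_def by blast
  moreover have "{p \<in> U \<inter> fst c. \<phi> p \<in> fst d \<inter> W} = {p \<in> U. \<phi> p \<in> fst d \<inter> W} \<inter> fst c" by auto
  ultimately show ?thesis
    using open_chart_image_subset[OF M c] openin_chart[OF M c] by auto
qed

lemma crep_open_UNIV:
  assumes M: "charted M" and N: "charted N" and U: "openin (mtop M) U" and \<phi>: "smooth_map_on M U N \<phi>"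
    and c: "c \<in> atlas M" and d: "d \<in> atlas N"
  shows "open (snd c ` {p \<in> U \<inter> fst c. \<phi> p \<in> fst d})"
  using crep_open[OF assms openin_chart[OF N d]] by simp

lemma smooth_map_on_subset:
  assumes \<phi>: "smooth_map_on M U N \<phi>" and "V \<subseteq> U"
  shows "smooth_map_on M V N \<phi>"
  unfolding smooth_map_on_def
proof (intro conjI ballI)
  show "continuous_map (subtopology (mtop M) V) (mtop N) \<phi>"
    using \<phi> \<open>V \<subseteq> U\<close> continuous_map_from_subtopology_mono unfolding smooth_map_on_def by blast
  show "smooth_on (snd c ` {p \<in> V \<inter> fst c. \<phi> p \<in> fst c'}) (crep c c' \<phi>)"
    if "c \<in> atlas M" "c' \<in> atlas N" for c c'
    by (rule smooth_on_subset[OF crep_smooth[OF \<phi> that]]) (use \<open>V \<subseteq> U\<close> in blast)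
qed

lemma smooth_map_on_cong:
  assumes M: "charted M" and N: "charted N" and U: "openin (mtop M) U" and \<phi>: "smooth_map_on M U N \<phi>"
    and eq: "\<And>p. p \<in> U \<Longrightarrow> \<phi> p = \<psi> p"
  shows "smooth_map_on M U N \<psi>"
  unfolding smooth_map_on_def
proof (intro conjI ballI)
  have "topspace (subtopology (mtop M) U) = U" using openin_subset[OF U] by auto
  moreover have "continuous_map (subtopology (mtop M) U) (mtop N) \<phi>"
    using \<phi> by (simp add: smooth_map_on_def)
  ultimately show "continuous_map (subtopology (mtop M) U) (mtop N) \<psi>"
    using eq by (auto elim!: continuous_map_eq)
  show "smooth_on (snd c ` {p \<in> U \<inter> fst c. \<psi> p \<in> fst d}) (crep c d \<psi>)"
    if c: "c \<in> atlas M" "d \<in> atlas N" for c d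
  proof -
    have "{p \<in> U \<inter> fst c. \<psi> p \<in> fst d} = {p \<in> U \<inter> fst c. \<phi> p \<in> fst d}" using eq by auto
    moreover have "smooth_on (snd c ` {p \<in> U \<inter> fst c. \<phi> p \<in> fst d}) (crep c d \<psi>)"
      by (rule smooth_on_cong[OF crep_open_UNIV[OF M N U \<phi> c] _ crep_smooth[OF \<phi> c]])
        (auto simp: chart_inv_left[OF M c(1)] eq)
    ultimately show ?thesis by simp
  qed
qed

lemma smooth_map_on_chart:
  assumes M: "charted M" and c: "c \<in> atlas M"
  shows "smooth_map_on M (fst c) euclid (snd c)"
  unfolding smooth_map_on_def
proof (intro conjI ballI)
  show "continuous_map (subtopology (mtop M) (fst c)) (mtop euclid) (snd c)"
    using continuous_chart[OF M c] by simp
  fix c' and d :: "('b, 'b) chart" assume c': "c' \<in> atlas M" and d: "d \<in> atlas euclid"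
  have "smooth_on (snd c' ` (fst c' \<inter> fst c)) (snd c \<circ> chart_inv c')" using M c c' by (simp add: charted_def)
  then show "smooth_on (snd c' ` {p \<in> fst c \<inter> fst c'. snd c p \<in> fst d}) (snd d \<circ> snd c \<circ> chart_inv c')"
    using d by (simp add: Int_def conj_commute)
qed

lemma smooth_map_on_chart_inv:
  assumes M: "charted M" and c: "c \<in> atlas M"
  shows "smooth_map_on euclid (snd c ` fst c) M (chart_inv c)"
  unfolding smooth_map_on_def
proof (intro conjI ballI)
  show "continuous_map (subtopology (mtop euclid) (snd c ` fst c)) (mtop M) (chart_inv c)"
    using continuous_chart_inv[OF M c] by simp
  fix d :: "('b, 'b) chart" and c' assume c': "c' \<in> atlas M" and d: "d \<in> atlas euclid"
  have "{y \<in> snd c ` fst c \<inter> UNIV. chart_inv c y \<in> fst c'} = snd c ` (fst c \<inter> fst c')"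
    using chart_inv_left[OF M c] by auto
  moreover have "smooth_on (snd c ` (fst c \<inter> fst c')) (snd c' \<circ> chart_inv c)" using M c c' by (simp add: charted_def)
  ultimately show "smooth_on (snd d ` {y \<in> snd c ` fst c \<inter> fst d. chart_inv c y \<in> fst c'})
      (snd c' \<circ> chart_inv c \<circ> chart_inv d)"
    using d by simp
qed

text \<open>The differential at \<open>p\<close> depends on the germ of the map only; this notion hides the domain.\<close>

definition smooth_near where
  "smooth_near M N \<phi> p \<longleftrightarrow> (\<exists>U. openin (mtop M) U \<and> p \<in> U \<and> smooth_map_on M U N \<phi>)"

lemma smooth_nearI: "openin (mtop M) U \<Longrightarrow> p \<in> U \<Longrightarrow> smooth_map_on M U N \<phi> \<Longrightarrow> smooth_near M N \<phi> p"
  by (auto simp: smooth_near_def)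

lemma smooth_map_on_image:
  assumes "smooth_map_on M U N \<phi>" "openin (mtop M) U" "p \<in> U"
  shows "\<phi> p \<in> points N"
proof -
  have "p \<in> topspace (subtopology (mtop M) U)" using assms(2,3) openin_subset by auto
  then show ?thesis
    using assms(1) continuous_map_image_subset_topspace unfolding smooth_map_on_def by blast
qed

lemma smooth_near_points: "smooth_near M N \<phi> p \<Longrightarrow> p \<in> points M \<and> \<phi> p \<in> points N"
proof -
  assume "smooth_near M N \<phi> p"
  then obtain U where U: "openin (mtop M) U" "p \<in> U" "smooth_map_on M U N \<phi>"
    unfolding smooth_near_def by blast
  show ?thesis using openin_subset[OF U(1)] U(2) smooth_map_on_image[OF U(3,1,2)] by auto
qed

lemma smooth_near_chart:
  "charted M \<Longrightarrow> c \<in> atlas M \<Longrightarrow> p \<in> fst c \<Longrightarrow> smooth_near M euclid (snd c) p"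
  by (rule smooth_nearI[OF openin_chart _ smooth_map_on_chart])

lemma smooth_near_chart_inv:
  "charted M \<Longrightarrow> c \<in> atlas M \<Longrightarrow> y \<in> snd c ` fst c \<Longrightarrow> smooth_near euclid M (chart_inv c) y"
  by (rule smooth_nearI[OF _ _ smooth_map_on_chart_inv]) (simp_all add: open_chart_image)

lemma smooth_on_smooth_map_euclid:
  assumes "open V" "smooth_on V F"
  shows "smooth_map_on (euclid :: ('v::euclidean_space, 'v) manifold) V (euclid :: ('w::euclidean_space, 'w) manifold) F"
  using assms smooth_on_continuous[OF assms(2)] unfolding smooth_map_on_def by simp

lemma smooth_near_euclid:
  assumes "open V" "smooth_on V F" "y \<in> V"
  shows "smooth_near (euclid :: ('v::euclidean_space, 'v) manifold) (euclid :: ('w::euclidean_space, 'w) manifold) F y"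
  by (rule smooth_nearI[OF _ assms(3) smooth_on_smooth_map_euclid[OF assms(1,2)]]) (use assms in simp)

lemma mderiv_has_derivative:
  assumes M: "charted M" and N: "charted N" and \<phi>: "smooth_near M N \<phi> p"
  shows "(crep (chart_at M p) (chart_at N (\<phi> p)) \<phi> has_derivative mderiv M N \<phi> p) (at (snd (chart_at M p) p))"
proof -
  obtain U where U: "openin (mtop M) U" "p \<in> U" "smooth_map_on M U N \<phi>"
    using \<phi> unfolding smooth_near_def by blast
  have "p \<in> points M" "\<phi> p \<in> points N" using smooth_near_points[OF \<phi>] by auto
  note c = chart_at[OF M this(1)] and d = chart_at[OF N this(2)]
  show ?thesis unfolding mderiv_def
    by (rule smooth_on_has_derivative[OF crep_smooth[OF U(3) c(1) d(1)]]) (use U c d in auto)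
qed

lemma mderiv_linear:
  "charted M \<Longrightarrow> charted N \<Longrightarrow> smooth_near M N \<phi> p \<Longrightarrow> linear (mderiv M N \<phi> p)"
  by (rule has_derivative_linear[OF mderiv_has_derivative])

lemma mderiv_cong:
  assumes M: "charted M" and U: "openin (mtop M) U" "p \<in> U" and eq: "\<And>q. q \<in> U \<Longrightarrow> \<phi> q = \<psi> q"
  shows "mderiv M N \<phi> p = mderiv M N \<psi> p"
proof -
  have p: "p \<in> points M" using U openin_subset by blast
  note c = chart_at[OF M p]
  have "open (snd (chart_at M p) ` (U \<inter> fst (chart_at M p)))"
    by (rule open_chart_image_subset[OF M c(1)]) (use U openin_chart[OF M c(1)] in auto)
  then show ?thesis unfolding mderiv_def eq[OF U(2)]
    by (rule frechet_derivative_cong_open) (use U c eq chart_inv_left[OF M c(1)] in auto)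
qed

text \<open>The charts used at \<open>p\<close>, \<open>\<phi> p\<close> and \<open>\<psi> (\<phi> p)\<close> are chosen once and for all, hence are the same on both
  sides, and the claim is the chain rule for the coordinate representations.\<close>

lemma mderiv_comp:
  assumes M: "charted M" and N: "charted N" and P: "charted P"
    and \<phi>: "smooth_near M N \<phi> p" and \<psi>: "smooth_near N P \<psi> (\<phi> p)"
  shows "mderiv M P (\<psi> \<circ> \<phi>) p = mderiv N P \<psi> (\<phi> p) \<circ> mderiv M N \<phi> p"
proof -
  define c d e where "c = chart_at M p" and "d = chart_at N (\<phi> p)" and "e = chart_at P (\<psi> (\<phi> p))"
  obtain U where U: "openin (mtop M) U" "p \<in> U" "smooth_map_on M U N \<phi>"
    using \<phi> unfolding smooth_near_def by blast
  have "p \<in> points M" "\<phi> p \<in> points N" using smooth_near_points[OF \<phi>] by auto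
  then have c: "c \<in> atlas M" "p \<in> fst c" and d: "d \<in> atlas N" "\<phi> p \<in> fst d"
    using chart_at[OF M] chart_at[OF N] by (auto simp: c_def d_def)
  have G: "(crep c d \<phi> has_derivative mderiv M N \<phi> p) (at (snd c p))"
    using mderiv_has_derivative[OF M N \<phi>] by (simp add: c_def d_def)
  have H: "(crep d e \<psi> has_derivative mderiv N P \<psi> (\<phi> p)) (at (crep c d \<phi> (snd c p)))"
    using mderiv_has_derivative[OF N P \<psi>] chart_inv_left[OF M c] by (simp add: d_def e_def)
  have "(crep d e \<psi> \<circ> crep c d \<phi> has_derivative mderiv N P \<psi> (\<phi> p) \<circ> mderiv M N \<phi> p) (at (snd c p))"
    by (rule diff_chain_at[OF G H])
  then have "frechet_derivative (crep d e \<psi> \<circ> crep c d \<phi>) (at (snd c p)) = mderiv N P \<psi> (\<phi> p) \<circ> mderiv M N \<phi> p"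
    using frechet_derivative_at by metis
  moreover have "frechet_derivative (crep d e \<psi> \<circ> crep c d \<phi>) (at (snd c p)) =
      frechet_derivative (crep c e (\<psi> \<circ> \<phi>)) (at (snd c p))"
    by (rule frechet_derivative_cong_open[OF crep_open_UNIV[OF M N U(1,3) c(1) d(1)]])
      (use U c d in \<open>auto simp: chart_inv_left[OF M c(1)] chart_inv_left[OF N d(1)]\<close>)
  ultimately show ?thesis by (simp add: mderiv_def c_def e_def)
qed

lemma mderiv_euclid: "mderiv euclid euclid F y = frechet_derivative F (at y)"
  by (simp add: mderiv_def)

lemma mderiv_id:
  assumes M: "charted M" and p: "p \<in> points M" shows "mderiv M M (\<lambda>q. q) p = id"
proof -
  note c = chart_at[OF M p]
  have "frechet_derivative (crep (chart_at M p) (chart_at M p) (\<lambda>q. q)) (at (snd (chart_at M p) p)) =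
      frechet_derivative id (at (snd (chart_at M p) p))"
    by (rule frechet_derivative_cong_open[OF open_chart_image[OF M c(1)]])
      (use c chart_inv_right[OF M c(1)] in auto)
  then show ?thesis by (simp add: mderiv_def)
qed

lemma mderiv_inverse:
  assumes M: "charted M" and N: "charted N" and \<phi>: "smooth_near M N \<phi> p" and \<psi>: "smooth_near N M \<psi> (\<phi> p)"
    and U: "openin (mtop M) U" "p \<in> U" and inv: "\<And>q. q \<in> U \<Longrightarrow> \<psi> (\<phi> q) = q"
  shows "mderiv N M \<psi> (\<phi> p) \<circ> mderiv M N \<phi> p = id"
proof -
  have "mderiv M M (\<psi> \<circ> \<phi>) p = mderiv M M (\<lambda>q. q) p"
    by (rule mderiv_cong[OF M U]) (simp add: inv)
  also have "\<dots> = id" using mderiv_id[OF M] U openin_subset by blast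
  finally show ?thesis using mderiv_comp[OF M N M \<phi> \<psi>] by simp
qed

lemma mderiv_chart_inverse:
  assumes M: "charted M" and c: "c \<in> atlas M" and p: "p \<in> fst c"
  shows "mderiv euclid M (chart_inv c) (snd c p) \<circ> mderiv M euclid (snd c) p = id"
proof (rule mderiv_inverse[OF M charted_euclid])
  show "smooth_near M euclid (snd c) p" by (rule smooth_near_chart[OF M c p])
  show "smooth_near euclid M (chart_inv c) (snd c p)" by (rule smooth_near_chart_inv[OF M c]) (use p in simp)
  show "openin (mtop M) (fst c)" by (rule openin_chart[OF M c])
  show "p \<in> fst c" by (rule p)
  show "chart_inv c (snd c q) = q" if "q \<in> fst c" for q by (rule chart_inv_left[OF M c that])
qed

lemma mderiv_chart_inverse':
  assumes M: "charted M" and c: "c \<in> atlas M" and y: "y \<in> snd c ` fst c"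
  shows "mderiv M euclid (snd c) (chart_inv c y) \<circ> mderiv euclid M (chart_inv c) y = id"
proof (rule mderiv_inverse[OF charted_euclid M])
  show "smooth_near euclid M (chart_inv c) y" by (rule smooth_near_chart_inv[OF M c y])
  show "smooth_near M euclid (snd c) (chart_inv c y)"
    by (rule smooth_near_chart[OF M c chart_inv_mem[OF M c y]])
  show "openin (mtop euclid) (snd c ` fst c)" by (simp add: open_chart_image[OF M c])
  show "y \<in> snd c ` fst c" by (rule y)
  show "snd c (chart_inv c z) = z" if "z \<in> snd c ` fst c" for z by (rule chart_inv_right[OF M c that])
qed

section \<open>Pull-back of forms and the exterior derivative\<close>

lemma pullback_comp:
  assumes "charted M" "charted N" "charted P" "smooth_near M N \<phi> p" "smooth_near N P \<psi> (\<phi> p)"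
  shows "pullback M N \<phi> (pullback N P \<psi> \<omega>) p vs = pullback M P (\<psi> \<circ> \<phi>) \<omega> p vs"
  by (simp add: pullback_def mderiv_comp[OF assms])

lemma pullback_cong:
  assumes "charted M" "openin (mtop M) U" "p \<in> U" "\<And>q. q \<in> U \<Longrightarrow> \<phi> q = \<psi> q"
  shows "pullback M N \<phi> \<omega> p vs = pullback M N \<psi> \<omega> p vs"
  using mderiv_cong[OF assms, where N=N] assms(4)[OF assms(3)] by (simp add: pullback_def)

lemma pullback_id:
  assumes "charted M" "p \<in> points M" shows "pullback M M (\<lambda>q. q) \<omega> p vs = \<omega> p vs"
  by (simp add: pullback_def mderiv_id[OF assms])

lemma pullback_inverse:
  assumes M: "charted M" and N: "charted N" and \<phi>: "smooth_near M N \<phi> p" and \<psi>: "smooth_near N M \<psi> (\<phi> p)"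
    and U: "openin (mtop M) U" "p \<in> U" and inv: "\<And>q. q \<in> U \<Longrightarrow> \<psi> (\<phi> q) = q"
  shows "pullback M N \<phi> (pullback N M \<psi> \<omega>) p vs = \<omega> p vs"
proof -
  have "pullback M N \<phi> (pullback N M \<psi> \<omega>) p vs = pullback M M (\<psi> \<circ> \<phi>) \<omega> p vs"
    by (rule pullback_comp[OF M N M \<phi> \<psi>])
  also have "\<dots> = pullback M M (\<lambda>q. q) \<omega> p vs" by (rule pullback_cong[OF M U]) (simp add: inv)
  also have "\<dots> = \<omega> p vs" by (rule pullback_id[OF M]) (use U openin_subset in blast)
  finally show ?thesis .
qed

lemma alternating_pullback:
  assumes "charted M" "charted N" "smooth_near M N \<phi> p" "alternating r (\<omega> (\<phi> p))"
  shows "alternating r (pullback M N \<phi> \<omega> p)"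
  unfolding pullback_def by (rule alternating_linear_map[OF assms(4) mderiv_linear[OF assms(1-3)]])

lemma form_on_alternating: "form_on M U r \<omega> \<Longrightarrow> p \<in> U \<Longrightarrow> alternating r (\<omega> p)"
  by (simp add: form_on_def)

lemma mvf_on_alternating: "mvf_on M U r X \<Longrightarrow> p \<in> U \<Longrightarrow> alternating r (X p)"
  by (simp add: mvf_on_def)

lemma local_form_eq: "local_form M c \<omega> y vs = \<omega> (chart_inv c y) (map (mderiv euclid M (chart_inv c) y) vs)"
  by (simp add: local_form_def pullback_def)

lemma local_form_flat:
  assumes M: "charted M" and c: "c \<in> atlas M" and U: "openin (mtop M) U" and \<omega>: "form_on M U r \<omega>"
  shows "flat_form (snd c ` (U \<inter> fst c)) r (local_form M c \<omega>)"
  unfolding flat_form_def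
proof (intro conjI ballI allI)
  fix y assume "y \<in> snd c ` (U \<inter> fst c)"
  then obtain p where p: "p \<in> U" "p \<in> fst c" "y = snd c p" by auto
  show "alternating r (local_form M c \<omega> y)" unfolding local_form_def
    by (rule alternating_pullback[OF charted_euclid M smooth_near_chart_inv[OF M c]])
      (use p in \<open>auto simp: chart_inv_left[OF M c] intro: form_on_alternating[OF \<omega>]\<close>)
qed (use \<omega> c in \<open>auto simp: form_on_def\<close>)

lemma open_chart_image_Int:
  assumes M: "charted M" and c: "c \<in> atlas M" and U: "openin (mtop M) U"
  shows "open (snd c ` (U \<inter> fst c))"
  by (rule open_chart_image_subset[OF M c]) (use U openin_chart[OF M c] in auto)

text \<open>Both sides pull \<open>\<omega>\<close> back along the two ways round the commuting square formed by \<open>\<phi>\<close>, its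
  coordinate representation and the inverses of the charts.\<close>

lemma local_form_pullback:
  assumes M: "charted M" and N: "charted N" and U: "openin (mtop M) U" and \<phi>: "smooth_map_on M U N \<phi>"
    and c: "c \<in> atlas M" and d: "d \<in> atlas N" and y: "y \<in> snd c ` {p \<in> U \<inter> fst c. \<phi> p \<in> fst d}"
  shows "local_form M c (pullback M N \<phi> \<omega>) y vs = flat_pull (crep c d \<phi>) (local_form N d \<omega>) y vs"
proof -
  let ?A = "snd c ` {p \<in> U \<inter> fst c. \<phi> p \<in> fst d}"
  obtain p where p: "p \<in> U" "p \<in> fst c" "\<phi> p \<in> fst d" "y = snd c p" using y by auto
  have cy: "chart_inv c y = p" using p chart_inv_left[OF M c] by simp
  have A: "open ?A" by (rule crep_open_UNIV[OF M N U \<phi> c d])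
  have G: "smooth_near euclid euclid (crep c d \<phi>) y"
    by (rule smooth_near_euclid[OF A crep_smooth[OF \<phi> c d] y])
  have ci: "smooth_near euclid M (chart_inv c) y" by (rule smooth_near_chart_inv[OF M c]) (use p in auto)
  have di: "smooth_near euclid N (chart_inv d) (crep c d \<phi> y)"
    by (rule smooth_near_chart_inv[OF N d]) (use p cy in auto)
  have \<phi>': "smooth_near M N \<phi> (chart_inv c y)" unfolding cy by (rule smooth_nearI[OF U p(1) \<phi>])
  have "local_form M c (pullback M N \<phi> \<omega>) y vs = pullback euclid N (\<phi> \<circ> chart_inv c) \<omega> y vs"
    unfolding local_form_def by (rule pullback_comp[OF charted_euclid M N ci \<phi>'])
  also have "\<dots> = pullback euclid N (chart_inv d \<circ> crep c d \<phi>) \<omega> y vs"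
    by (rule pullback_cong[OF charted_euclid _ y])
      (use A in \<open>auto simp: chart_inv_left[OF M c] chart_inv_left[OF N d]\<close>)
  also have "\<dots> = pullback euclid euclid (crep c d \<phi>) (local_form N d \<omega>) y vs"
    unfolding local_form_def by (rule pullback_comp[OF charted_euclid charted_euclid N G di, symmetric])
  finally show ?thesis by (simp add: flat_pull_def pullback_def mderiv_euclid)
qed

lemma form_on_pullback:
  assumes M: "charted M" and N: "charted N" and U: "openin (mtop M) U" and W: "openin (mtop N) W"
    and \<phi>: "smooth_map_on M U N \<phi>" and UW: "\<phi> ` U \<subseteq> W" and \<omega>: "form_on N W r \<omega>"
  shows "form_on M U r (pullback M N \<phi> \<omega>)"
  unfolding form_on_def
proof (intro conjI ballI allI)
  show "alternating r (pullback M N \<phi> \<omega> p)" if "p \<in> U" for p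
    by (rule alternating_pullback[OF M N smooth_nearI[OF U that \<phi>] form_on_alternating[OF \<omega>]]) (use that UW in auto)
  fix c vs assume c: "c \<in> atlas M"
  show "smooth_on (snd c ` (U \<inter> fst c)) (\<lambda>y. local_form M c (pullback M N \<phi> \<omega>) y vs)"
  proof (rule smooth_on_local)
    fix y assume "y \<in> snd c ` (U \<inter> fst c)"
    then obtain p where p: "p \<in> U" "p \<in> fst c" "y = snd c p" by auto
    have "\<phi> p \<in> points N" using UW p openin_subset[OF W] by auto
    note d = chart_at[OF N this]
    define d where "d = chart_at N (\<phi> p)"
    define A where "A = snd c ` {p \<in> U \<inter> fst c. \<phi> p \<in> fst d}"
    have d: "d \<in> atlas N" "\<phi> p \<in> fst d" using d by (auto simp: d_def)
    have A: "open A" unfolding A_def by (rule crep_open_UNIV[OF M N U \<phi> c d(1)])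
    have yA: "y \<in> A" using p d by (auto simp: A_def)
    have "flat_form A r (flat_pull (crep c d \<phi>) (local_form N d \<omega>))"
      by (rule flat_form_pull[OF A open_chart_image_Int[OF N d(1) W] _ _ local_form_flat[OF N d(1) W \<omega>]])
        (use UW crep_smooth[OF \<phi> c d(1)] in \<open>auto simp: A_def chart_inv_left[OF M c]\<close>)
    then have "smooth_on A (\<lambda>y. flat_pull (crep c d \<phi>) (local_form N d \<omega>) y vs)" by (simp add: flat_form_def)
    then have "smooth_on A (\<lambda>y. local_form M c (pullback M N \<phi> \<omega>) y vs)"
      by (rule smooth_on_cong[OF A, rotated])
        (rule local_form_pullback[OF M N U \<phi> c d(1), symmetric], simp add: A_def)
    then show "\<exists>T. open T \<and> y \<in> T \<and> smooth_on T (\<lambda>y. local_form M c (pullback M N \<phi> \<omega>) y vs)"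
      using A yA by blast
  qed
qed

lemma ext_deriv_cong:
  assumes M: "charted M" and U: "openin (mtop M) U" "p \<in> U" and eq: "\<And>q vs. q \<in> U \<Longrightarrow> \<omega> q vs = \<omega>' q vs"
  shows "ext_deriv M \<omega> p vs = ext_deriv M \<omega>' p vs"
proof -
  have p: "p \<in> points M" using U openin_subset by blast
  note c = chart_at[OF M p]
  show ?thesis unfolding ext_deriv_def
    by (rule ext_deriv_flat_cong[OF open_chart_image_Int[OF M c(1) U(1)]])
      (use U c in \<open>auto simp: local_form_eq chart_inv_left[OF M c(1)] eq\<close>)
qed

text \<open>The charts that define the exterior derivative at \<open>p\<close> and at \<open>\<phi> p\<close> are those that identify the
  tangent spaces there, so the claim is the naturality of the exterior derivative in vector spaces,
  applied to the coordinate representation of \<open>\<phi>\<close>.\<close>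

lemma ext_deriv_pullback:
  assumes M: "charted M" and N: "charted N" and U: "openin (mtop M) U" and W: "openin (mtop N) W"
    and \<phi>: "smooth_map_on M U N \<phi>" and UW: "\<phi> ` U \<subseteq> W" and \<omega>: "form_on N W r \<omega>" and p: "p \<in> U"
  shows "ext_deriv M (pullback M N \<phi> \<omega>) p vs = pullback M N \<phi> (ext_deriv N \<omega>) p vs"
proof -
  have "p \<in> points M" "\<phi> p \<in> points N" using p U UW openin_subset[OF W] openin_subset[OF U] by auto
  then have cd: "chart_at M p \<in> atlas M" "p \<in> fst (chart_at M p)"
      "chart_at N (\<phi> p) \<in> atlas N" "\<phi> p \<in> fst (chart_at N (\<phi> p))"
    using chart_at[OF M] chart_at[OF N] by auto
  define c d where "c = chart_at M p" and "d = chart_at N (\<phi> p)"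
  have c: "c \<in> atlas M" "p \<in> fst c" and d: "d \<in> atlas N" "\<phi> p \<in> fst d" using cd by (auto simp: c_def d_def)
  define A where "A = snd c ` {p \<in> U \<inter> fst c. \<phi> p \<in> fst d}"
  have A: "open A" unfolding A_def by (rule crep_open_UNIV[OF M N U \<phi> c(1) d(1)])
  have yA: "snd c p \<in> A" using p c d by (auto simp: A_def)
  have "ext_deriv M (pullback M N \<phi> \<omega>) p vs = ext_deriv_flat (local_form M c (pullback M N \<phi> \<omega>)) (snd c p) vs"
    by (simp add: ext_deriv_def c_def)
  also have "\<dots> = ext_deriv_flat (flat_pull (crep c d \<phi>) (local_form N d \<omega>)) (snd c p) vs"
    by (rule ext_deriv_flat_cong[OF A yA]) (rule local_form_pullback[OF M N U \<phi> c(1) d(1)], simp add: A_def)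
  also have "\<dots> = ext_deriv_flat (local_form N d \<omega>) (crep c d \<phi> (snd c p)) (map (frechet_derivative (crep c d \<phi>) (at (snd c p))) vs)"
    by (rule ext_deriv_flat_pull[OF A open_chart_image_Int[OF N d(1) W] _ _ local_form_flat[OF N d(1) W \<omega>] yA])
      (use UW crep_smooth[OF \<phi> c(1) d(1)] in \<open>auto simp: A_def chart_inv_left[OF M c(1)]\<close>)
  also have "\<dots> = pullback M N \<phi> (ext_deriv N \<omega>) p vs"
    using chart_inv_left[OF M c] by (simp add: pullback_def ext_deriv_def c_def d_def mderiv_def)
  finally show ?thesis .
qed

lemma ext_deriv_euclid: "ext_deriv euclid \<omega> y vs = ext_deriv_flat \<omega> y vs"
proof -
  have "local_form euclid (UNIV, id) \<omega> = \<omega>"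
    by (intro ext) (simp add: local_form_eq mderiv_euclid)
  then show ?thesis by (simp add: ext_deriv_def)
qed

text \<open>The exterior derivative is defined through the chart chosen at each point, but may be computed in
  any chart: this is its naturality under the inverse of the chart.\<close>

lemma local_form_ext_deriv:
  assumes M: "charted M" and c: "c \<in> atlas M" and U: "openin (mtop M) U" and \<omega>: "form_on M U r \<omega>"
    and y: "y \<in> snd c ` (U \<inter> fst c)"
  shows "local_form M c (ext_deriv M \<omega>) y vs = ext_deriv_flat (local_form M c \<omega>) y vs"
proof -
  have s: "smooth_map_on euclid (snd c ` (U \<inter> fst c)) M (chart_inv c)"
    by (rule smooth_map_on_subset[OF smooth_map_on_chart_inv[OF M c]]) auto
  have "ext_deriv euclid (pullback euclid M (chart_inv c) \<omega>) y vs = pullback euclid M (chart_inv c) (ext_deriv M \<omega>) y vs"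
    by (rule ext_deriv_pullback[OF charted_euclid M _ U s _ \<omega> y])
      (auto simp: open_chart_image_Int[OF M c U] chart_inv_left[OF M c])
  then show ?thesis by (simp add: local_form_def ext_deriv_euclid)
qed

lemma form_on_ext_deriv:
  assumes M: "charted M" and U: "openin (mtop M) U" and \<omega>: "form_on M U r \<omega>"
  shows "form_on M U (Suc r) (ext_deriv M \<omega>)"
  unfolding form_on_def
proof (intro conjI ballI allI)
  show "alternating (Suc r) (ext_deriv M \<omega> p)" if "p \<in> U" for p
  proof -
    have p: "p \<in> points M" using U that openin_subset by blast
    note c = chart_at[OF M p]
    show ?thesis unfolding ext_deriv_def
      by (rule alternating_ext_deriv_flat[OF open_chart_image_Int[OF M c(1) U] local_form_flat[OF M c(1) U \<omega>]])
        (use c that in auto)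
  qed
  show "smooth_on (snd c ` (U \<inter> fst c)) (\<lambda>y. local_form M c (ext_deriv M \<omega>) y vs)" if c: "c \<in> atlas M" for c vs
  proof (rule smooth_on_cong[OF open_chart_image_Int[OF M c U]])
    show "smooth_on (snd c ` (U \<inter> fst c)) (\<lambda>y. ext_deriv_flat (local_form M c \<omega>) y vs)"
      using flat_form_ext_deriv[OF open_chart_image_Int[OF M c U] local_form_flat[OF M c U \<omega>]]
      by (simp add: flat_form_def)
  qed (simp add: local_form_ext_deriv[OF M c U \<omega>])
qed

lemma ext_deriv_twice:
  assumes M: "charted M" and U: "openin (mtop M) U" and \<omega>: "form_on M U r \<omega>" and p: "p \<in> U"
  shows "ext_deriv M (ext_deriv M \<omega>) p vs = 0"
proof -
  have "p \<in> points M" using U p openin_subset by blast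
  note c = chart_at[OF M this]
  let ?V = "snd (chart_at M p) ` (U \<inter> fst (chart_at M p))"
  have V: "open ?V" by (rule open_chart_image_Int[OF M c(1) U])
  have y: "snd (chart_at M p) p \<in> ?V" using p c by auto
  have "ext_deriv M (ext_deriv M \<omega>) p vs =
      ext_deriv_flat (ext_deriv_flat (local_form M (chart_at M p) \<omega>)) (snd (chart_at M p) p) vs"
    unfolding ext_deriv_def[of M "ext_deriv M \<omega>"]
    by (rule ext_deriv_flat_cong[OF V y]) (rule local_form_ext_deriv[OF M c(1) U \<omega>])
  then show ?thesis using ext_deriv_flat_twice[OF V local_form_flat[OF M c(1) U \<omega>] y] by simp
qed

lemma form_on_cong:
  assumes M: "charted M" and U: "openin (mtop M) U" and \<omega>: "form_on M U r \<omega>"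
    and eq: "\<And>p vs. p \<in> U \<Longrightarrow> \<omega> p vs = \<omega>' p vs"
  shows "form_on M U r \<omega>'"
  unfolding form_on_def
proof (intro conjI ballI allI)
  show "alternating r (\<omega>' p)" if "p \<in> U" for p
  proof -
    have "\<omega> p = \<omega>' p" using eq[OF that] by blast
    then show ?thesis using form_on_alternating[OF \<omega> that] by simp
  qed
  show "smooth_on (snd c ` (U \<inter> fst c)) (\<lambda>y. local_form M c \<omega>' y vs)" if c: "c \<in> atlas M" for c vs
    by (rule smooth_on_cong[OF open_chart_image_Int[OF M c U], of "\<lambda>y. local_form M c \<omega> y vs"])
      (use \<omega> c in \<open>auto simp: local_form_eq chart_inv_left[OF M c] eq form_on_def\<close>)
qed

lemma form_on_zero: "form_on M U r (\<lambda>p vs. 0)"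
  by (simp add: form_on_def alternating_zero local_form_eq)

lemma form_on_lincomb:
  assumes M: "charted M" and U: "openin (mtop M) U" and \<omega>: "form_on M U r \<omega>" and \<eta>: "form_on M U r \<eta>"
  shows "form_on M U r (\<lambda>p vs. a * \<omega> p vs + b * \<eta> p vs)"
  unfolding form_on_def
proof (intro conjI ballI allI)
  show "alternating r (\<lambda>vs. a * \<omega> p vs + b * \<eta> p vs)" if "p \<in> U" for p
    by (intro alternating_add alternating_cmult form_on_alternating[OF \<omega> that] form_on_alternating[OF \<eta> that])
  show "smooth_on (snd c ` (U \<inter> fst c)) (\<lambda>y. local_form M c (\<lambda>p vs. a * \<omega> p vs + b * \<eta> p vs) y vs)"
    if c: "c \<in> atlas M" for c vs
    unfolding local_form_eq
    by (intro smooth_on_add smooth_on_mult smooth_on_const open_chart_image_Int[OF M c U])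
      (use \<omega> \<eta> c in \<open>auto simp: form_on_def local_form_eq\<close>)
qed

lemma ext_deriv_lincomb:
  assumes M: "charted M" and U: "openin (mtop M) U" and \<omega>: "form_on M U r \<omega>" and \<eta>: "form_on M U r \<eta>" and p: "p \<in> U"
  shows "ext_deriv M (\<lambda>p vs. a * \<omega> p vs + b * \<eta> p vs) p vs = a * ext_deriv M \<omega> p vs + b * ext_deriv M \<eta> p vs"
proof -
  have "p \<in> points M" using U p openin_subset by blast
  note c = chart_at[OF M this]
  define c where "c = chart_at M p"
  have c: "c \<in> atlas M" "p \<in> fst c" using c by (auto simp: c_def)
  have y: "snd c p \<in> snd c ` (U \<inter> fst c)" using p c by auto
  note D = flat_form_has_derivative[OF local_form_flat[OF M c(1) U \<omega>] y]
    flat_form_has_derivative[OF local_form_flat[OF M c(1) U \<eta>] y]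
  have "frechet_derivative (\<lambda>z. local_form M c (\<lambda>p vs. a * \<omega> p vs + b * \<eta> p vs) z ws) (at (snd c p)) v =
      a * frechet_derivative (\<lambda>z. local_form M c \<omega> z ws) (at (snd c p)) v +
      b * frechet_derivative (\<lambda>z. local_form M c \<eta> z ws) (at (snd c p)) v" for ws v
    using frechet_derivative_eqI[OF has_derivative_add[OF has_derivative_mult_right[OF D(1)] has_derivative_mult_right[OF D(2)]]]
    unfolding local_form_eq .
  then show ?thesis
    by (simp add: ext_deriv_def ext_deriv_flat_del_nth flip: c_def)
      (simp add: sum_distrib_left distrib_left sum.distrib mult.left_commute)
qed


section \<open>Multivector fields and contraction\<close>

lemma adjoint_comp:
  fixes f :: "'u::euclidean_space \<Rightarrow> 'v::euclidean_space" and g :: "'v \<Rightarrow> 'w::euclidean_space"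
  assumes "linear f" "linear g" shows "adjoint (g \<circ> f) = adjoint f \<circ> adjoint g"
  by (rule adjoint_unique) (simp add: adjoint_works assms)

lemma adjoint_id: "adjoint (id :: 'v::euclidean_space \<Rightarrow> 'v) = id"
  by (rule adjoint_unique) simp

lemma adjoint_expand:
  fixes f :: "'u::euclidean_space \<Rightarrow> 'v::euclidean_space"
  assumes "linear f" shows "adjoint f a = (\<Sum>b\<in>Basis. (a \<bullet> f b) *\<^sub>R b)"
proof -
  have "adjoint f a \<bullet> b = a \<bullet> f b" for b
    using adjoint_works[OF assms, of b a] by (simp add: inner_commute)
  then show ?thesis using euclidean_representation[of "adjoint f a"] by simp
qed

lemma local_mvf_eq:
  "local_mvf M c X y as = X (chart_inv c y) (map (adjoint (mderiv M euclid (snd c) (chart_inv c y))) as)"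
  by (simp add: local_mvf_def pushforward_def Let_def)

lemma alternating_local_mvf:
  assumes M: "charted M" and c: "c \<in> atlas M" and p: "p \<in> fst c" and X: "alternating m (X p)"
  shows "alternating m (local_mvf M c X (snd c p))"
  unfolding local_mvf_eq[abs_def] chart_inv_left[OF M c p]
  by (rule alternating_linear_map[OF X adjoint_linear[OF mderiv_linear[OF M charted_euclid smooth_near_chart[OF M c p]]]])

context
  fixes M :: "('a, 'v::euclidean_space) manifold" and U and N :: "('b, 'w::euclidean_space) manifold" and V and \<phi>
  assumes M: "charted M" and N: "charted N" and \<phi>: "diffeo_on M U N V \<phi>"
begin

lemma diffeo_open: "openin (mtop M) U" "openin (mtop N) V"
  using \<phi> by (auto simp: diffeo_on_def)

lemma diffeo_smooth: "smooth_map_on M U N \<phi>" "smooth_map_on N V M (inv_into U \<phi>)"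
  using \<phi> by (auto simp: diffeo_on_def)

lemma diffeo_bij: "bij_betw \<phi> U V"
  using \<phi> by (auto simp: diffeo_on_def)

lemma diffeo_inv_left: "p \<in> U \<Longrightarrow> inv_into U \<phi> (\<phi> p) = p"
  using diffeo_bij by (simp add: bij_betw_def)

lemma diffeo_inv_right: "q \<in> V \<Longrightarrow> \<phi> (inv_into U \<phi> q) = q"
  using diffeo_bij by (simp add: bij_betw_def f_inv_into_f)

lemma diffeo_mem: "p \<in> U \<Longrightarrow> \<phi> p \<in> V"
  using diffeo_bij by (auto simp: bij_betw_def)

lemma diffeo_inv_mem: "q \<in> V \<Longrightarrow> inv_into U \<phi> q \<in> U"
  using diffeo_bij by (auto simp: bij_betw_def inv_into_into)

lemma diffeo_near: "p \<in> U \<Longrightarrow> smooth_near M N \<phi> p"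
  by (rule smooth_nearI[OF diffeo_open(1) _ diffeo_smooth(1)])

lemma diffeo_near_inv: "q \<in> V \<Longrightarrow> smooth_near N M (inv_into U \<phi>) q"
  by (rule smooth_nearI[OF diffeo_open(2) _ diffeo_smooth(2)])

lemma pushforward_at: "p \<in> U \<Longrightarrow> pushforward M U N \<phi> X (\<phi> p) as = X p (map (adjoint (mderiv M N \<phi> p)) as)"
  by (simp add: pushforward_def Let_def diffeo_inv_left)

text \<open>Both sides evaluate \<open>X\<close> on covectors pulled back along the two ways round the commuting square
  formed by \<open>\<phi>\<close>, its coordinate representation and the charts.\<close>

lemma local_mvf_pushforward:
  assumes c: "c \<in> atlas M" and d: "d \<in> atlas N" and p: "p \<in> U" "p \<in> fst c" "\<phi> p \<in> fst d"
  shows "local_mvf N d (pushforward M U N \<phi> X) (snd d (\<phi> p)) as =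
    local_mvf M c X (snd c p) (map (adjoint (frechet_derivative (crep c d \<phi>) (at (snd c p)))) as)"
proof -
  let ?y = "snd c p"
  have cp: "smooth_near M euclid (snd c) p" by (rule smooth_near_chart[OF M c p(2)])
  have dp: "smooth_near N euclid (snd d) (\<phi> p)" by (rule smooth_near_chart[OF N d p(3)])
  let ?A = "snd c ` {p \<in> U \<inter> fst c. \<phi> p \<in> fst d}"
  have A: "open ?A" by (rule crep_open_UNIV[OF M N diffeo_open(1) diffeo_smooth(1) c d])
  have G: "smooth_near euclid euclid (crep c d \<phi>) ?y"
    by (rule smooth_near_euclid[OF A crep_smooth[OF diffeo_smooth(1) c d]]) (use p in auto)
  have "mderiv N euclid (snd d) (\<phi> p) \<circ> mderiv M N \<phi> p = mderiv M euclid (snd d \<circ> \<phi>) p"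
    by (rule mderiv_comp[OF M N charted_euclid diffeo_near[OF p(1)] dp, symmetric])
  also have "\<dots> = mderiv M euclid (crep c d \<phi> \<circ> snd c) p"
    by (rule mderiv_cong[OF M openin_Int[OF diffeo_open(1) openin_chart[OF M c]]])
      (use p in \<open>auto simp: chart_inv_left[OF M c]\<close>)
  also have "\<dots> = frechet_derivative (crep c d \<phi>) (at ?y) \<circ> mderiv M euclid (snd c) p"
    using mderiv_comp[OF M charted_euclid charted_euclid cp G] unfolding mderiv_euclid .
  finally have eq: "mderiv N euclid (snd d) (\<phi> p) \<circ> mderiv M N \<phi> p =
    frechet_derivative (crep c d \<phi>) (at ?y) \<circ> mderiv M euclid (snd c) p" .
  note lin = mderiv_linear[OF M N diffeo_near[OF p(1)]] mderiv_linear[OF N charted_euclid dp]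
    mderiv_linear[OF M charted_euclid cp] mderiv_linear[OF charted_euclid charted_euclid G, unfolded mderiv_euclid]
  have "adjoint (mderiv M N \<phi> p) \<circ> adjoint (mderiv N euclid (snd d) (\<phi> p)) =
      adjoint (mderiv M euclid (snd c) p) \<circ> adjoint (frechet_derivative (crep c d \<phi>) (at ?y))"
    using arg_cong[OF eq, of adjoint] adjoint_comp[OF lin(1,2)] adjoint_comp[OF lin(3,4)] by simp
  then show ?thesis
    by (simp add: local_mvf_eq local_mvf_eq chart_inv_left[OF N d p(3)]
        chart_inv_left[OF M c p(2)] pushforward_at[OF p(1)] del: comp_apply)
qed

lemma mvf_on_pushforward:
  assumes X: "mvf_on M U m X"
  shows "mvf_on N V m (pushforward M U N \<phi> X)"
  unfolding mvf_on_def
proof (intro conjI ballI allI)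
  have UW: "openin (mtop M) U" "openin (mtop N) V" by (fact diffeo_open)+
  fix q assume q: "q \<in> V"
  show "alternating m (pushforward M U N \<phi> X q)"
    unfolding pushforward_def Let_def
    by (intro alternating_linear_map mvf_on_alternating[OF X] adjoint_linear mderiv_linear[OF M N] diffeo_near diffeo_inv_mem q)
next
  fix d as assume d: "d \<in> atlas N"
  let ?\<psi> = "inv_into U \<phi>"
  show "smooth_on (snd d ` (V \<inter> fst d)) (\<lambda>y. local_mvf N d (pushforward M U N \<phi> X) y as)"
  proof (rule smooth_on_local)
    fix y assume "y \<in> snd d ` (V \<inter> fst d)"
    then obtain q where q: "q \<in> V" "q \<in> fst d" "y = snd d q" by auto
    have "?\<psi> q \<in> points M" using diffeo_inv_mem[OF q(1)] openin_subset[OF diffeo_open(1)] by auto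
    note c = chart_at[OF M this]
    define c where "c = chart_at M (?\<psi> q)"
    have c: "c \<in> atlas M" "?\<psi> q \<in> fst c" using c by (auto simp: c_def)
    define A where "A = snd d ` {q \<in> V \<inter> fst d. ?\<psi> q \<in> fst c}"
    define B where "B = snd c ` {p \<in> U \<inter> fst c. \<phi> p \<in> fst d}"
    let ?G = "crep c d \<phi>" and ?H = "crep d c ?\<psi>"
    have A: "open A" unfolding A_def by (rule crep_open_UNIV[OF N M diffeo_open(2) diffeo_smooth(2) d c(1)])
    have B: "open B" unfolding B_def by (rule crep_open_UNIV[OF M N diffeo_open(1) diffeo_smooth(1) c(1) d])
    have yA: "y \<in> A" using q c by (auto simp: A_def)
    have AB: "?H ` A \<subseteq> B"
      by (auto simp: A_def B_def chart_inv_left[OF N d] diffeo_inv_right intro!: imageI diffeo_inv_mem)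
    have H: "smooth_on A ?H" unfolding A_def by (rule crep_smooth[OF diffeo_smooth(2) d c(1)])
    have G: "smooth_on B ?G" unfolding B_def by (rule crep_smooth[OF diffeo_smooth(1) c(1) d])
    have BU: "B \<subseteq> snd c ` (U \<inter> fst c)" by (auto simp: B_def)
    have X': "smooth_on B (\<lambda>z. local_mvf M c X z bs)" for bs
      by (rule smooth_on_subset[OF _ BU]) (use X c in \<open>auto simp: mvf_on_def\<close>)
    have alt: "alternating m (local_mvf M c X z)" if "z \<in> B" for z
      using that by (auto simp: B_def intro!: alternating_local_mvf[OF M c(1)] mvf_on_alternating[OF X])
    have lin: "linear (frechet_derivative ?G (at z))" if "z \<in> B" for z
      by (rule linear_frechet_derivative[OF smooth_on_differentiable[OF G that]])
    have HB: "?H z \<in> B" if "z \<in> A" for z using AB that by blast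
    have L: "smooth_on A (\<lambda>z. adjoint (frechet_derivative ?G (at (?H z))) a)" for a
    proof (rule smooth_on_cong[OF A])
      show "smooth_on A (\<lambda>z. \<Sum>b\<in>Basis. (a \<bullet> frechet_derivative ?G (at (?H z)) b) *\<^sub>R b)"
        by (intro smooth_on_sum smooth_on_scaleR smooth_on_inner smooth_on_const A
            smooth_on_comp[OF A B AB H smooth_on_deriv[OF G]])
      show "(\<Sum>b\<in>Basis. (a \<bullet> frechet_derivative ?G (at (?H z)) b) *\<^sub>R b) = adjoint (frechet_derivative ?G (at (?H z))) a"
        if "z \<in> A" for z by (rule adjoint_expand[OF lin[OF HB[OF that]], symmetric])
    qed
    have loc: "local_mvf N d (pushforward M U N \<phi> X) z as =
        local_mvf M c X (?H z) (map (adjoint (frechet_derivative ?G (at (?H z)))) as)" if z: "z \<in> A" for z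
    proof -
      obtain q where q: "q \<in> V" "q \<in> fst d" "?\<psi> q \<in> fst c" "z = snd d q" using z by (auto simp: A_def)
      show ?thesis
        using local_mvf_pushforward[OF c(1) d, of "?\<psi> q" X as] q
        by (simp add: diffeo_inv_mem diffeo_inv_right chart_inv_left[OF N d])
    qed
    have "smooth_on A (\<lambda>z. local_mvf N d (pushforward M U N \<phi> X) z as)"
    proof (cases "length as = m")
      case True
      have "smooth_on A (\<lambda>z. local_mvf M c X (?H z) (map (\<lambda>l. l z) (map (\<lambda>a z. adjoint (frechet_derivative ?G (at (?H z))) a) as)))"
        by (rule smooth_on_multilinear[OF A alternating_multilinear[OF alt[OF HB]]])
          (use True in \<open>auto intro!: L smooth_on_comp[OF A B AB H X'] simp del: comp_apply\<close>)
      then show ?thesis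
        by (rule smooth_on_cong[OF A, rotated]) (simp add: loc o_def)
    next
      case False
      show ?thesis
        by (rule smooth_on_cong[OF A _ smooth_on_const[of _ 0]])
          (use False in \<open>simp add: loc alternating_wrong_length[OF alt[OF HB]] del: comp_apply\<close>)
    qed
    then show "\<exists>T. open T \<and> y \<in> T \<and> smooth_on T (\<lambda>y. local_mvf N d (pushforward M U N \<phi> X) y as)"
      using A yA by blast
  qed
qed

end

lemma contraction_adjoint:
  fixes L :: "'v::euclidean_space \<Rightarrow> 'w::euclidean_space"
  assumes L: "linear L" and t: "alternating m t" and s: "alternating r s"
  shows "(\<Sum>bs\<in>basis_lists m. t bs * s (rev (map L bs) @ ws)) =
    (\<Sum>cs\<in>basis_lists m. t (map (adjoint L) cs) * s (rev cs @ ws))"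
proof (cases "m + length ws = r")
  case True
  have "multilinear m (\<lambda>cs. s (rev cs @ ws))"
    unfolding multilinear_def
  proof (intro allI impI)
    fix vs :: "'w list" and i assume vs: "length vs = m" "i < m"
    have "linear (\<lambda>u. s ((rev vs @ ws)[m - i - 1 := u]))"
      by (rule alternating_slot[OF s]) (use vs True in auto)
    then show "linear (\<lambda>u. s (rev (vs[i := u]) @ ws))"
      using vs by (simp add: rev_update list_update_append)
  qed
  from multilinear_contraction_adjoint[OF L alternating_multilinear[OF t] this]
  show ?thesis by simp
next
  case False
  then have "s (rev cs @ ws) = 0" if "length cs = m" for cs
    using alternating_wrong_length[OF s] that by simp
  then show ?thesis by (auto simp: length_basis_lists intro!: sum.neutral)
qed

lemma contr_eq: "contr m X \<omega> p ws = (\<Sum>bs\<in>basis_lists m. X p bs * \<omega> p (rev bs @ ws)) / fact m"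
  by (simp add: contr_def basis_lists_def)

lemma contr_cong:
  "(\<And>as. X p as = X' p as) \<Longrightarrow> (\<And>vs. \<omega> p vs = \<omega>' p vs) \<Longrightarrow> contr m X \<omega> p ws = contr m X' \<omega>' p ws"
  by (simp add: contr_eq)

lemma contr_lincomb_mvf:
  "contr m (\<lambda>p as. a * X p as + b * Y p as) \<omega> p ws = a * contr m X \<omega> p ws + b * contr m Y \<omega> p ws"
  by (simp add: contr_eq sum_distrib_left sum.distrib distrib_right mult.assoc add_divide_distrib)

lemma alternating_sum:
  assumes "\<And>i. i \<in> A \<Longrightarrow> alternating r (t i)" shows "alternating r (\<lambda>vs. \<Sum>i\<in>A. t i vs)"
  using assms by (induction A rule: infinite_finite_induct) (auto intro!: alternating_zero alternating_add)

lemma alternating_contr: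
  fixes X \<omega> :: "('a, 'v::euclidean_space) tfield"
  assumes X: "alternating m (X p)" and \<omega>: "alternating r (\<omega> p)"
  shows "alternating (r - m) (contr m X \<omega> p)"
proof -
  have "alternating (r - m) (\<lambda>ws. \<omega> p (rev bs @ ws))" if bs: "length bs = m" for bs
    unfolding alternating_def
  proof (intro conjI allI impI)
    fix ws :: "'v list"
    show "\<omega> p (rev bs @ ws) = 0" if "length ws \<noteq> r - m"
      by (rule alternating_wrong_length[OF \<omega>]) (use that bs in simp)
    show "linear (\<lambda>u. \<omega> p (rev bs @ ws[i := u]))" if "length ws = r - m" "i < r - m" for i
      using alternating_slot[OF \<omega>, of "rev bs @ ws" "m + i"] that bs by (simp add: list_update_append)
    show "\<omega> p (rev bs @ ws) = 0" if "\<not> distinct ws"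
      by (rule alternating_not_distinct[OF \<omega>]) (use that in simp)
  qed
  then have "alternating (r - m) (\<lambda>ws. \<Sum>bs\<in>basis_lists m. X p bs * \<omega> p (rev bs @ ws))"
    by (intro alternating_sum alternating_cmult) (simp add: length_basis_lists)
  then have "alternating (r - m) (\<lambda>ws. (1 / fact m) * (\<Sum>bs\<in>basis_lists m. X p bs * \<omega> p (rev bs @ ws)))"
    by (rule alternating_cmult)
  then show ?thesis by (simp add: contr_eq[abs_def])
qed

text \<open>The local representative of a contraction is the contraction of the local representatives,
  because the differential of the chart acts on multivectors by its adjoint and on forms by its
  inverse.\<close>

lemma local_form_contr:
  assumes M: "charted M" and c: "c \<in> atlas M" and p: "p \<in> fst c"
    and X: "alternating m (X p)" and \<omega>: "alternating r (\<omega> p)"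
  shows "local_form M c (contr m X \<omega>) (snd c p) ws = contr m (local_mvf M c X) (local_form M c \<omega>) (snd c p) ws"
proof -
  let ?L = "mderiv M euclid (snd c) p" and ?L' = "mderiv euclid M (chart_inv c) (snd c p)"
  have inv: "?L' \<circ> ?L = id" by (rule mderiv_chart_inverse[OF M c p])
  have ci: "smooth_near euclid M (chart_inv c) (snd c p)"
    by (rule smooth_near_chart_inv[OF M c]) (use p in simp)
  have "alternating r (\<lambda>vs. \<omega> p (map ?L' vs))"
    by (rule alternating_linear_map[OF \<omega> mderiv_linear[OF charted_euclid M ci]])
  from contraction_adjoint[OF mderiv_linear[OF M charted_euclid smooth_near_chart[OF M c p]] X this, of ws]
  show ?thesis
    by (simp add: contr_eq local_form_eq local_mvf_eq chart_inv_left[OF M c p] rev_map[symmetric] inv)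
qed

lemma form_on_contr:
  assumes M: "charted M" and U: "openin (mtop M) U" and X: "mvf_on M U m X" and \<omega>: "form_on M U r \<omega>"
  shows "form_on M U (r - m) (contr m X \<omega>)"
  unfolding form_on_def
proof (intro conjI ballI allI)
  show "alternating (r - m) (contr m X \<omega> p)" if "p \<in> U" for p
    by (rule alternating_contr[of m X p r \<omega>, OF mvf_on_alternating[OF X that] form_on_alternating[OF \<omega> that]])
  fix c ws assume c: "c \<in> atlas M"
  show "smooth_on (snd c ` (U \<inter> fst c)) (\<lambda>y. local_form M c (contr m X \<omega>) y ws)"
  proof (rule smooth_on_cong[OF open_chart_image_Int[OF M c U]])
    show "smooth_on (snd c ` (U \<inter> fst c)) (\<lambda>y. (1 / fact m) * (\<Sum>bs\<in>basis_lists m. local_mvf M c X y bs * local_form M c \<omega> y (rev bs @ ws)))"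
      by (intro smooth_on_mult smooth_on_sum smooth_on_const open_chart_image_Int[OF M c U])
        (use X \<omega> c in \<open>auto simp: mvf_on_def form_on_def\<close>)
    fix y assume "y \<in> snd c ` (U \<inter> fst c)"
    then obtain p where p: "p \<in> U" "p \<in> fst c" "y = snd c p" by auto
    then show "(1 / fact m) * (\<Sum>bs\<in>basis_lists m. local_mvf M c X y bs * local_form M c \<omega> y (rev bs @ ws)) =
      local_form M c (contr m X \<omega>) y ws"
      using local_form_contr[where X=X and \<omega>=\<omega>, OF M c p(2) mvf_on_alternating[OF X p(1)] form_on_alternating[OF \<omega> p(1)]]
      by (simp add: contr_eq)
  qed
qed

lemma form_on_lie:
  assumes M: "charted M" and U: "openin (mtop M) U" and X: "mvf_on M U m X" and \<omega>: "form_on M U r \<omega>"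
  shows "form_on M U (Suc r - m) (lie M m X \<omega>)"
proof -
  have 1: "form_on M U (Suc r - m) (ext_deriv M (contr m X \<omega>))"
  proof (cases "m \<le> r")
    case True
    then show ?thesis using form_on_ext_deriv[OF M U form_on_contr[OF M U X \<omega>]] by (simp add: Suc_diff_le)
  next
    case False
    \<comment> \<open>the contraction vanishes, and \<open>0\<close> is a form of the truncated degree\<close>
    have z: "contr m X \<omega> p ws = 0" if "p \<in> U" for p ws
    proof -
      have "\<omega> p (rev bs @ ws) = 0" if "length bs = m" for bs
        by (rule alternating_wrong_length[OF form_on_alternating[OF \<omega> \<open>p \<in> U\<close>]]) (use that False in simp)
      then show ?thesis by (simp add: contr_eq length_basis_lists)
    qed
    have "ext_deriv M (contr m X \<omega>) p ws = 0" if "p \<in> U" for p ws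
    proof -
      have "ext_deriv M (contr m X \<omega>) p ws = ext_deriv M (\<lambda>p ws. 0) p ws"
        by (rule ext_deriv_cong[OF M U that z])
      also have "\<dots> = 0" by (simp add: ext_deriv_def ext_deriv_flat_del_nth local_form_eq)
      finally show ?thesis .
    qed
    then show ?thesis by (intro form_on_cong[OF M U form_on_zero]) simp
  qed
  have 2: "form_on M U (Suc r - m) (contr m X (ext_deriv M \<omega>))"
    by (rule form_on_contr[OF M U X form_on_ext_deriv[OF M U \<omega>]])
  from form_on_lincomb[OF M U 1 2, of 1 "- ((-1) ^ m)"] show ?thesis
    by (simp add: lie_def[abs_def])
qed

lemma lie_cong:
  assumes M: "charted M" and U: "openin (mtop M) U" "p \<in> U"
    and X: "\<And>q as. q \<in> U \<Longrightarrow> X q as = X' q as" and eq: "\<And>q vs. q \<in> U \<Longrightarrow> \<omega> q vs = \<omega>' q vs"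
  shows "lie M m X \<omega> p ws = lie M m X' \<omega>' p ws"
proof -
  have "ext_deriv M (contr m X \<omega>) p ws = ext_deriv M (contr m X' \<omega>') p ws"
    by (rule ext_deriv_cong[OF M U]) (rule contr_cong; simp add: X eq)
  moreover have "contr m X (ext_deriv M \<omega>) p ws = contr m X' (ext_deriv M \<omega>') p ws"
    by (rule contr_cong) (simp_all add: X U ext_deriv_cong[OF M U eq])
  ultimately show ?thesis by (simp add: lie_def)
qed

lemma mvf_on_cong:
  assumes M: "charted M" and U: "openin (mtop M) U" and X: "mvf_on M U m X"
    and eq: "\<And>p as. p \<in> U \<Longrightarrow> X p as = X' p as"
  shows "mvf_on M U m X'"
  unfolding mvf_on_def
proof (intro conjI ballI allI)
  show "alternating m (X' p)" if "p \<in> U" for p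
  proof -
    have "X p = X' p" using eq[OF that] by blast
    then show ?thesis using mvf_on_alternating[OF X that] by simp
  qed
  show "smooth_on (snd c ` (U \<inter> fst c)) (\<lambda>y. local_mvf M c X' y as)" if c: "c \<in> atlas M" for c as
    by (rule smooth_on_cong[OF open_chart_image_Int[OF M c U], of "\<lambda>y. local_mvf M c X y as"])
      (use X c in \<open>auto simp: local_mvf_eq chart_inv_left[OF M c] eq mvf_on_def\<close>)
qed

lemma mvf_on_zero: "mvf_on M U r (\<lambda>p vs. 0)"
  by (simp add: mvf_on_def alternating_zero local_mvf_eq)

lemma mvf_on_lincomb:
  assumes M: "charted M" and U: "openin (mtop M) U" and X: "mvf_on M U r X" and Y: "mvf_on M U r Y"
  shows "mvf_on M U r (\<lambda>p vs. a * X p vs + b * Y p vs)"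
  unfolding mvf_on_def
proof (intro conjI ballI allI)
  show "alternating r (\<lambda>vs. a * X p vs + b * Y p vs)" if "p \<in> U" for p
    by (intro alternating_add alternating_cmult mvf_on_alternating[OF X that] mvf_on_alternating[OF Y that])
  show "smooth_on (snd c ` (U \<inter> fst c)) (\<lambda>y. local_mvf M c (\<lambda>p vs. a * X p vs + b * Y p vs) y vs)"
    if c: "c \<in> atlas M" for c vs
    unfolding local_mvf_eq
    by (intro smooth_on_add smooth_on_mult smooth_on_const open_chart_image_Int[OF M c U])
      (use X Y c in \<open>auto simp: mvf_on_def local_mvf_eq\<close>)
qed

lemma mvf_on_0_form:
  assumes M: "charted M" and U: "openin (mtop M) U" and Y: "mvf_on M U 0 Y" shows "form_on M U 0 Y"
  unfolding form_on_def
proof (intro conjI ballI allI)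
  show "alternating 0 (Y p)" if "p \<in> U" for p by (rule mvf_on_alternating[OF Y that])
  fix c and vs :: "'b list" assume c: "c \<in> atlas M"
  have s: "smooth_on (snd c ` (U \<inter> fst c)) (\<lambda>y. local_mvf M c Y y [])" using Y c by (simp add: mvf_on_def)
  show "smooth_on (snd c ` (U \<inter> fst c)) (\<lambda>y. local_form M c Y y vs)"
  proof (cases "vs = []")
    case True
    then show ?thesis using s by (simp add: local_form_eq local_mvf_eq)
  next
    case False
    have "smooth_on (snd c ` (U \<inter> fst c)) (\<lambda>y. 0::real)" by simp
    moreover have "local_form M c Y y vs = 0" if "y \<in> snd c ` (U \<inter> fst c)" for y
      using that alternating_wrong_length[OF mvf_on_alternating[OF Y]] False
      by (auto simp: local_form_eq chart_inv_left[OF M c])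
    ultimately show ?thesis using smooth_on_cong[OF open_chart_image_Int[OF M c U]] by metis
  qed
qed

context
  fixes M :: "('a, 'v::euclidean_space) manifold" and U and N :: "('b, 'w::euclidean_space) manifold" and V and \<phi>
  assumes M: "charted M" and N: "charted N" and \<phi>: "diffeo_on M U N V \<phi>"
begin

lemma contr_pullback:
  assumes p: "p \<in> U" and X: "alternating m (X p)" and \<omega>: "alternating r (\<omega> (\<phi> p))"
  shows "contr m X (pullback M N \<phi> \<omega>) p ws = pullback M N \<phi> (contr m (pushforward M U N \<phi> X) \<omega>) p ws"
  using contraction_adjoint[OF mderiv_linear[OF M N diffeo_near[OF M N \<phi> p]] X \<omega>, of "map (mderiv M N \<phi> p) ws"]
  by (simp add: contr_eq pullback_def pushforward_at[OF M N \<phi> p] rev_map)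

lemma lie_pullback:
  assumes p: "p \<in> U" and X: "mvf_on M U m X" and \<omega>: "form_on N V r \<omega>"
  shows "lie M m X (pullback M N \<phi> \<omega>) p ws = pullback M N \<phi> (lie N m (pushforward M U N \<phi> X) \<omega>) p ws"
proof -
  note o = diffeo_open[OF M N \<phi>] and s = diffeo_smooth(1)[OF M N \<phi>] and mem = diffeo_mem[OF M N \<phi>]
  have UV: "\<phi> ` U \<subseteq> V" using mem by auto
  let ?X = "pushforward M U N \<phi> X"
  have X': "mvf_on N V m ?X" by (rule mvf_on_pushforward[OF M N \<phi> X])
  have "ext_deriv M (contr m X (pullback M N \<phi> \<omega>)) p ws = ext_deriv M (pullback M N \<phi> (contr m ?X \<omega>)) p ws"
    by (rule ext_deriv_cong[OF M o(1) p])
      (rule contr_pullback[of _ m X r \<omega>], auto intro: mvf_on_alternating[OF X] form_on_alternating[OF \<omega>] mem)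
  also have "\<dots> = pullback M N \<phi> (ext_deriv N (contr m ?X \<omega>)) p ws"
    by (rule ext_deriv_pullback[OF M N o s UV form_on_contr[OF N o(2) X' \<omega>] p])
  finally have 1: "ext_deriv M (contr m X (pullback M N \<phi> \<omega>)) p ws = pullback M N \<phi> (ext_deriv N (contr m ?X \<omega>)) p ws" .
  have "contr m X (ext_deriv M (pullback M N \<phi> \<omega>)) p ws = contr m X (pullback M N \<phi> (ext_deriv N \<omega>)) p ws"
    by (rule contr_cong[OF refl]) (rule ext_deriv_pullback[OF M N o s UV \<omega> p])
  also have "\<dots> = pullback M N \<phi> (contr m ?X (ext_deriv N \<omega>)) p ws"
    by (rule contr_pullback[of p m X "Suc r" "ext_deriv N \<omega>", OF p mvf_on_alternating[OF X p]
          form_on_alternating[OF form_on_ext_deriv[OF N o(2) \<omega>] mem[OF p]]])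
  finally show ?thesis using 1 by (simp add: lie_def pullback_def)
qed

lemma inv_into_inverse: "p \<in> U \<Longrightarrow> inv_into V (inv_into U \<phi>) p = \<phi> p"
  using diffeo_bij[OF M N \<phi>] inv_into_inv_into_eq by metis

lemma diffeo_on_inverse: "diffeo_on N V M U (inv_into U \<phi>)"
  unfolding diffeo_on_def
proof (intro conjI)
  show "smooth_map_on M U N (inv_into V (inv_into U \<phi>))"
    by (rule smooth_map_on_cong[OF M N diffeo_open(1)[OF M N \<phi>] diffeo_smooth(1)[OF M N \<phi>]])
      (simp add: inv_into_inverse)
qed (use \<phi> bij_betw_inv_into in \<open>auto simp: diffeo_on_def\<close>)

lemma pullback_inverse_left: "p \<in> U \<Longrightarrow> pullback M N \<phi> (pullback N M (inv_into U \<phi>) \<omega>) p vs = \<omega> p vs"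
  by (rule pullback_inverse[OF M N diffeo_near[OF M N \<phi>] diffeo_near_inv[OF M N \<phi>] diffeo_open(1)[OF M N \<phi>]])
    (auto simp: diffeo_mem[OF M N \<phi>] diffeo_inv_left[OF M N \<phi>])

lemma pullback_inverse_right:
  assumes q: "q \<in> V" shows "pullback N M (inv_into U \<phi>) (pullback M N \<phi> \<omega>) q vs = \<omega> q vs"
proof -
  note m = diffeo_inv_mem[OF M N \<phi>]
  show ?thesis
    by (rule pullback_inverse[OF N M diffeo_near_inv[OF M N \<phi> q] diffeo_near[OF M N \<phi> m[OF q]] diffeo_open(2)[OF M N \<phi>] q])
      (rule diffeo_inv_right[OF M N \<phi>])
qed

lemma pushforward_inverse_left:
  assumes p: "p \<in> U"
  shows "pushforward N V M (inv_into U \<phi>) (pushforward M U N \<phi> X) p as = X p as"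
proof -
  let ?\<psi> = "inv_into U \<phi>"
  have q: "\<phi> p \<in> V" by (rule diffeo_mem[OF M N \<phi> p])
  have inv: "mderiv N M ?\<psi> (\<phi> p) \<circ> mderiv M N \<phi> p = id"
    by (rule mderiv_inverse[OF M N diffeo_near[OF M N \<phi> p] diffeo_near_inv[OF M N \<phi> q] diffeo_open(1)[OF M N \<phi>] p])
      (rule diffeo_inv_left[OF M N \<phi>])
  have "adjoint (mderiv M N \<phi> p) \<circ> adjoint (mderiv N M ?\<psi> (\<phi> p)) = id"
    using arg_cong[OF inv, of adjoint] adjoint_id
      adjoint_comp[OF mderiv_linear[OF M N diffeo_near[OF M N \<phi> p]] mderiv_linear[OF N M diffeo_near_inv[OF M N \<phi> q]]]
    by metis
  then show ?thesis
    using pushforward_at[OF N M diffeo_on_inverse q, of "pushforward M U N \<phi> X" as] p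
    by (simp add: pushforward_at[OF M N \<phi>] diffeo_inv_left[OF M N \<phi>])
qed

end

section \<open>Maps induced on quotients\<close>

context
  fixes S1 :: "'x set" and r1 and S2 :: "'y set" and r2 and f
  assumes r1: "equiv S1 r1" and r2: "equiv S2 r2"
    and f: "\<And>x y. (x, y) \<in> r1 \<Longrightarrow> (f x, f y) \<in> r2"
begin

text \<open>The image of a class is the union over all its representatives of the classes of their images; for
  a map that respects the relations, these classes coincide.\<close>

lemma induced_class: 
  assumes "x \<in> S1" shows "induced r2 f (r1 `` {x}) = r2 `` {f x}"
proof -
  have "r2 `` {f y} = r2 `` {f x}" if "(x, y) \<in> r1" for y
    using equiv_class_eq[OF r2 f[OF that]] by simp
  moreover have "(x, x) \<in> r1" using assms r1 by (meson equivE refl_onD)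
  ultimately show ?thesis unfolding induced_def by blast
qed

lemma induced_mem:
  assumes "x \<in> S1" shows "f x \<in> S2"
proof -
  have "(x, x) \<in> r1" using assms r1 by (meson equivE refl_onD)
  from f[OF this] show ?thesis using equiv_type[OF r2] by auto
qed

lemma induced_bij:
  assumes g: "\<And>x y. (x, y) \<in> r2 \<Longrightarrow> (g x, g y) \<in> r1"
    and gf: "\<And>x. x \<in> S1 \<Longrightarrow> (g (f x), x) \<in> r1" and fg: "\<And>y. y \<in> S2 \<Longrightarrow> (f (g y), y) \<in> r2"
  shows "bij_betw (induced r2 f) (S1 // r1) (S2 // r2)"
proof (rule bij_betw_byWitness[where f'="induced r1 g"])
  have g': "induced r1 g (r2 `` {y}) = r1 `` {g y}" if "y \<in> S2" for y
  proof -
    have "r1 `` {g z} = r1 `` {g y}" if "(y, z) \<in> r2" for z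
      using equiv_class_eq[OF r1 g[OF that]] by simp
    moreover have "(y, y) \<in> r2" using that r2 by (meson equivE refl_onD)
    ultimately show ?thesis unfolding induced_def by blast
  qed
  have gm: "g y \<in> S1" if "y \<in> S2" for y
  proof -
    have "(y, y) \<in> r2" using that r2 by (meson equivE refl_onD)
    from g[OF this] show ?thesis using equiv_type[OF r1] by auto
  qed
  show "\<forall>A\<in>S1 // r1. induced r1 g (induced r2 f A) = A"
    by (auto elim!: quotientE simp: induced_class g' induced_mem equiv_class_eq[OF r1 gf])
  show "\<forall>B\<in>S2 // r2. induced r2 f (induced r1 g B) = B"
    by (auto elim!: quotientE simp: induced_class g' gm equiv_class_eq[OF r2 fg])
  show "induced r2 f ` (S1 // r1) \<subseteq> S2 // r2"
    by (auto elim!: quotientE simp: induced_class intro!: quotientI induced_mem)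
  show "induced r1 g ` (S2 // r2) \<subseteq> S1 // r1"
    by (auto elim!: quotientE simp: g' intro!: quotientI gm)
qed

lemma induced_op1:
  assumes o1: "\<And>x y. (x, y) \<in> r1 \<Longrightarrow> (o1 x, o1 y) \<in> r1" and o2: "\<And>x y. (x, y) \<in> r2 \<Longrightarrow> (o2 x, o2 y) \<in> r2"
    and fo: "\<And>x. x \<in> S1 \<Longrightarrow> f (o1 x) = o2 (f x)" and A: "A \<in> S1 // r1"
  shows "induced r2 f (\<Union>x\<in>A. r1 `` {o1 x}) = (\<Union>y\<in>induced r2 f A. r2 `` {o2 y})"
proof -
  obtain x where x: "x \<in> S1" "A = r1 `` {x}" using A by (auto elim: quotientE)
  have xx: "(x, x) \<in> r1" using x r1 by (meson equivE refl_onD)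
  have o1x: "o1 x \<in> S1" using o1[OF xx] equiv_type[OF r1] by auto
  have "r1 `` {o1 y} = r1 `` {o1 x}" if "y \<in> A" for y
    using equiv_class_eq[OF r1 o1[of x y]] that x by simp
  moreover have "x \<in> A" using xx x by auto
  ultimately have "(\<Union>x\<in>A. r1 `` {o1 x}) = r1 `` {o1 x}" by blast
  then have 1: "induced r2 f (\<Union>x\<in>A. r1 `` {o1 x}) = r2 `` {o2 (f x)}"
    using induced_class[OF o1x] fo[OF x(1)] by simp
  have "r2 `` {o2 y} = r2 `` {o2 (f x)}" if "y \<in> induced r2 f A" for y
    using equiv_class_eq[OF r2 o2[of "f x" y]] that x induced_class[OF x(1)] by simp
  moreover have "f x \<in> induced r2 f A" using f[OF xx] x induced_class[OF x(1)] by auto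
  ultimately have "(\<Union>y\<in>induced r2 f A. r2 `` {o2 y}) = r2 `` {o2 (f x)}" by blast
  with 1 show ?thesis by simp
qed

lemma induced_op2:
  assumes o1: "\<And>x y x' y'. (x, y) \<in> r1 \<Longrightarrow> (x', y') \<in> r1 \<Longrightarrow> (o1 x x', o1 y y') \<in> r1"
    and o2: "\<And>x y x' y'. (x, y) \<in> r2 \<Longrightarrow> (x', y') \<in> r2 \<Longrightarrow> (o2 x x', o2 y y') \<in> r2"
    and fo: "\<And>x x'. x \<in> S1 \<Longrightarrow> x' \<in> S1 \<Longrightarrow> f (o1 x x') = o2 (f x) (f x')"
    and A: "A \<in> S1 // r1" and B: "B \<in> S1 // r1"
  shows "induced r2 f (\<Union>x\<in>A. \<Union>x'\<in>B. r1 `` {o1 x x'}) =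
    (\<Union>y\<in>induced r2 f A. \<Union>y'\<in>induced r2 f B. r2 `` {o2 y y'})"
proof -
  obtain x where x: "x \<in> S1" "A = r1 `` {x}" using A by (auto elim: quotientE)
  obtain x' where x': "x' \<in> S1" "B = r1 `` {x'}" using B by (auto elim: quotientE)
  have xx: "(x, x) \<in> r1" "(x', x') \<in> r1" using x x' r1 by (meson equivE refl_onD)+
  have o1x: "o1 x x' \<in> S1" using o1[OF xx] equiv_type[OF r1] by auto
  have "r1 `` {o1 y y'} = r1 `` {o1 x x'}" if "y \<in> A" "y' \<in> B" for y y'
    using equiv_class_eq[OF r1 o1[of x y x' y']] that x x' by simp
  moreover have "x \<in> A" "x' \<in> B" using xx x x' by auto
  ultimately have "(\<Union>y\<in>A. \<Union>y'\<in>B. r1 `` {o1 y y'}) = r1 `` {o1 x x'}" by blast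
  then have 1: "induced r2 f (\<Union>x\<in>A. \<Union>x'\<in>B. r1 `` {o1 x x'}) = r2 `` {o2 (f x) (f x')}"
    using induced_class[OF o1x] fo[OF x(1) x'(1)] by simp
  have cl: "induced r2 f A = r2 `` {f x}" "induced r2 f B = r2 `` {f x'}"
    using x x' induced_class by auto
  have "r2 `` {o2 y y'} = r2 `` {o2 (f x) (f x')}" if "y \<in> induced r2 f A" "y' \<in> induced r2 f B" for y y'
    using equiv_class_eq[OF r2 o2[of "f x" y "f x'" y']] that cl by simp
  moreover have "f x \<in> induced r2 f A" "f x' \<in> induced r2 f B" using f[OF xx(1)] f[OF xx(2)] cl by auto
  ultimately have "(\<Union>y\<in>induced r2 f A. \<Union>y'\<in>induced r2 f B. r2 `` {o2 y y'}) = r2 `` {o2 (f x) (f x')}" by blast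
  with 1 show ?thesis by simp
qed

end

text \<open>Compatibility with a set-valued bracket, where the bracket of two classes is the union over all
  pairs of representatives. If both \<open>f\<close> and its inverse \<open>g\<close> carry brackets of representatives to
  brackets of representatives, these unions correspond to each other.\<close>

lemma induced_bracket:
  fixes f :: "'x \<Rightarrow> 'y" and g :: "'y \<Rightarrow> 'x"
  assumes r1: "\<And>m. m \<in> D \<Longrightarrow> equiv (S1 m) (r1 m)" and r2: "\<And>m. m \<in> D \<Longrightarrow> equiv (S2 m) (r2 m)"
    and f: "\<And>m x y. m \<in> D \<Longrightarrow> (x, y) \<in> r1 m \<Longrightarrow> (f x, f y) \<in> r2 m"
    and g: "\<And>m x y. m \<in> D \<Longrightarrow> (x, y) \<in> r2 m \<Longrightarrow> (g x, g y) \<in> r1 m"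
    and gf: "\<And>m x. m \<in> D \<Longrightarrow> x \<in> S1 m \<Longrightarrow> (g (f x), x) \<in> r1 m"
    and fg: "\<And>m y. m \<in> D \<Longrightarrow> y \<in> S2 m \<Longrightarrow> (f (g y), y) \<in> r2 m"
    and D: "i \<in> D" "j \<in> D" "l \<in> D" and A: "A \<in> S1 i // r1 i" and B: "B \<in> S1 j // r1 j"
    and fb: "\<And>x y z. x \<in> S1 i \<Longrightarrow> y \<in> S1 j \<Longrightarrow> z \<in> b1 x y \<Longrightarrow> f z \<in> b2 (f x) (f y)"
    and gb: "\<And>x y z. x \<in> S2 i \<Longrightarrow> y \<in> S2 j \<Longrightarrow> z \<in> b2 x y \<Longrightarrow> g z \<in> b1 (g x) (g y)"
  shows "induced (r2 l) f (\<Union>x\<in>A. \<Union>y\<in>B. r1 l `` b1 x y) =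
    (\<Union>x\<in>induced (r2 i) f A. \<Union>y\<in>induced (r2 j) f B. r2 l `` b2 x y)" (is "?L = ?R")
proof
  have refl1: "(x, x) \<in> r1 m" if "m \<in> D" "x \<in> S1 m" for m x using r1[OF that(1)] that(2) by (meson equivE refl_onD)
  have refl2: "(x, x) \<in> r2 m" if "m \<in> D" "x \<in> S2 m" for m x using r2[OF that(1)] that(2) by (meson equivE refl_onD)
  have trans1: "(x, z) \<in> r1 m" if "m \<in> D" "(x, y) \<in> r1 m" "(y, z) \<in> r1 m" for m x y z
    using r1[OF that(1)] that(2,3) by (meson equivE transD)
  have trans2: "(x, z) \<in> r2 m" if "m \<in> D" "(x, y) \<in> r2 m" "(y, z) \<in> r2 m" for m x y z
    using r2[OF that(1)] that(2,3) by (meson equivE transD)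
  have sym1: "(y, x) \<in> r1 m" if "m \<in> D" "(x, y) \<in> r1 m" for m x y
    using r1[OF that(1)] that(2) by (meson equivE symD)
  have mem1: "x \<in> S1 m \<and> y \<in> S1 m" if "m \<in> D" "(x, y) \<in> r1 m" for m x y
    using equiv_type[OF r1[OF that(1)]] that(2) by auto
  have mem2: "x \<in> S2 m \<and> y \<in> S2 m" if "m \<in> D" "(x, y) \<in> r2 m" for m x y
    using equiv_type[OF r2[OF that(1)]] that(2) by auto
  have AS: "x \<in> S1 i" if "x \<in> A" for x using A that mem1[OF D(1)] by (auto elim: quotientE)
  have BS: "x \<in> S1 j" if "x \<in> B" for x using B that mem1[OF D(2)] by (auto elim: quotientE)
  have Acl: "y \<in> A" if "x \<in> A" "(x, y) \<in> r1 i" for x y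
    using A that trans1[OF D(1)] by (auto elim!: quotientE)
  have Bcl: "y \<in> B" if "x \<in> B" "(x, y) \<in> r1 j" for x y
    using B that trans1[OF D(2)] by (auto elim!: quotientE)
  show "?L \<subseteq> ?R"
  proof
    fix w assume "w \<in> ?L"
    then obtain z z' x y where h: "(f z', w) \<in> r2 l" "(z, z') \<in> r1 l" "x \<in> A" "y \<in> B" "z \<in> b1 x y"
      by (auto simp: induced_def)
    have "f z \<in> b2 (f x) (f y)" by (rule fb) (use h AS BS in auto)
    moreover have "(f z, w) \<in> r2 l" using trans2[OF D(3) f[OF D(3) h(2)] h(1)] .
    moreover have "f x \<in> induced (r2 i) f A" "f y \<in> induced (r2 j) f B"
      using h(3,4) f[OF D(1) refl1[OF D(1) AS[OF h(3)]]] f[OF D(2) refl1[OF D(2) BS[OF h(4)]]]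
      unfolding induced_def by blast+
    ultimately show "w \<in> ?R" by blast
  qed
  show "?R \<subseteq> ?L"
  proof
    fix w assume "w \<in> ?R"
    then obtain z x y x' y' where h: "(z, w) \<in> r2 l" "z \<in> b2 x' y'" "x \<in> A" "y \<in> B"
      "(f x, x') \<in> r2 i" "(f y, y') \<in> r2 j"
      by (auto simp: induced_def)
    have gx: "g x' \<in> A"
      by (rule Acl[OF h(3) trans1[OF D(1) sym1[OF D(1) gf[OF D(1) AS[OF h(3)]]] g[OF D(1) h(5)]]])
    have gy: "g y' \<in> B"
      by (rule Bcl[OF h(4) trans1[OF D(2) sym1[OF D(2) gf[OF D(2) BS[OF h(4)]]] g[OF D(2) h(6)]]])
    have "g z \<in> b1 (g x') (g y')" by (rule gb) (use h mem2[OF D(1)] mem2[OF D(2)] in auto)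
    moreover have "(g z, g z) \<in> r1 l" using refl2[OF D(3)] mem2[OF D(3) h(1)] g[OF D(3)] by blast
    moreover have "(f (g z), w) \<in> r2 l"
      using trans2[OF D(3) fg[OF D(3)] h(1)] mem2[OF D(3) h(1)] by blast
    ultimately show "w \<in> ?L" using gx gy unfolding induced_def by blast
  qed
qed

section \<open>Locally Hamiltonian fields and classes of Hamiltonian forms\<close>

lemma ext_deriv_cmult:
  assumes "charted M" "openin (mtop M) U" "form_on M U r \<omega>" "p \<in> U"
  shows "ext_deriv M (\<lambda>p vs. a * \<omega> p vs) p vs = a * ext_deriv M \<omega> p vs"
  using ext_deriv_lincomb[OF assms(1,2,3,3,4), of a 0] by simp

lemma ext_deriv_zero: "ext_deriv M (\<lambda>p ws. 0) p ws = 0"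
  by (simp add: ext_deriv_def ext_deriv_flat_del_nth local_form_eq)

context
  fixes M :: "('a, 'v::euclidean_space) manifold" and \<Omega> k
  assumes M: "charted M" and \<Omega>: "form_on M (points M) k \<Omega>"
begin

lemma locally_hamiltonian_lincomb:
  assumes "X \<in> locally_hamiltonian M \<Omega> m" "Y \<in> locally_hamiltonian M \<Omega> m"
  shows "(\<lambda>p as. a * X p as + b * Y p as) \<in> locally_hamiltonian M \<Omega> m"
proof -
  have X: "mvf_on M (points M) m X" "\<And>p ws. p \<in> points M \<Longrightarrow> ext_deriv M (contr m X \<Omega>) p ws = 0"
    and Y: "mvf_on M (points M) m Y" "\<And>p ws. p \<in> points M \<Longrightarrow> ext_deriv M (contr m Y \<Omega>) p ws = 0"
    using assms by (auto simp: locally_hamiltonian_def)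
  have "ext_deriv M (contr m (\<lambda>p as. a * X p as + b * Y p as) \<Omega>) p ws = 0" if p: "p \<in> points M" for p ws
    using ext_deriv_lincomb[OF M openin_topspace form_on_contr[OF M openin_topspace X(1) \<Omega>]
        form_on_contr[OF M openin_topspace Y(1) \<Omega>] p, of a b] X(2)[OF p] Y(2)[OF p]
    by (simp add: contr_lincomb_mvf[abs_def])
  then show ?thesis using mvf_on_lincomb[OF M openin_topspace X(1) Y(1)] by (simp add: locally_hamiltonian_def)
qed

lemma characteristic_lincomb:
  assumes "X \<in> characteristic M \<Omega> m" "Y \<in> characteristic M \<Omega> m"
  shows "(\<lambda>p as. a * X p as + b * Y p as) \<in> characteristic M \<Omega> m"
  using assms mvf_on_lincomb[OF M openin_topspace] by (auto simp: characteristic_def contr_lincomb_mvf)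

lemma characteristic_zero:
  assumes "\<And>p as. p \<in> points M \<Longrightarrow> X p as = 0" shows "X \<in> characteristic M \<Omega> m"
  using mvf_on_cong[OF M openin_topspace mvf_on_zero, of X] assms
  by (simp add: characteristic_def contr_eq)

lemma mod_char_eqI:
  assumes "X \<in> locally_hamiltonian M \<Omega> m" "Y \<in> locally_hamiltonian M \<Omega> m"
    "\<And>p as. p \<in> points M \<Longrightarrow> X p as = Y p as"
  shows "(X, Y) \<in> mod_char M \<Omega> m"
  using assms characteristic_zero by (simp add: mod_char_def)

lemma equiv_mod_char: "equiv (locally_hamiltonian M \<Omega> m) (mod_char M \<Omega> m)"
proof (rule equivI)
  show "mod_char M \<Omega> m \<subseteq> locally_hamiltonian M \<Omega> m \<times> locally_hamiltonian M \<Omega> m"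
    by (auto simp: mod_char_def)
  show "refl_on (locally_hamiltonian M \<Omega> m) (mod_char M \<Omega> m)"
    by (auto simp: refl_on_def mod_char_eqI)
  show "sym (mod_char M \<Omega> m)"
  proof (rule symI)
    fix X Y assume "(X, Y) \<in> mod_char M \<Omega> m"
    then show "(Y, X) \<in> mod_char M \<Omega> m"
      using characteristic_lincomb[of "\<lambda>p as. X p as - Y p as" m "\<lambda>p as. X p as - Y p as" "-1" 0]
      by (simp add: mod_char_def)
  qed
  show "trans (mod_char M \<Omega> m)"
  proof (rule transI)
    fix X Y Z assume "(X, Y) \<in> mod_char M \<Omega> m" "(Y, Z) \<in> mod_char M \<Omega> m"
    then show "(X, Z) \<in> mod_char M \<Omega> m"
      using characteristic_lincomb[of "\<lambda>p as. X p as - Y p as" m "\<lambda>p as. Y p as - Z p as" 1 1]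
      by (simp add: mod_char_def)
  qed
qed

lemma mod_char_lincomb:
  assumes "(X, X') \<in> mod_char M \<Omega> m" "(Y, Y') \<in> mod_char M \<Omega> m"
  shows "((\<lambda>p as. a * X p as + b * Y p as), (\<lambda>p as. a * X' p as + b * Y' p as)) \<in> mod_char M \<Omega> m"
  using assms characteristic_lincomb[of "\<lambda>p as. X p as - X' p as" m "\<lambda>p as. Y p as - Y' p as" a b]
  by (simp add: mod_char_def locally_hamiltonian_lincomb algebra_simps)

lemma mod_char_add:
  "(X, X') \<in> mod_char M \<Omega> m \<Longrightarrow> (Y, Y') \<in> mod_char M \<Omega> m \<Longrightarrow> (field_add X Y, field_add X' Y') \<in> mod_char M \<Omega> m"
  using mod_char_lincomb[of X X' m Y Y' 1 1] by (simp add: field_add_def)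

lemma mod_char_scale:
  "(X, X') \<in> mod_char M \<Omega> m \<Longrightarrow> (field_scale r X, field_scale r X') \<in> mod_char M \<Omega> m"
  using mod_char_lincomb[of X X' m X X' r 0] by (simp add: field_scale_def)

lemma ham_forms_lincomb:
  assumes U: "openin (mtop M) U" and "\<zeta> \<in> ham_forms M k \<Omega> U m" "\<xi> \<in> ham_forms M k \<Omega> U m"
  shows "(\<lambda>p ws. a * \<zeta> p ws + b * \<xi> p ws) \<in> ham_forms M k \<Omega> U m"
proof -
  obtain X Y where X: "X \<in> locally_hamiltonian M \<Omega> m" "form_on M U (k - m - 1) \<zeta>"
      "\<And>p ws. p \<in> U \<Longrightarrow> contr m X \<Omega> p ws = ext_deriv M \<zeta> p ws"
    and Y: "Y \<in> locally_hamiltonian M \<Omega> m" "form_on M U (k - m - 1) \<xi>"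
      "\<And>p ws. p \<in> U \<Longrightarrow> contr m Y \<Omega> p ws = ext_deriv M \<xi> p ws"
    using assms by (auto simp: ham_forms_def hamiltonian_form_def)
  have "hamiltonian_form M k \<Omega> U m (\<lambda>p as. a * X p as + b * Y p as) (\<lambda>p ws. a * \<zeta> p ws + b * \<xi> p ws)"
    unfolding hamiltonian_form_def using form_on_lincomb[OF M U X(2) Y(2)]
    by (simp add: contr_lincomb_mvf ext_deriv_lincomb[OF M U X(2) Y(2)] X(3) Y(3))
  then show ?thesis using locally_hamiltonian_lincomb[OF X(1) Y(1)] by (auto simp: ham_forms_def)
qed

lemma closed_form_on_lincomb:
  assumes U: "openin (mtop M) U" and "closed_form_on M U r \<zeta>" "closed_form_on M U r \<xi>"
  shows "closed_form_on M U r (\<lambda>p ws. a * \<zeta> p ws + b * \<xi> p ws)"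
proof -
  have "form_on M U r \<zeta>" "form_on M U r \<xi>" using assms(2,3) by (auto simp: closed_form_on_def)
  from ext_deriv_lincomb[OF M U this] form_on_lincomb[OF M U this] show ?thesis
    using assms(2,3) by (simp add: closed_form_on_def)
qed

lemma closed_form_on_zero:
  assumes U: "openin (mtop M) U" and z: "\<And>p ws. p \<in> U \<Longrightarrow> \<zeta> p ws = 0"
  shows "closed_form_on M U r \<zeta>"
proof -
  have "form_on M U r \<zeta>" by (rule form_on_cong[OF M U form_on_zero]) (simp add: z)
  moreover have "ext_deriv M \<zeta> p ws = 0" if "p \<in> U" for p ws
    using ext_deriv_cong[OF M U that z] ext_deriv_zero[of M p ws] by simp
  ultimately show ?thesis by (simp add: closed_form_on_def)
qed

lemma mod_closed_eqI:
  assumes "openin (mtop M) U" "\<zeta> \<in> ham_forms M k \<Omega> U m" "\<xi> \<in> ham_forms M k \<Omega> U m"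
    "\<And>p ws. p \<in> U \<Longrightarrow> \<zeta> p ws = \<xi> p ws"
  shows "(\<zeta>, \<xi>) \<in> mod_closed M k \<Omega> U m"
  using assms closed_form_on_zero[OF assms(1)] by (simp add: mod_closed_def)

lemma equiv_mod_closed:
  assumes U: "openin (mtop M) U" shows "equiv (ham_forms M k \<Omega> U m) (mod_closed M k \<Omega> U m)"
proof (rule equivI)
  show "mod_closed M k \<Omega> U m \<subseteq> ham_forms M k \<Omega> U m \<times> ham_forms M k \<Omega> U m"
    by (auto simp: mod_closed_def)
  show "refl_on (ham_forms M k \<Omega> U m) (mod_closed M k \<Omega> U m)"
    by (auto simp: refl_on_def mod_closed_eqI[OF U])
  show "sym (mod_closed M k \<Omega> U m)"
  proof (rule symI)
    fix X Y assume "(X, Y) \<in> mod_closed M k \<Omega> U m"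
    then show "(Y, X) \<in> mod_closed M k \<Omega> U m"
      using closed_form_on_lincomb[OF U, of _ "\<lambda>p as. X p as - Y p as" "\<lambda>p as. X p as - Y p as" "-1" 0]
      by (simp add: mod_closed_def)
  qed
  show "trans (mod_closed M k \<Omega> U m)"
  proof (rule transI)
    fix X Y Z assume "(X, Y) \<in> mod_closed M k \<Omega> U m" "(Y, Z) \<in> mod_closed M k \<Omega> U m"
    then show "(X, Z) \<in> mod_closed M k \<Omega> U m"
      using closed_form_on_lincomb[OF U, of _ "\<lambda>p as. X p as - Y p as" "\<lambda>p as. Y p as - Z p as" 1 1]
      by (simp add: mod_closed_def)
  qed
qed

lemma mod_closed_lincomb:
  assumes U: "openin (mtop M) U"
    and "(X, X') \<in> mod_closed M k \<Omega> U m" "(Y, Y') \<in> mod_closed M k \<Omega> U m"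
  shows "((\<lambda>p as. a * X p as + b * Y p as), (\<lambda>p as. a * X' p as + b * Y' p as)) \<in> mod_closed M k \<Omega> U m"
  using assms closed_form_on_lincomb[OF U, of _ "\<lambda>p as. X p as - X' p as" "\<lambda>p as. Y p as - Y' p as" a b]
  by (simp add: mod_closed_def ham_forms_lincomb[OF U] algebra_simps)

lemma mod_closed_add:
  "openin (mtop M) U \<Longrightarrow> (X, X') \<in> mod_closed M k \<Omega> U m \<Longrightarrow> (Y, Y') \<in> mod_closed M k \<Omega> U m \<Longrightarrow>
    (field_add X Y, field_add X' Y') \<in> mod_closed M k \<Omega> U m"
  using mod_closed_lincomb[of U X X' m Y Y' 1 1] by (simp add: field_add_def)

lemma mod_closed_scale:
  "openin (mtop M) U \<Longrightarrow> (X, X') \<in> mod_closed M k \<Omega> U m \<Longrightarrow>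
    (field_scale r X, field_scale r X') \<in> mod_closed M k \<Omega> U m"
  using mod_closed_lincomb[of U X X' m X X' r 0] by (simp add: field_scale_def)

end

section \<open>Naturality under a diffeomorphism\<close>

locale diffeo_pair =
  fixes M :: "('a, 'v::euclidean_space) manifold" and N :: "('b, 'v) manifold" and \<phi> :: "'a \<Rightarrow> 'b"
  assumes M: "charted M" and N: "charted N" and \<phi>: "diffeomorphism M N \<phi>"
begin

abbreviation \<psi> :: "'b \<Rightarrow> 'a" where "\<psi> \<equiv> inv_into (points M) \<phi>"
abbreviation push :: "('a, 'v) tfield \<Rightarrow> ('b, 'v) tfield" where "push \<equiv> pushforward M (points M) N \<phi>"
abbreviation pull :: "('b, 'v) tfield \<Rightarrow> ('a, 'v) tfield" where "pull \<equiv> pullback M N \<phi>"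
abbreviation push_inv :: "('b, 'v) tfield \<Rightarrow> ('a, 'v) tfield" where "push_inv \<equiv> pushforward N (points N) M \<psi>"
abbreviation pull_inv :: "('a, 'v) tfield \<Rightarrow> ('b, 'v) tfield" where "pull_inv \<equiv> pullback N M \<psi>"

lemma inverse_pair: "diffeo_pair N M \<psi>"
  by unfold_locales (rule N, rule M, rule diffeo_on_inverse[OF M N \<phi>])

lemmas mem = diffeo_mem[OF M N \<phi>] and inv_mem = diffeo_inv_mem[OF M N \<phi>]
  and inv_left = diffeo_inv_left[OF M N \<phi>] and inv_right = diffeo_inv_right[OF M N \<phi>]

lemma points_image: "\<phi> ` points M = points N"
  using diffeo_bij[OF M N \<phi>] by (simp add: bij_betw_def)

lemma open_image:
  assumes U: "openin (mtop M) U" shows "openin (mtop N) (\<phi> ` U)"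
proof -
  have "\<phi> ` U = {q \<in> points N. \<psi> q \<in> U}"
    using openin_subset[OF U] mem inv_left inv_right by (auto simp: image_iff) metis
  moreover have "openin (mtop N) {q \<in> points N. \<psi> q \<in> U}"
    using diffeo_smooth(2)[OF M N \<phi>] U by (intro openin_preimage[OF openin_topspace]) (auto simp: smooth_map_on_def)
  ultimately show ?thesis by simp
qed

lemma smooth_map_restrict: "openin (mtop M) U \<Longrightarrow> smooth_map_on M U N \<phi>"
  by (rule smooth_map_on_subset[OF diffeo_smooth(1)[OF M N \<phi>]]) (rule openin_subset)

lemma form_on_pull:
  assumes U: "openin (mtop M) U" and "form_on N (\<phi> ` U) r \<omega>" shows "form_on M U r (pull \<omega>)"
  by (rule form_on_pullback[OF M N U open_image[OF U] smooth_map_restrict[OF U] order_refl assms(2)])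

lemma ext_deriv_pull:
  assumes U: "openin (mtop M) U" and "form_on N (\<phi> ` U) r \<omega>" and "p \<in> U"
  shows "ext_deriv M (pull \<omega>) p vs = pull (ext_deriv N \<omega>) p vs"
  by (rule ext_deriv_pullback[OF M N U open_image[OF U] smooth_map_restrict[OF U] order_refl assms(2,3)])

text \<open>Equality of forms on \<open>N\<close> is tested after pull-back, since \<open>pull_inv\<close> undoes \<open>pull\<close>.\<close>

lemma pull_inject:
  assumes q: "q \<in> points N" and eq: "\<And>p ws. p \<in> points M \<Longrightarrow> pull \<alpha> p ws = pull \<beta> p ws"
  shows "\<alpha> q ws = \<beta> q ws"
proof -
  have "pull_inv (pull \<alpha>) q ws = pull_inv (pull \<beta>) q ws"
    using eq[OF inv_mem[OF q]] unfolding pullback_def[of N M] .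
  then show ?thesis using pullback_inverse_right[OF M N \<phi> q] by simp
qed

lemma mvf_on_push: "mvf_on M (points M) m X \<Longrightarrow> mvf_on N (points N) m (push X)"
  by (rule mvf_on_pushforward[OF M N \<phi>])

lemma contr_pull:
  assumes "mvf_on M (points M) m X" "form_on N (points N) r \<omega>" "p \<in> points M"
  shows "contr m X (pull \<omega>) p ws = pull (contr m (push X) \<omega>) p ws"
  by (rule contr_pullback[OF M N \<phi> assms(3), of m X r \<omega>])
    (auto intro: mvf_on_alternating[OF assms(1,3)] form_on_alternating[OF assms(2) mem[OF assms(3)]])

text \<open>Lie derivatives are natural, so the identity that defines the bracket on \<open>N\<close>, tested on a form
  \<open>\<alpha>\<close>, pulls back to the one that defines the bracket on \<open>M\<close>, tested on the pull-back of \<open>\<alpha>\<close>. The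
  normalisation of brackets with functions is transported by regarding functions as \<open>0\<close>-forms.\<close>

lemma schouten_push:
  assumes X: "mvf_on M (points M) i X" and Y: "mvf_on M (points M) j Y" and Z: "Z \<in> schouten M i j X Y"
  shows "push Z \<in> schouten N i j (push X) (push Y)"
proof -
  have Zm: "mvf_on M (points M) (i + j - 1) Z" using Z by (simp add: schouten_def)
  have Zl: "lie M (i + j - 1) Z \<alpha> p ws = lie M i X (lie M j Y \<alpha>) p ws -
      (-1) ^ ((i + 1) * (j + 1)) * lie M j Y (lie M i X \<alpha>) p ws"
    if "form_on M (points M) r \<alpha>" "p \<in> points M" for r \<alpha> p ws
    using Z that by (simp add: schouten_def)
  note L = lie_pullback[OF M N \<phi>]
  have two: "lie M i X (lie M j Y (pull \<alpha>)) p ws = pull (lie N i (push X) (lie N j (push Y) \<alpha>)) p ws"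
    if X: "mvf_on M (points M) i X" and Y: "mvf_on M (points M) j Y"
      and \<alpha>: "form_on N (points N) r \<alpha>" and p: "p \<in> points M" for i j X Y r \<alpha> p ws
  proof -
    have "lie M i X (lie M j Y (pull \<alpha>)) p ws = lie M i X (pull (lie N j (push Y) \<alpha>)) p ws"
      by (rule lie_cong[OF M openin_topspace p refl]) (rule L[OF _ Y \<alpha>])
    also have "\<dots> = pull (lie N i (push X) (lie N j (push Y) \<alpha>)) p ws"
      by (rule L[OF p X form_on_lie[OF N openin_topspace mvf_on_push[OF Y] \<alpha>]])
    finally show ?thesis .
  qed
  have "lie N (i + j - 1) (push Z) \<alpha> q ws = lie N i (push X) (lie N j (push Y) \<alpha>) q ws -
      (-1) ^ ((i + 1) * (j + 1)) * lie N j (push Y) (lie N i (push X) \<alpha>) q ws"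
    if \<alpha>: "form_on N (points N) r \<alpha>" and q: "q \<in> points N" for r \<alpha> q ws
  proof (rule pull_inject[OF q, of _ "\<lambda>q ws. lie N i (push X) (lie N j (push Y) \<alpha>) q ws -
      (-1) ^ ((i + 1) * (j + 1)) * lie N j (push Y) (lie N i (push X) \<alpha>) q ws"])
    fix p ws assume p: "p \<in> points M"
    have \<alpha>': "form_on M (points M) r (pull \<alpha>)" by (rule form_on_pull) (simp_all add: points_image \<alpha>)
    show "pull (lie N (i + j - 1) (push Z) \<alpha>) p ws =
      pull (\<lambda>q ws. lie N i (push X) (lie N j (push Y) \<alpha>) q ws -
        (-1) ^ ((i + 1) * (j + 1)) * lie N j (push Y) (lie N i (push X) \<alpha>) q ws) p ws"
      using Zl[OF \<alpha>' p, of ws] two[OF X Y \<alpha> p, of ws] two[OF Y X \<alpha> p, of ws] L[OF p Zm \<alpha>, of ws]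
      by (simp add: pullback_def)
  qed
  moreover have fn: "contr 1 (push X') (ext_deriv N (push Y')) q [] = contr 1 X' (ext_deriv M Y') (\<psi> q) []"
    if X': "mvf_on M (points M) 1 X'" and Y': "mvf_on M (points M) 0 Y'" and q: "q \<in> points N" for X' Y' q
  proof -
    have f: "form_on N (points N) 0 (push Y')" by (rule mvf_on_0_form[OF N openin_topspace mvf_on_push[OF Y']])
    have Y0: "Y' p vs = pull (push Y') p vs" if p: "p \<in> points M" for p vs
      using alternating_wrong_length[OF mvf_on_alternating[OF Y' p]]
      by (cases "vs = []") (simp_all add: pullback_def pushforward_at[OF M N \<phi> p])
    have p: "\<psi> q \<in> points M" by (rule inv_mem[OF q])
    have "contr 1 X' (ext_deriv M Y') (\<psi> q) [] = contr 1 X' (ext_deriv M (pull (push Y'))) (\<psi> q) []"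
      by (rule contr_cong[OF refl]) (rule ext_deriv_cong[OF M openin_topspace p Y0])
    also have "\<dots> = contr 1 X' (pull (ext_deriv N (push Y'))) (\<psi> q) []"
      by (rule contr_cong[OF refl]) (rule ext_deriv_pull[where r=0, OF openin_topspace _ p], simp add: points_image f)
    also have "\<dots> = pull (contr 1 (push X') (ext_deriv N (push Y'))) (\<psi> q) []"
      by (rule contr_pull[OF X' form_on_ext_deriv[OF N openin_topspace f] p])
    also have "\<dots> = contr 1 (push X') (ext_deriv N (push Y')) q []"
      by (simp add: pullback_def inv_right[OF q])
    finally show ?thesis by simp
  qed
  moreover have "push Z q [] = Z (\<psi> q) []" for q by (simp add: pushforward_def Let_def)
  ultimately show ?thesis
    using mvf_on_push[OF Zm] Z X Y inv_mem unfolding schouten_def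
    by auto
qed

end

section \<open>Conformal diffeomorphisms\<close>

text \<open>On an empty manifold every constant is admissible, including \<open>0\<close>. The constant is therefore required
  to be nonzero in the presence of a point only.\<close>

locale conformal_pair = diffeo_pair M N \<phi>
  for M :: "('a, 'v::euclidean_space) manifold" and N :: "('b, 'v) manifold" and \<phi> +
  fixes \<Omega>1 \<Omega>2 k c
  assumes \<Omega>1: "form_on M (points M) k \<Omega>1" and \<Omega>2: "form_on N (points N) k \<Omega>2"
    and conf: "\<And>p vs. p \<in> points M \<Longrightarrow> pull \<Omega>2 p vs = c * \<Omega>1 p vs"
    and c: "\<And>p. p \<in> points M \<Longrightarrow> c \<noteq> 0"
begin

text \<open>The inverse diffeomorphism is again conformal. Each statement about \<open>push\<close> or \<open>pull\<close> thus has a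
  counterpart for \<open>push_inv\<close> or \<open>pull_inv\<close>, which is how inverses on quotients are obtained.\<close>

lemma inverse_conformal: "conformal_pair N M \<psi> \<Omega>2 \<Omega>1 k (inverse c)"
proof (intro conformal_pair.intro inverse_pair conformal_pair_axioms.intro \<Omega>1 \<Omega>2)
  fix q assume q: "q \<in> points N"
  show "inverse c \<noteq> 0" using c[OF inv_mem[OF q]] by simp
  fix vs
  have "\<Omega>2 q vs = pull_inv (pull \<Omega>2) q vs" by (rule pullback_inverse_right[OF M N \<phi> q, symmetric])
  also have "\<dots> = c * pull_inv \<Omega>1 q vs" using conf[OF inv_mem[OF q]] by (simp add: pullback_def[of N M])
  finally show "pull_inv \<Omega>1 q vs = inverse c * \<Omega>2 q vs" using c[OF inv_mem[OF q]] by simp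
qed

lemma pull_contr_push:
  assumes X: "mvf_on M (points M) m X" and p: "p \<in> points M"
  shows "pull (contr m (push X) \<Omega>2) p ws = c * contr m X \<Omega>1 p ws"
proof -
  have "pull (contr m (push X) \<Omega>2) p ws = contr m X (pull \<Omega>2) p ws"
    by (rule contr_pull[OF X \<Omega>2 p, symmetric])
  also have "\<dots> = c * contr m X \<Omega>1 p ws" by (simp add: contr_eq conf[OF p] sum_distrib_left mult.left_commute)
  finally show ?thesis .
qed

lemma contr_push:
  assumes X: "mvf_on M (points M) m X" and q: "q \<in> points N"
  shows "contr m (push X) \<Omega>2 q ws = c * pull_inv (contr m X \<Omega>1) q ws"
proof -
  have "contr m (push X) \<Omega>2 q ws = pull_inv (pull (contr m (push X) \<Omega>2)) q ws"
    by (rule pullback_inverse_right[OF M N \<phi> q, symmetric])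
  also have "\<dots> = c * pull_inv (contr m X \<Omega>1) q ws"
    using pull_contr_push[OF X inv_mem[OF q]] by (simp add: pullback_def[of N M])
  finally show ?thesis .
qed

lemma push_locally_hamiltonian:
  assumes "X \<in> locally_hamiltonian M \<Omega>1 m" shows "push X \<in> locally_hamiltonian N \<Omega>2 m"
proof -
  have X: "mvf_on M (points M) m X" and d: "\<And>p ws. p \<in> points M \<Longrightarrow> ext_deriv M (contr m X \<Omega>1) p ws = 0"
    using assms by (auto simp: locally_hamiltonian_def)
  interpret inv: diffeo_pair N M \<psi> by (rule inverse_pair)
  have f: "form_on M (\<psi> ` points N) (k - m) (contr m X \<Omega>1)"
    unfolding inv.points_image by (rule form_on_contr[OF M openin_topspace X \<Omega>1])
  have "ext_deriv N (contr m (push X) \<Omega>2) q ws = 0" if q: "q \<in> points N" for q ws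
  proof -
    have "ext_deriv N (contr m (push X) \<Omega>2) q ws = ext_deriv N (\<lambda>q ws. c * pull_inv (contr m X \<Omega>1) q ws) q ws"
      by (rule ext_deriv_cong[OF N openin_topspace q]) (rule contr_push[OF X])
    also have "\<dots> = c * ext_deriv N (pull_inv (contr m X \<Omega>1)) q ws"
      by (rule ext_deriv_cmult[OF N openin_topspace inv.form_on_pull[OF openin_topspace f] q])
    also have "\<dots> = 0"
      using inv.ext_deriv_pull[OF openin_topspace f q] d[OF inv_mem[OF q]] by (simp add: pullback_def[of N M])
    finally show ?thesis .
  qed
  then show ?thesis using mvf_on_push[OF X] by (simp add: locally_hamiltonian_def)
qed

lemma push_characteristic:
  assumes "X \<in> characteristic M \<Omega>1 m" shows "push X \<in> characteristic N \<Omega>2 m"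
  using assms contr_push mvf_on_push inv_mem by (auto simp: characteristic_def pullback_def[of N M])

lemma push_mod_char: "(X, Y) \<in> mod_char M \<Omega>1 m \<Longrightarrow> (push X, push Y) \<in> mod_char N \<Omega>2 m"
  using push_characteristic[of "\<lambda>p as. X p as - Y p as" m] push_locally_hamiltonian
  by (auto simp: mod_char_def pushforward_def Let_def)

lemma closed_form_pull:
  assumes U: "openin (mtop M) U" and "closed_form_on N (\<phi> ` U) r \<eta>" shows "closed_form_on M U r (pull \<eta>)"
  using assms form_on_pull[OF U] ext_deriv_pull[OF U] by (auto simp: closed_form_on_def pullback_def)

lemma pull_hamiltonian_form:
  assumes U: "openin (mtop M) U" and X: "mvf_on M (points M) m X"
    and \<zeta>: "hamiltonian_form N k \<Omega>2 (\<phi> ` U) m (push X) \<zeta>"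
  shows "hamiltonian_form M k \<Omega>1 U m (\<lambda>p as. c * X p as) (pull \<zeta>)"
  unfolding hamiltonian_form_def
proof (intro conjI ballI allI)
  have f: "form_on N (\<phi> ` U) (k - m - 1) \<zeta>" using \<zeta> by (simp add: hamiltonian_form_def)
  show "form_on M U (k - m - 1) (pull \<zeta>)" by (rule form_on_pull[OF U f])
  fix p ws assume p: "p \<in> U"
  then have pM: "p \<in> points M" using U openin_subset by blast
  have "ext_deriv M (pull \<zeta>) p ws = pull (contr m (push X) \<Omega>2) p ws"
    using ext_deriv_pull[OF U f p] \<zeta> p by (simp add: hamiltonian_form_def pullback_def)
  also have "\<dots> = contr m (\<lambda>p as. c * X p as) \<Omega>1 p ws"
    using pull_contr_push[OF X pM] contr_lincomb_mvf[of m c X 0 X] by simp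
  finally show "contr m (\<lambda>p as. c * X p as) \<Omega>1 p ws = ext_deriv M (pull \<zeta>) p ws" by simp
qed

text \<open>The inverse of \<open>\<psi>\<close> in the sense of \<^const>\<open>inv_into\<close> agrees with \<open>\<phi>\<close> on the points of \<open>M\<close>, not
  as a total function; hence the detour through germs.\<close>

lemma push_push_inv: "q \<in> points N \<Longrightarrow> push (push_inv X) q as = X q as"
proof -
  assume q: "q \<in> points N"
  interpret inv: diffeo_pair N M \<psi> by (rule inverse_pair)
  have eq: "inv_into (points N) \<psi> p = \<phi> p" if "p \<in> points M" for p by (rule inv_into_inverse[OF M N \<phi> that])
  have "mderiv M N (inv_into (points N) \<psi>) (\<psi> q) = mderiv M N \<phi> (\<psi> q)"
    by (rule mderiv_cong[OF M openin_topspace inv_mem[OF q]]) (rule eq)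
  moreover have "inv_into (points M) (inv_into (points N) \<psi>) q = \<psi> q"
    by (rule inv_into_inverse[OF N M inv.\<phi> q])
  ultimately have "inv.push_inv (inv.push X) q as = push (push_inv X) q as"
    by (simp add: pushforward_def Let_def)
  then show ?thesis using pushforward_inverse_left[OF N M inv.\<phi> q, of X as] by simp
qed

text \<open>A form on the image that is Hamiltonian for \<open>X\<close> is pulled back to one that is Hamiltonian for
  \<open>c\<close> times the transport of \<open>X\<close> to \<open>M\<close>.\<close>

lemma pull_ham_forms:
  assumes U: "openin (mtop M) U" and "\<zeta> \<in> ham_forms N k \<Omega>2 (\<phi> ` U) m"
  shows "pull \<zeta> \<in> ham_forms M k \<Omega>1 U m"
proof -
  interpret inv: conformal_pair N M \<psi> \<Omega>2 \<Omega>1 k "inverse c" by (rule inverse_conformal)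
  obtain X where X: "X \<in> locally_hamiltonian N \<Omega>2 m" and \<zeta>: "hamiltonian_form N k \<Omega>2 (\<phi> ` U) m X \<zeta>"
    using assms(2) by (auto simp: ham_forms_def)
  have X': "push_inv X \<in> locally_hamiltonian M \<Omega>1 m" by (rule inv.push_locally_hamiltonian[OF X])
  then have Xm: "mvf_on M (points M) m (push_inv X)" by (simp add: locally_hamiltonian_def)
  have "contr m (push (push_inv X)) \<Omega>2 q ws = contr m X \<Omega>2 q ws" if "q \<in> \<phi> ` U" for q ws
    by (rule contr_cong) (use that openin_subset[OF U] mem in \<open>auto intro!: push_push_inv\<close>)
  then have "hamiltonian_form N k \<Omega>2 (\<phi> ` U) m (push (push_inv X)) \<zeta>"
    using \<zeta> by (simp add: hamiltonian_form_def)
  from pull_hamiltonian_form[OF U Xm this]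
  have "hamiltonian_form M k \<Omega>1 U m (\<lambda>p as. c * push_inv X p as) (pull \<zeta>)" .
  moreover have "(\<lambda>p as. c * push_inv X p as) \<in> locally_hamiltonian M \<Omega>1 m"
    using locally_hamiltonian_lincomb[OF M \<Omega>1 X' X', of c 0] by simp
  ultimately show ?thesis by (auto simp: ham_forms_def)
qed

lemma pull_mod_closed:
  assumes U: "openin (mtop M) U" and "(\<zeta>, \<xi>) \<in> mod_closed N k \<Omega>2 (\<phi> ` U) m"
  shows "(pull \<zeta>, pull \<xi>) \<in> mod_closed M k \<Omega>1 U m"
  using assms pull_ham_forms[OF U] closed_form_pull[OF U, of _ "\<lambda>p ws. \<zeta> p ws - \<xi> p ws"]
  by (auto simp: mod_closed_def pullback_def)

lemma form_iso:
  assumes U: "openin (mtop M) U"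
  shows "induces_form_iso M N k \<Omega>1 \<Omega>2 \<phi> U m"
proof -
  interpret inv: conformal_pair N M \<psi> \<Omega>2 \<Omega>1 k "inverse c" by (rule inverse_conformal)
  have UM: "U \<subseteq> points M" by (rule openin_subset[OF U])
  have oU: "openin (mtop N) (\<phi> ` U)" by (rule open_image[OF U])
  have img: "\<psi> ` \<phi> ` U = U" using UM inv_left by (force simp: image_image)
  note e1 = equiv_mod_closed[OF M \<Omega>1 U, of m] and e2 = equiv_mod_closed[OF N \<Omega>2 oU, of m]
  note f = pull_mod_closed[OF U, of _ _ m]
  have g: "(pull_inv \<zeta>, pull_inv \<xi>) \<in> mod_closed N k \<Omega>2 (\<phi> ` U) m"
    if "(\<zeta>, \<xi>) \<in> mod_closed M k \<Omega>1 U m" for \<zeta> \<xi>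
    using inv.pull_mod_closed[OF oU, unfolded img, OF that] .
  have g_mem: "pull_inv \<zeta> \<in> ham_forms N k \<Omega>2 (\<phi> ` U) m" if "\<zeta> \<in> ham_forms M k \<Omega>1 U m" for \<zeta>
    using inv.pull_ham_forms[OF oU, unfolded img, OF that] .
  have fg: "(pull (pull_inv \<zeta>), \<zeta>) \<in> mod_closed M k \<Omega>1 U m" if "\<zeta> \<in> ham_forms M k \<Omega>1 U m" for \<zeta>
    by (rule mod_closed_eqI[OF M \<Omega>1 U pull_ham_forms[OF U g_mem[OF that]] that])
      (use UM in \<open>auto intro!: pullback_inverse_left[OF M N \<phi>]\<close>)
  have gf: "(pull_inv (pull \<zeta>), \<zeta>) \<in> mod_closed N k \<Omega>2 (\<phi> ` U) m" if "\<zeta> \<in> ham_forms N k \<Omega>2 (\<phi> ` U) m" for \<zeta>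
    by (rule mod_closed_eqI[OF N \<Omega>2 oU g_mem[OF pull_ham_forms[OF U that]] that])
      (use UM mem in \<open>auto intro!: pullback_inverse_right[OF M N \<phi>]\<close>)
  show ?thesis
    unfolding induces_form_iso_def Let_def
  proof (intro conjI ballI allI impI)
    show "pull ` ham_forms N k \<Omega>2 (\<phi> ` U) m \<subseteq> ham_forms M k \<Omega>1 U m" using pull_ham_forms[OF U] by blast
    show "closed_form_on M U (k - m - 1) (pull \<eta>)" if "closed_form_on N (\<phi> ` U) (k - m - 1) \<eta>" for \<eta>
      by (rule closed_form_pull[OF U that])
    show "bij_betw (induced (mod_closed M k \<Omega>1 U m) pull)
       (ham_forms N k \<Omega>2 (\<phi> ` U) m // mod_closed N k \<Omega>2 (\<phi> ` U) m) (ham_forms M k \<Omega>1 U m // mod_closed M k \<Omega>1 U m)"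
      by (rule induced_bij[where f=pull and g=pull_inv, OF e2 e1 f g gf fg])
    fix A assume A: "A \<in> ham_forms N k \<Omega>2 (\<phi> ` U) m // mod_closed N k \<Omega>2 (\<phi> ` U) m"
    show "induced (mod_closed M k \<Omega>1 U m) pull (\<Union>\<zeta>\<in>A. mod_closed N k \<Omega>2 (\<phi> ` U) m `` {field_scale s \<zeta>}) =
        (\<Union>\<zeta>\<in>induced (mod_closed M k \<Omega>1 U m) pull A. mod_closed M k \<Omega>1 U m `` {field_scale s \<zeta>})" for s
      by (rule induced_op1[OF e2 e1 f mod_closed_scale[OF N \<Omega>2 oU] mod_closed_scale[OF M \<Omega>1 U] _ A])
        (simp_all add: field_scale_def pullback_def)
    fix B assume B: "B \<in> ham_forms N k \<Omega>2 (\<phi> ` U) m // mod_closed N k \<Omega>2 (\<phi> ` U) m"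
    show "induced (mod_closed M k \<Omega>1 U m) pull (\<Union>\<zeta>\<in>A. \<Union>\<xi>\<in>B. mod_closed N k \<Omega>2 (\<phi> ` U) m `` {field_add \<zeta> \<xi>}) =
        (\<Union>\<zeta>\<in>induced (mod_closed M k \<Omega>1 U m) pull A. \<Union>\<xi>\<in>induced (mod_closed M k \<Omega>1 U m) pull B.
          mod_closed M k \<Omega>1 U m `` {field_add \<zeta> \<xi>})"
      by (rule induced_op2[OF e2 e1 f mod_closed_add[OF N \<Omega>2 oU] mod_closed_add[OF M \<Omega>1 U] _ A B])
        (simp_all add: field_add_def pullback_def)
  qed
qed

lemma VH_iso: "induces_VH_iso M N k \<Omega>1 \<Omega>2 \<phi>"
proof -
  interpret inv: conformal_pair N M \<psi> \<Omega>2 \<Omega>1 k "inverse c" by (rule inverse_conformal)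
  note e1 = equiv_mod_char[OF M \<Omega>1] and e2 = equiv_mod_char[OF N \<Omega>2]
  note lh = push_locally_hamiltonian inv.push_locally_hamiltonian
  have gf: "(push_inv (push X), X) \<in> mod_char M \<Omega>1 m" if "X \<in> locally_hamiltonian M \<Omega>1 m" for X m
    by (rule mod_char_eqI[OF M \<Omega>1 lh(2)[OF lh(1)[OF that]] that]) (rule pushforward_inverse_left[OF M N \<phi>])
  have fg: "(push (push_inv X), X) \<in> mod_char N \<Omega>2 m" if "X \<in> locally_hamiltonian N \<Omega>2 m" for X m
    by (rule mod_char_eqI[OF N \<Omega>2 lh(1)[OF lh(2)[OF that]] that]) (rule push_push_inv)
  have lm: "mvf_on M (points M) m X" if "X \<in> locally_hamiltonian M \<Omega>1 m" for X m
    using that by (simp add: locally_hamiltonian_def)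
  have ln: "mvf_on N (points N) m X" if "X \<in> locally_hamiltonian N \<Omega>2 m" for X m
    using that by (simp add: locally_hamiltonian_def)
  have "graded_lie_iso (VH M k \<Omega>1) (VH N k \<Omega>2) (\<lambda>m. induced (mod_char N \<Omega>2 m) push)"
    unfolding graded_lie_iso_def VH_def graded_lie.simps
  proof (intro conjI ballI allI impI)
    show "{0..k} = {0..k}" ..
    fix m
    show "bij_betw (induced (mod_char N \<Omega>2 m) push) (locally_hamiltonian M \<Omega>1 m // mod_char M \<Omega>1 m)
        (locally_hamiltonian N \<Omega>2 m // mod_char N \<Omega>2 m)"
      by (rule induced_bij[where f=push and g=push_inv, OF e1 e2 push_mod_char inv.push_mod_char gf fg])
    fix A assume A: "A \<in> locally_hamiltonian M \<Omega>1 m // mod_char M \<Omega>1 m"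
    show "induced (mod_char N \<Omega>2 m) push (\<Union>X\<in>A. mod_char M \<Omega>1 m `` {field_scale r X}) =
        (\<Union>X\<in>induced (mod_char N \<Omega>2 m) push A. mod_char N \<Omega>2 m `` {field_scale r X})" for r
      by (rule induced_op1[OF e1 e2 push_mod_char mod_char_scale[OF M \<Omega>1] mod_char_scale[OF N \<Omega>2] _ A])
        (simp_all add: field_scale_def pushforward_def Let_def)
    fix B assume B: "B \<in> locally_hamiltonian M \<Omega>1 m // mod_char M \<Omega>1 m"
    show "induced (mod_char N \<Omega>2 m) push (\<Union>X\<in>A. \<Union>Y\<in>B. mod_char M \<Omega>1 m `` {field_add X Y}) =
        (\<Union>X\<in>induced (mod_char N \<Omega>2 m) push A. \<Union>Y\<in>induced (mod_char N \<Omega>2 m) push B. mod_char N \<Omega>2 m `` {field_add X Y})"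
      by (rule induced_op2[OF e1 e2 push_mod_char mod_char_add[OF M \<Omega>1] mod_char_add[OF N \<Omega>2] _ A B])
        (simp_all add: field_add_def pushforward_def Let_def)
  next
    fix i j A B
    assume AB: "A \<in> locally_hamiltonian M \<Omega>1 i // mod_char M \<Omega>1 i" "B \<in> locally_hamiltonian M \<Omega>1 j // mod_char M \<Omega>1 j"
    show "induced (mod_char N \<Omega>2 (i + j - 1)) push
          (\<Union>X\<in>A. \<Union>Y\<in>B. mod_char M \<Omega>1 (i + j - 1) `` schouten M i j X Y) =
        (\<Union>X\<in>induced (mod_char N \<Omega>2 i) push A. \<Union>Y\<in>induced (mod_char N \<Omega>2 j) push B.
          mod_char N \<Omega>2 (i + j - 1) `` schouten N i j X Y)"
      by (rule induced_bracket[where D=UNIV and f=push and g=push_inv and ?b1.0="schouten M i j"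
            and ?b2.0="schouten N i j", OF e1 e2 push_mod_char inv.push_mod_char gf fg UNIV_I UNIV_I UNIV_I AB])
        (auto intro: schouten_push inv.schouten_push lm ln)
  qed
  then show ?thesis
    unfolding induces_VH_iso_def Let_def using lh(1) push_characteristic by blast
qed

lemma difference_closed:
  assumes U: "openin (mtop M) U" and X: "mvf_on M (points M) m X"
    and \<xi>1: "hamiltonian_form M k \<Omega>1 U m X \<xi>1" and \<xi>2: "hamiltonian_form N k \<Omega>2 (\<phi> ` U) m (push X) \<xi>2"
  shows "closed_form_on M U (k - m - 1) (\<lambda>p ws. c * \<xi>1 p ws - pull \<xi>2 p ws)"
proof -
  have f1: "form_on M U (k - m - 1) \<xi>1" and f2: "form_on N (\<phi> ` U) (k - m - 1) \<xi>2"
    using \<xi>1 \<xi>2 by (auto simp: hamiltonian_form_def)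
  note f2' = form_on_pull[OF U f2]
  have "ext_deriv M (\<lambda>p ws. c * \<xi>1 p ws + (-1) * pull \<xi>2 p ws) p ws = 0" if p: "p \<in> U" for p ws
  proof -
    have pM: "p \<in> points M" using p openin_subset[OF U] by blast
    have "ext_deriv M (pull \<xi>2) p ws = pull (contr m (push X) \<Omega>2) p ws"
      using ext_deriv_pull[OF U f2 p] \<xi>2 p by (simp add: hamiltonian_form_def pullback_def)
    then show ?thesis
      unfolding ext_deriv_lincomb[OF M U f1 f2' p]
      using pull_contr_push[OF X pM] \<xi>1 p by (simp add: hamiltonian_form_def)
  qed
  then show ?thesis using form_on_lincomb[OF M U f1 f2', of c "-1"] by (simp add: closed_form_on_def)
qed

lemma hamiltonian_locally_hamiltonian:
  assumes X: "mvf_on M (points M) m X" and \<xi>: "hamiltonian_form M k \<Omega>1 (points M) m X \<xi>"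
  shows "X \<in> locally_hamiltonian M \<Omega>1 m"
proof -
  have f: "form_on M (points M) (k - m - 1) \<xi>" and eq: "\<And>p ws. p \<in> points M \<Longrightarrow> contr m X \<Omega>1 p ws = ext_deriv M \<xi> p ws"
    using \<xi> by (auto simp: hamiltonian_form_def)
  have "ext_deriv M (contr m X \<Omega>1) p ws = 0" if p: "p \<in> points M" for p ws
    using ext_deriv_cong[OF M openin_topspace p eq] ext_deriv_twice[OF M openin_topspace f p] by simp
  then show ?thesis using X by (simp add: locally_hamiltonian_def)
qed

lemma push_hamiltonian:
  assumes X: "mvf_on M (points M) m X" and \<xi>: "hamiltonian_form M k \<Omega>1 (points M) m X \<xi>"
  shows "hamiltonian_form N k \<Omega>2 (points N) m (\<lambda>q as. inverse c * push X q as) (pull_inv \<xi>)"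
proof -
  interpret inv: conformal_pair N M \<psi> \<Omega>2 \<Omega>1 k "inverse c" by (rule inverse_conformal)
  have "contr m (push_inv (push X)) \<Omega>1 p ws = contr m X \<Omega>1 p ws" if "p \<in> points M" for p ws
    by (rule contr_cong) (simp_all add: pushforward_inverse_left[OF M N \<phi> that])
  then have "hamiltonian_form M k \<Omega>1 (\<psi> ` points N) m (push_inv (push X)) \<xi>"
    using \<xi> by (simp add: hamiltonian_form_def inv.points_image)
  from inv.pull_hamiltonian_form[OF openin_topspace mvf_on_push[OF X] this] show ?thesis .
qed

lemma hamiltonian_unique:
  assumes X: "mvf_on M (points M) m X" and \<xi>: "hamiltonian_form M k \<Omega>1 (points M) m X \<xi>"
    and Y: "mvf_on N (points N) m Y" and \<zeta>: "hamiltonian_form N k \<Omega>2 (points N) m Y (pull_inv \<xi>)"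
  shows "(\<lambda>q as. push X q as - c * Y q as) \<in> characteristic N \<Omega>2 m"
proof -
  have "contr m (\<lambda>q as. 1 * push X q as + (- c) * Y q as) \<Omega>2 q ws = 0" if q: "q \<in> points N" for q ws
  proof -
    have "contr m Y \<Omega>2 q ws = contr m (\<lambda>q as. inverse c * push X q as) \<Omega>2 q ws"
      using \<zeta> push_hamiltonian[OF X \<xi>] q by (simp add: hamiltonian_form_def)
    also have "\<dots> = inverse c * contr m (push X) \<Omega>2 q ws"
      using contr_lincomb_mvf[of m "inverse c" "push X" 0 "push X"] by simp
    finally show ?thesis unfolding contr_lincomb_mvf using c[OF inv_mem[OF q]] by simp
  qed
  then show ?thesis
    using mvf_on_lincomb[OF N openin_topspace mvf_on_push[OF X] Y, of 1 "- c"] by (simp add: characteristic_def)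
qed

end

section \<open>Bump functions and extension by zero\<close>

lemma power_le_fact_exp:
  fixes x :: real
  assumes "0 \<le> x" shows "x ^ n \<le> fact n * exp x"
proof -
  have "(\<Sum>k\<in>{n}. x ^ k /\<^sub>R fact k) \<le> (\<Sum>k. x ^ k /\<^sub>R fact k)"
    by (rule sum_le_suminf[OF summable_exp_generic]) (use assms in auto)
  then have "x ^ n /\<^sub>R fact n \<le> exp x" by (simp add: exp_def)
  then show ?thesis by (simp add: field_simps)
qed

text \<open>The functions \<open>t\<^sup>-\<^sup>j exp (- 1 / t)\<close>, continued by \<open>0\<close>. Their span is closed under differentiation, so they
  are smooth as soon as they are differentiable.\<close>

definition flat_exp :: "nat \<Rightarrow> real \<Rightarrow> real" where
  "flat_exp j t = (if 0 < t then (1 / t) ^ j * exp (- (1 / t)) else 0)"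

text \<open>A quadratic bound gives the derivative \<open>0\<close> at the origin.\<close>

lemma flat_exp_bound: "\<bar>flat_exp j t\<bar> \<le> fact (j + 2) * t^2"
proof (cases "0 < t")
  case True
  have "(1 / t) ^ (j + 2) \<le> fact (j + 2) * exp (1 / t)" by (rule power_le_fact_exp) (use True in simp)
  then have "(1 / t) ^ (j + 2) * exp (- (1 / t)) \<le> fact (j + 2) * exp (1 / t) * exp (- (1 / t))"
    by (rule mult_right_mono) simp
  then have "(1 / t) ^ j * (1 / t)^2 * exp (- (1 / t)) \<le> fact (j + 2)"
    by (simp only: power_add mult.assoc exp_minus_inverse mult_1_right)
  then have "t^2 * ((1 / t) ^ j * (1 / t)^2 * exp (- (1 / t))) \<le> t^2 * fact (j + 2)"
    by (rule mult_left_mono) simp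
  moreover have "t^2 * ((1 / t) ^ j * (1 / t)^2 * exp (- (1 / t))) = (1 / t) ^ j * exp (- (1 / t))"
    using True by (simp add: power2_eq_square)
  ultimately have "(1 / t) ^ j * exp (- (1 / t)) \<le> fact (j + 2) * t^2" by (simp only: mult.commute)
  then show ?thesis using True by (simp add: flat_exp_def del: fact_Suc add_2_eq_Suc')
qed (simp add: flat_exp_def)

lemma flat_exp_derivative:
  "(flat_exp j has_real_derivative (flat_exp (j + 2) t - real j * flat_exp (j + 1) t)) (at t)"
proof -
  consider "0 < t" | "t < 0" | "t = 0" by linarith
  then show ?thesis
  proof cases
    case 1
    have i: "((\<lambda>t. 1 / t) has_real_derivative - ((1 / t)^2)) (at t)"
      using 1 by (auto intro!: derivative_eq_intros simp: power2_eq_square divide_simps)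
    have e: "((\<lambda>t. exp (- (1 / t))) has_real_derivative exp (- (1 / t)) * (1 / t)^2) (at t)"
      using DERIV_chain2[OF DERIV_exp DERIV_minus[OF i]] by simp
    have "real j * (- (g^2) * g ^ (j - Suc 0)) = - real j * g ^ (j + 1)" for g :: real
      by (cases j) (simp_all add: power2_eq_square algebra_simps)
    from this[of "1 / t"] DERIV_mult[OF DERIV_power[OF i, of j] e]
    have "((\<lambda>t. (1 / t) ^ j * exp (- (1 / t))) has_real_derivative
        (- real j * (1 / t) ^ (j + 1) * exp (- (1 / t)) + exp (- (1 / t)) * (1 / t)^2 * (1 / t) ^ j)) (at t)"
      by simp
    also have "- real j * (1 / t) ^ (j + 1) * exp (- (1 / t)) + exp (- (1 / t)) * (1 / t)^2 * (1 / t) ^ j =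
        flat_exp (j + 2) t - real j * flat_exp (j + 1) t"
      using 1 by (simp add: flat_exp_def power_add power2_eq_square mult_ac)
    finally show ?thesis
      by (rule has_field_derivative_transform_within_open[OF _ open_greaterThan[of 0]])
        (use 1 in \<open>auto simp: flat_exp_def\<close>)
  next
    case 2
    have "((\<lambda>t. 0) has_real_derivative (flat_exp (j + 2) t - real j * flat_exp (j + 1) t)) (at t)"
      using 2 by (simp add: flat_exp_def)
    then show ?thesis
      by (rule has_field_derivative_transform_within_open[OF _ open_lessThan[of 0]])
        (use 2 in \<open>auto simp: flat_exp_def\<close>)
  next
    case 3
    have "((\<lambda>h. flat_exp j h / h) \<longlongrightarrow> 0) (at 0)"
    proof (rule Lim_null_comparison)
      have "norm (flat_exp j h / h) \<le> fact (j + 2) * \<bar>h\<bar>" for h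
      proof (cases "h = 0")
        case False
        have "\<bar>flat_exp j h\<bar> \<le> fact (j + 2) * \<bar>h\<bar> * \<bar>h\<bar>"
          using flat_exp_bound[of j h] by (simp add: power2_eq_square mult.assoc flip: abs_mult)
        then show ?thesis using False by (simp add: divide_le_eq)
      qed simp
      then show "\<forall>\<^sub>F h in at 0. norm (flat_exp j h / h) \<le> fact (j + 2) * \<bar>h\<bar>"
        by (intro always_eventually allI)
      show "((\<lambda>h. fact (j + 2) * \<bar>h\<bar>) \<longlongrightarrow> (0::real)) (at 0)"
        by (auto intro!: tendsto_eq_intros)
    qed
    then show ?thesis using 3 by (simp add: DERIV_def flat_exp_def)
  qed
qed

lemma smooth_on_flat_exp: "smooth_on UNIV (flat_exp j)"
proof -
  have "Ck_on r UNIV (flat_exp j)" for r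
  proof (induction r arbitrary: j)
    case 0
    have "continuous_on UNIV (flat_exp j)"
      by (intro continuous_at_imp_continuous_on ballI DERIV_isCont[OF flat_exp_derivative])
    then show ?case by simp
  next
    case (Suc r)
    have D: "(flat_exp j has_derivative (\<lambda>v. v * (flat_exp (j + 2) t - real j * flat_exp (j + 1) t))) (at t)" for t
      using flat_exp_derivative[of j t] by (simp add: has_field_derivative_def mult.commute[of _ "_ - _"])
    have "Ck_on r UNIV (\<lambda>t. v * (flat_exp (j + 2) t + (- real j) * flat_exp (j + 1) t))" for v
      by (intro bounded_bilinear.Ck_on[OF bounded_bilinear_mult] Ck_on_add Suc.IH Ck_on_const open_UNIV)
    then have "Ck_on r UNIV (\<lambda>t. frechet_derivative (flat_exp j) (at t) v)" for v
      by (simp add: frechet_derivative_eqI[OF D])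
    then show ?case using D by (auto simp: differentiable_def)
  qed
  then show ?thesis by (simp add: smooth_on_def)
qed

definition bump :: "'v::euclidean_space \<Rightarrow> real \<Rightarrow> 'v \<Rightarrow> real" where
  "bump y0 \<rho> y = flat_exp 0 (\<rho>^2 - (y - y0) \<bullet> (y - y0))"

lemma smooth_on_ident: "smooth_on S (\<lambda>x. x)"
  by (rule smooth_on_bounded_linear) (rule bounded_linear_ident)

lemma smooth_on_bump: "smooth_on UNIV (bump y0 \<rho>)"
proof -
  have 1: "smooth_on UNIV (\<lambda>y. y + (- y0))" by (intro smooth_on_add smooth_on_ident smooth_on_const open_UNIV)
  have "smooth_on UNIV (\<lambda>y. \<rho>^2 - (y + (- y0)) \<bullet> (y + (- y0)))"
    by (intro smooth_on_diff smooth_on_const smooth_on_inner 1 open_UNIV)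
  from smooth_on_comp[OF open_UNIV open_UNIV subset_UNIV this smooth_on_flat_exp[of 0]]
  show ?thesis by (simp add: bump_def[abs_def])
qed

lemma bump_center: "0 < \<rho> \<Longrightarrow> 0 < bump y0 \<rho> y0"
  by (simp add: bump_def flat_exp_def)

lemma bump_outside:
  assumes "0 < \<rho>" "y \<notin> cball y0 \<rho>" shows "bump y0 \<rho> y = 0"
proof -
  have "\<rho> < norm (y - y0)" using assms by (simp add: dist_norm norm_minus_commute)
  then have "\<rho>^2 < (y - y0) \<bullet> (y - y0)" using assms(1) by (simp add: power_strict_mono flip: power2_norm_eq_inner)
  then show ?thesis by (simp add: bump_def flat_exp_def)
qed

lemma mvf_on_local:
  assumes M: "charted M"
    and loc: "\<And>p. p \<in> U \<Longrightarrow> \<exists>W. openin (mtop M) W \<and> p \<in> W \<and> mvf_on M W m X"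
  shows "mvf_on M U m X"
  unfolding mvf_on_def
proof (intro conjI ballI allI)
  fix p assume "p \<in> U"
  then obtain W where "p \<in> W" "mvf_on M W m X" using loc by blast
  then show "alternating m (X p)" by (simp add: mvf_on_def)
next
  fix c as assume c: "c \<in> atlas M"
  show "smooth_on (snd c ` (U \<inter> fst c)) (\<lambda>y. local_mvf M c X y as)"
  proof (rule smooth_on_local)
    fix y assume "y \<in> snd c ` (U \<inter> fst c)"
    then obtain p where p: "p \<in> U" "p \<in> fst c" "y = snd c p" by auto
    obtain W where W: "openin (mtop M) W" "p \<in> W" "mvf_on M W m X" using loc[OF p(1)] by blast
    have "smooth_on (snd c ` (W \<inter> fst c)) (\<lambda>y. local_mvf M c X y as)" using W(3) c by (simp add: mvf_on_def)
    then show "\<exists>T. open T \<and> y \<in> T \<and> smooth_on T (\<lambda>y. local_mvf M c X y as)"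
      using open_chart_image_Int[OF M c W(1)] p W(2) by blast
  qed
qed

lemma diffeo_on_chart_inv:
  assumes M: "charted M" and c: "c \<in> atlas M"
  shows "diffeo_on euclid (snd c ` fst c) M (fst c) (chart_inv c)"
  unfolding diffeo_on_def
proof (intro conjI)
  show "openin (mtop euclid) (snd c ` fst c)" by (simp add: open_chart_image[OF M c])
  show "openin (mtop M) (fst c)" by (rule openin_chart[OF M c])
  show bij: "bij_betw (chart_inv c) (snd c ` fst c) (fst c)"
    by (rule bij_betw_inv_into) (simp add: bij_betw_def chart_inj[OF M c])
  show "smooth_map_on euclid (snd c ` fst c) M (chart_inv c)" by (rule smooth_map_on_chart_inv[OF M c])
  have "snd c p = inv_into (snd c ` fst c) (chart_inv c) p" if p: "p \<in> fst c" for p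
    using inv_into_f_eq[OF bij_betw_imp_inj_on[OF bij], of "snd c p" p] p chart_inv_left[OF M c p] by auto
  then show "smooth_map_on M (fst c) euclid (inv_into (snd c ` fst c) (chart_inv c))"
    by (rule smooth_map_on_cong[OF M charted_euclid openin_chart[OF M c] smooth_map_on_chart[OF M c]])
qed

text \<open>A compactly supported multivector field on the image of a chart extends by zero to the whole
  manifold: the support is closed because the manifold is Hausdorff.\<close>

lemma extend_by_zero:
  fixes M :: "('a, 'v::euclidean_space) manifold"
  assumes M: "charted M" and H: "Hausdorff_space (mtop M)" and c: "c \<in> atlas M"
    and alt: "\<And>y. y \<in> snd c ` fst c \<Longrightarrow> alternating m (Y y)"
    and sm: "\<And>as. smooth_on (snd c ` fst c) (\<lambda>y. Y y as)"
    and K: "compact K" "K \<subseteq> snd c ` fst c"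
    and zero: "\<And>y as. y \<in> snd c ` fst c \<Longrightarrow> y \<notin> K \<Longrightarrow> Y y as = 0"
  obtains X W where "mvf_on M (points M) m X" "\<And>p as. p \<in> fst c \<Longrightarrow> local_mvf M c X (snd c p) as = Y (snd c p) as"
    "openin (mtop M) W" "points M = fst c \<union> W" "\<And>p as. p \<in> W \<Longrightarrow> X p as = 0"
proof -
  let ?V = "snd c ` fst c"
  let ?P = "pushforward euclid ?V M (chart_inv c) Y"
  note D = diffeo_on_chart_inv[OF M c] and E = charted_euclid[where 'v='v]
  define X where "X p = (if p \<in> fst c then ?P p else (\<lambda>as. 0))" for p
  define W where "W = points M - chart_inv c ` K"
  have sub: "chart_inv c ` K \<subseteq> points M" using K(2) chart_subset[OF M c] chart_inv_mem[OF M c] by blast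
  have "compactin (mtop M) (chart_inv c ` K)"
    by (rule image_compactin[OF _ continuous_chart_inv[OF M c]]) (use K in \<open>simp add: compactin_subtopology\<close>)
  then have W: "openin (mtop M) W"
    unfolding W_def by (intro openin_diff openin_topspace compactin_imp_closedin[OF H])
  have at: "?P p as = Y (snd c p) (map (adjoint (mderiv euclid M (chart_inv c) (snd c p))) as)" if p: "p \<in> fst c" for p as
    using pushforward_at[OF E M D, of "snd c p" Y as] p by (simp add: chart_inv_left[OF M c])
  have zW: "X p as = 0" if "p \<in> W" for p as
  proof (cases "p \<in> fst c")
    case True
    then have "snd c p \<notin> K" using that chart_inv_left[OF M c True] by (force simp: W_def)
    then show ?thesis using True by (simp add: X_def at zero)
  qed (simp add: X_def)
  have cover: "points M = fst c \<union> W"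
    using K(2) chart_inv_mem[OF M c] chart_subset[OF M c] by (auto simp: W_def)
  have "mvf_on euclid ?V m Y"
    using alt sm by (simp add: mvf_on_def local_mvf_eq mderiv_euclid adjoint_id)
  then have "mvf_on M (fst c) m ?P" by (rule mvf_on_pushforward[OF E M D])
  then have Xc: "mvf_on M (fst c) m X" by (rule mvf_on_cong[OF M openin_chart[OF M c]]) (simp add: X_def)
  have XW: "mvf_on M W m X" by (rule mvf_on_cong[OF M W mvf_on_zero]) (simp add: zW)
  have X: "mvf_on M (points M) m X"
  proof (rule mvf_on_local[OF M])
    fix p assume "p \<in> points M"
    then consider "p \<in> fst c" | "p \<in> W" using cover by blast
    then show "\<exists>W. openin (mtop M) W \<and> p \<in> W \<and> mvf_on M W m X"
      by cases (use Xc XW W openin_chart[OF M c] in blast)+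
  qed
  have loc: "local_mvf M c X (snd c p) as = Y (snd c p) as" if p: "p \<in> fst c" for p as
  proof -
    let ?L = "mderiv M euclid (snd c) p" and ?L' = "mderiv euclid M (chart_inv c) (snd c p)"
    have y: "snd c p \<in> ?V" using p by simp
    have "?L \<circ> ?L' = id" using mderiv_chart_inverse'[OF M c y] by (simp add: chart_inv_left[OF M c p])
    then have "adjoint ?L' \<circ> adjoint ?L = id"
      using adjoint_comp[OF mderiv_linear[OF E M smooth_near_chart_inv[OF M c y]]
          mderiv_linear[OF M E smooth_near_chart[OF M c p]]] adjoint_id by metis
    then show ?thesis by (simp add: local_mvf_eq chart_inv_left[OF M c p] X_def p at)
  qed
  show ?thesis by (rule that[OF X loc W cover zW])
qed

lemma smooth_on_bilinear:
  fixes G :: "'v::euclidean_space \<Rightarrow> 'v \<Rightarrow> 'v \<Rightarrow> real"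
  assumes V: "open V" and sm: "\<And>u v. smooth_on V (\<lambda>y. G y u v)"
    and lin: "\<And>y v. y \<in> V \<Longrightarrow> linear (\<lambda>u. G y u v)" and u: "smooth_on V u"
  shows "smooth_on V (\<lambda>y. G y (u y) v)"
proof (rule smooth_on_cong[OF V])
  show "smooth_on V (\<lambda>y. \<Sum>b\<in>Basis. (u y \<bullet> b) * G y b v)"
    by (intro smooth_on_sum smooth_on_mult smooth_on_inner smooth_on_const V u sm)
  show "(\<Sum>b\<in>Basis. (u y \<bullet> b) * G y b v) = G y (u y) v" if "y \<in> V" for y
    using linear_expand_Basis[OF lin[OF that], of "u y"] by simp
qed

text \<open>A smooth field of positive definite bilinear forms identifies smooth covector fields with
  smooth vector fields. The solution is built up over a basis, the next basis vector being
  orthogonalised against the span of the previous ones.\<close>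

lemma smooth_solve_span:
  fixes G :: "'v::euclidean_space \<Rightarrow> 'v \<Rightarrow> 'v \<Rightarrow> real"
  assumes V: "open V" and sm: "\<And>u v. smooth_on V (\<lambda>y. G y u v)"
    and lin: "\<And>y v. y \<in> V \<Longrightarrow> linear (\<lambda>u. G y u v)" and sym: "\<And>y u v. y \<in> V \<Longrightarrow> G y u v = G y v u"
    and pos: "\<And>y u. y \<in> V \<Longrightarrow> u \<noteq> 0 \<Longrightarrow> 0 < G y u u"
    and "finite B" "independent B" and "\<And>v. smooth_on V (\<lambda>y. \<theta> y v)"
  shows "\<exists>u. smooth_on V u \<and> (\<forall>y\<in>V. u y \<in> span B \<and> (\<forall>b\<in>B. G y (u y) b = \<theta> y b))"
  using assms(6-)
proof (induction B arbitrary: \<theta> rule: finite_induct)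
  case empty
  show ?case by (rule exI[of _ "\<lambda>y. 0"]) simp
next
  case (insert b B)
  have indep: "independent B" "b \<notin> span B" using insert.prems(1) insert.hyps(2) by (auto simp: independent_insert)
  obtain u0 where u0: "smooth_on V u0" "\<And>y. y \<in> V \<Longrightarrow> u0 y \<in> span B"
    "\<And>y b. y \<in> V \<Longrightarrow> b \<in> B \<Longrightarrow> G y (u0 y) b = \<theta> y b"
    using insert.IH[of \<theta>, OF indep(1) insert.prems(2)] by blast
  obtain u1 where u1: "smooth_on V u1" "\<And>y. y \<in> V \<Longrightarrow> u1 y \<in> span B"
    "\<And>y b'. y \<in> V \<Longrightarrow> b' \<in> B \<Longrightarrow> G y (u1 y) b' = G y b b'"
    using insert.IH[of "\<lambda>y. G y b", OF indep(1) sm] by blast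
  \<comment> \<open>\<open>d\<close> is \<open>b\<close> made orthogonal to the span of \<open>B\<close>; it does not vanish as \<open>b\<close> is independent of \<open>B\<close>\<close>
  define d where "d y = (-1) *\<^sub>R u1 y + b" for y
  have d: "smooth_on V d" unfolding d_def by (intro smooth_on_add smooth_on_scaleR smooth_on_const V u1(1))
  have lin2: "linear (G y w)" if y: "y \<in> V" for y w
  proof -
    have "(\<lambda>u. G y u w) = G y w" by (rule ext) (rule sym[OF y])
    with lin[OF y, of w] show ?thesis by simp
  qed
  have orth: "G y (d y) v = 0" if y: "y \<in> V" and v: "v \<in> span B" for y v
  proof -
    have "G y (d y) b' = 0" if "b' \<in> B" for b'
      using u1(3)[OF y that] by (simp add: d_def linear_add[OF lin[OF y]] linear_neg[OF lin[OF y]] linear_diff[OF lin[OF y]])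
    then show ?thesis by (rule linear_eq_0_on_span[OF lin2[OF y] _ v])
  qed
  have pos': "0 < G y (d y) b" if y: "y \<in> V" for y
  proof -
    have "d y \<noteq> 0" using u1(2)[OF y] indep(2) by (auto simp: d_def)
    then have "0 < G y (d y) (d y)" by (rule pos[OF y])
    also have "G y (d y) (d y) = G y (d y) ((-1) *\<^sub>R u1 y + b)" by (simp add: d_def)
    also have "\<dots> = - G y (d y) (u1 y) + G y (d y) b"
      unfolding linear_add[OF lin2[OF y]] linear_scale[OF lin2[OF y]] by simp
    finally show ?thesis using orth[OF y u1(2)[OF y]] by simp
  qed
  define s where "s y = (\<theta> y b - G y (u0 y) b) * inverse (G y (d y) b)" for y
  define u where "u y = u0 y + s y *\<^sub>R d y" for y
  note bil = smooth_on_bilinear[where G=G, OF V sm lin]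
  have "smooth_on V (\<lambda>y. inverse (G y (d y) b))"
    by (rule smooth_on_inverse[OF V _ bil[OF _ d]]) (use pos' in force)+
  then have s: "smooth_on V s" unfolding s_def
    by (intro smooth_on_mult smooth_on_diff V insert.prems(2) bil[OF _ u0(1)])
  have "smooth_on V u" unfolding u_def by (intro smooth_on_add smooth_on_scaleR V u0(1) s d)
  moreover have "u y \<in> span (insert b B)" if y: "y \<in> V" for y
    using u0(2)[OF y] u1(2)[OF y] span_mono[of B "insert b B"] span_base[of b "insert b B"]
    unfolding u_def d_def by (intro span_add span_scale) auto
  moreover have "G y (u y) b' = \<theta> y b'" if y: "y \<in> V" and b': "b' \<in> insert b B" for y b'
  proof -
    have "G y (u y) b' = G y (u0 y) b' + s y * G y (d y) b'"
      by (simp add: u_def linear_add[OF lin[OF y]] linear_scale[OF lin[OF y]])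
    also have "\<dots> = \<theta> y b'"
    proof (cases "b' = b")
      case True
      then show ?thesis using pos'[OF y] by (simp add: s_def field_simps)
    next
      case False
      then have "b' \<in> B" using b' by simp
      then show ?thesis using orth[OF y span_base] u0(3)[OF y] by simp
    qed
    finally show ?thesis .
  qed
  ultimately show ?case by blast
qed

lemma smooth_solve:
  fixes G :: "'v::euclidean_space \<Rightarrow> 'v \<Rightarrow> 'v \<Rightarrow> real"
  assumes V: "open V" and sm: "\<And>u v. smooth_on V (\<lambda>y. G y u v)"
    and lin: "\<And>y v. y \<in> V \<Longrightarrow> linear (\<lambda>u. G y u v)" and sym: "\<And>y u v. y \<in> V \<Longrightarrow> G y u v = G y v u"
    and pos: "\<And>y u. y \<in> V \<Longrightarrow> u \<noteq> 0 \<Longrightarrow> 0 < G y u u"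
    and \<theta>: "\<And>v. smooth_on V (\<lambda>y. \<theta> y v)" "\<And>y. y \<in> V \<Longrightarrow> linear (\<theta> y)"
  obtains u where "smooth_on V u" "\<And>y v. y \<in> V \<Longrightarrow> G y (u y) v = \<theta> y v"
proof -
  obtain u where u: "smooth_on V u" "\<And>y b. y \<in> V \<Longrightarrow> b \<in> Basis \<Longrightarrow> G y (u y) b = \<theta> y b"
    using smooth_solve_span[where G=G and \<theta>=\<theta>, OF V sm lin sym pos finite_Basis independent_Basis \<theta>(1)] by blast
  have "G y (u y) v = \<theta> y v" if y: "y \<in> V" for y v
  proof -
    have "(\<lambda>v. G y v (u y)) = G y (u y)" by (rule ext) (rule sym[OF y])
    with lin[OF y, of "u y"] have "linear (G y (u y))" by simp
    then have "G y (u y) v = (\<Sum>b\<in>Basis. (v \<bullet> b) *\<^sub>R G y (u y) b)" by (rule linear_expand_Basis)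
    also have "\<dots> = (\<Sum>b\<in>Basis. (v \<bullet> b) *\<^sub>R \<theta> y b)" by (simp add: u(2)[OF y])
    also have "\<dots> = \<theta> y v" by (rule linear_expand_Basis[OF \<theta>(2)[OF y], symmetric])
    finally show ?thesis .
  qed
  with u(1) show ?thesis by (rule that)
qed

section \<open>Forms with the same locally Hamiltonian fields\<close>

lemma sum_basis_lists_rev: "(\<Sum>bs\<in>basis_lists m. f (rev bs)) = (\<Sum>bs\<in>basis_lists m. f bs)"
  by (rule sum.reindex_bij_witness[of _ rev rev]) (auto simp: basis_lists_def)

lemma alternating_rev:
  assumes t: "alternating m t" shows "alternating m (\<lambda>as. t (rev as))"
  unfolding alternating_def
proof (intro conjI allI impI)
  fix vs :: "'a list"
  show "t (rev vs) = 0" if "length vs \<noteq> m" using alternating_wrong_length[OF t] that by simp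
  show "linear (\<lambda>u. t (rev (vs[i := u])))" if "length vs = m" "i < m" for i
    using alternating_slot[OF t, of "rev vs" "m - i - 1"] that by (simp add: rev_update)
  show "t (rev vs) = 0" if "\<not> distinct vs" using alternating_not_distinct[OF t] that by simp
qed

lemma alternating_snoc:
  assumes t: "alternating (Suc m) t" shows "alternating m (\<lambda>vs. t (vs @ [u]))"
  unfolding alternating_def
proof (intro conjI allI impI)
  fix vs :: "'a list"
  show "t (vs @ [u]) = 0" if "length vs \<noteq> m" using alternating_wrong_length[OF t] that by simp
  show "linear (\<lambda>x. t (vs[i := x] @ [u]))" if "length vs = m" "i < m" for i
    using alternating_slot[OF t, of "vs @ [u]" i] that by (simp add: list_update_append)
  show "t (vs @ [u]) = 0" if "\<not> distinct vs" using alternating_not_distinct[OF t] that by simp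
qed

lemma linear_snoc:
  assumes t: "alternating (Suc m) t" shows "linear (\<lambda>u. t (vs @ [u]))"
proof (cases "length vs = m")
  case True
  then show ?thesis using alternating_slot[OF t, of "vs @ [0]" m] by (simp add: list_update_append)
next
  case False
  then show ?thesis using alternating_wrong_length[OF t] by (simp add: linear_zero)
qed

lemma alternating_cycle:
  assumes "alternating (Suc m) t" "length vs = m" shows "t (v # vs) = (-1) ^ m * t (vs @ [v])"
  using alternating_move[OF assms(1), of "[]" vs "[]" v] assms(2) by simp

definition form_inner :: "nat \<Rightarrow> ('v::euclidean_space list \<Rightarrow> real) \<Rightarrow> ('v list \<Rightarrow> real) \<Rightarrow> real" where
  "form_inner m a b = (\<Sum>bs\<in>basis_lists m. a bs * b bs)"

lemma form_inner_commute: "form_inner m a b = form_inner m b a"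
  by (simp add: form_inner_def mult.commute)

lemma form_inner_pos:
  assumes "alternating m a" "a vs \<noteq> 0" shows "0 < form_inner m a a"
proof -
  have "length vs = m" using assms alternating_wrong_length by blast
  then have "a vs = 0" if "\<forall>bs\<in>basis_lists m. a bs = 0"
    using multilinear_expand[OF alternating_multilinear[OF assms(1)], of vs] that by simp
  then have "\<not> (\<forall>bs\<in>basis_lists m. a bs = 0)" using assms(2) by blast
  then obtain bs where "bs \<in> basis_lists m" "a bs \<noteq> 0" by blast
  then show ?thesis unfolding form_inner_def
    by (intro sum_pos2[of _ bs]) (auto simp: zero_less_mult_iff linorder_neq_iff)
qed

text \<open>Equality in the Cauchy--Schwarz inequality: the squared length of \<open>\<langle>a, a\<rangle> b - \<langle>a, b\<rangle> a\<close> is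
  \<open>\<langle>a, a\<rangle> (\<langle>a, a\<rangle> \<langle>b, b\<rangle> - \<langle>a, b\<rangle>\<^sup>2)\<close>.\<close>

lemma form_inner_equality:
  assumes a: "alternating m a" and b: "alternating m b"
    and eq: "form_inner m a a * form_inner m b b = form_inner m a b * form_inner m a b"
  shows "form_inner m a a * b vs = form_inner m a b * a vs"
proof (cases "length vs = m")
  case True
  let ?A = "form_inner m a a" and ?B = "form_inner m a b"
  let ?d = "\<lambda>bs. ?A * b bs - ?B * a bs"
  have "(\<Sum>bs\<in>basis_lists m. ?d bs * ?d bs) = ?A * (?A * form_inner m b b - ?B * ?B)"
  proof -
    have "(\<Sum>bs\<in>basis_lists m. (\<alpha> * b bs - \<beta> * a bs) * (\<alpha> * b bs - \<beta> * a bs)) =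
        \<alpha> * \<alpha> * form_inner m b b - 2 * \<alpha> * \<beta> * form_inner m a b + \<beta> * \<beta> * form_inner m a a" for \<alpha> \<beta>
      by (simp add: form_inner_def sum_distrib_left sum.distrib[symmetric] sum_subtractf[symmetric] algebra_simps)
    from this[of ?A ?B] show ?thesis by (simp add: algebra_simps)
  qed
  also have "\<dots> = 0" using eq by simp
  finally have "?d bs * ?d bs = 0" if "bs \<in> basis_lists m" for bs
    using that sum_nonneg_eq_0_iff[of "basis_lists m" "\<lambda>bs. ?d bs * ?d bs"] by simp
  then have d: "?A * b bs = ?B * a bs" if "bs \<in> basis_lists m" for bs using that by simp
  have "?A * b vs = (\<Sum>bs\<in>basis_lists m. list_inner vs bs * (?A * b bs))"
    by (subst multilinear_expand[OF alternating_multilinear[OF b] True]) (simp add: sum_distrib_left mult.left_commute)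
  also have "\<dots> = (\<Sum>bs\<in>basis_lists m. list_inner vs bs * (?B * a bs))" by (simp add: d)
  also have "\<dots> = ?B * a vs"
    by (subst multilinear_expand[OF alternating_multilinear[OF a] True]) (simp add: sum_distrib_left mult.left_commute)
  finally show ?thesis .
next
  case False
  then show ?thesis using alternating_wrong_length a b by (metis mult_zero_right)
qed

lemma ext_deriv_flat_two:
  "ext_deriv_flat \<omega> y [v0, v1] =
    frechet_derivative (\<lambda>z. \<omega> z [v1]) (at y) v0 - frechet_derivative (\<lambda>z. \<omega> z [v0]) (at y) v1"
  by (simp add: ext_deriv_flat_def numeral_2_eq_2)

lemma local_form_at:
  assumes M: "charted M" and c: "c \<in> atlas M" and q: "q \<in> fst c"
  shows "local_form M c \<eta> (snd c q) (map (mderiv M euclid (snd c) q) ws) = \<eta> q ws"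
  using mderiv_chart_inverse[OF M c q] by (simp add: local_form_eq chart_inv_left[OF M c q])

text \<open>Here \<open>\<Omega>'\<close> stands for the pull-back of \<open>\<Omega>2\<close>. Every locally Hamiltonian or characteristic field of
  \<open>\<Omega>\<close> is assumed to be one of \<open>\<Omega>'\<close>. The degree is written as \<open>k + 2\<close>, so that the degrees
  of the fields used below are successors.\<close>

locale shared_hamiltonian =
  fixes M :: "('a, 'v::euclidean_space) manifold" and \<Omega> \<Omega>' :: "('a, 'v) tfield" and k :: nat
  assumes M: "charted M" and Hausdorff: "Hausdorff_space (mtop M)"
    and \<Omega>: "form_on M (points M) (Suc (Suc k)) \<Omega>" and \<Omega>': "form_on M (points M) (Suc (Suc k)) \<Omega>'"
    and nondegenerate: "\<And>p. p \<in> points M \<Longrightarrow> inj (\<lambda>v ws. \<Omega> p (v # ws))"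
    and lh: "\<And>m X p ws. m \<le> Suc (Suc k) \<Longrightarrow> X \<in> locally_hamiltonian M \<Omega> m \<Longrightarrow> p \<in> points M \<Longrightarrow>
      ext_deriv M (contr m X \<Omega>') p ws = 0"
    and ch: "\<And>m X p ws. m \<le> Suc (Suc k) \<Longrightarrow> X \<in> characteristic M \<Omega> m \<Longrightarrow> p \<in> points M \<Longrightarrow> contr m X \<Omega>' p ws = 0"
begin

abbreviation K where "K \<equiv> Suc (Suc k)"

lemma nonzero_at:
  assumes p: "p \<in> points M" and v: "v \<noteq> 0" obtains ws where "\<Omega> p (v # ws) \<noteq> 0"
proof -
  have "\<Omega> p (0 # ws) = 0" for ws
  proof (cases "length (0 # ws) = K")
    case True
    then show ?thesis using linear_0[OF alternating_slot[OF form_on_alternating[OF \<Omega> p], of "0 # ws" 0]] by simp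
  next
    case False
    then show ?thesis by (rule alternating_wrong_length[OF form_on_alternating[OF \<Omega> p]])
  qed
  moreover have "(\<lambda>ws. \<Omega> p (v # ws)) \<noteq> (\<lambda>ws. \<Omega> p (0 # ws))"
    using nondegenerate[OF p] v unfolding inj_def by blast
  ultimately show ?thesis using that by fastforce
qed

end

locale shared_hamiltonian_chart = shared_hamiltonian M \<Omega> \<Omega>' k
  for M :: "('a, 'v::euclidean_space) manifold" and \<Omega> \<Omega>' k +
  fixes c :: "('a, 'v) chart"
  assumes c: "c \<in> atlas M"
begin

abbreviation V where "V \<equiv> snd c ` fst c"
abbreviation w where "w \<equiv> local_form M c \<Omega>"
abbreviation w' where "w' \<equiv> local_form M c \<Omega>'"
abbreviation A where "A y \<equiv> form_inner K (w y) (w y)"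
abbreviation B where "B y \<equiv> form_inner K (w y) (w' y)"

lemma V: "open V"
  by (rule open_chart_image[OF M c])

lemma V_eq: "snd c ` (points M \<inter> fst c) = V"
  using chart_subset[OF M c] by blast

lemma flat: "flat_form V K w" "flat_form V K w'"
  using local_form_flat[OF M c openin_topspace \<Omega>] local_form_flat[OF M c openin_topspace \<Omega>'] by (simp_all add: V_eq)

lemma alt: "y \<in> V \<Longrightarrow> alternating K (w y)" "y \<in> V \<Longrightarrow> alternating K (w' y)"
  using flat by (auto simp: flat_form_def)

lemma sm: "smooth_on V (\<lambda>y. w y vs)" "smooth_on V (\<lambda>y. w' y vs)"
  using flat by (auto simp: flat_form_def)

lemma smA: "smooth_on V A" and smB: "smooth_on V B"
  unfolding form_inner_def by (intro smooth_on_sum smooth_on_mult V sm)+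

lemma nonzero_local:
  assumes y: "y \<in> V" and u: "u \<noteq> 0" obtains ws where "w y (u # ws) \<noteq> 0"
proof -
  let ?q = "chart_inv c y"
  let ?L = "mderiv M euclid (snd c) ?q" and ?L' = "mderiv euclid M (chart_inv c) y"
  have q: "?q \<in> points M" using chart_inv_mem[OF M c y] chart_subset[OF M c] by blast
  have 1: "?L (?L' u) = u" using fun_cong[OF mderiv_chart_inverse'[OF M c y], of u] by simp
  have "linear ?L" by (rule mderiv_linear[OF M charted_euclid smooth_near_chart[OF M c chart_inv_mem[OF M c y]]])
  then have "?L' u \<noteq> 0" using 1 u linear_0 by metis
  then obtain ws where ws: "\<Omega> ?q (?L' u # ws) \<noteq> 0" using nonzero_at[OF q] by blast
  have "w (snd c ?q) (map ?L (?L' u # ws)) = \<Omega> ?q (?L' u # ws)" by (rule local_form_at[OF M c chart_inv_mem[OF M c y]])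
  then have "w y (u # map ?L ws) \<noteq> 0" using ws 1 chart_inv_right[OF M c y] by simp
  then show ?thesis by (rule that)
qed

lemma A_pos: assumes y: "y \<in> V" shows "0 < A y"
proof -
  obtain b :: 'v where "b \<in> Basis" using nonempty_Basis by blast
  then have "b \<noteq> 0" by auto
  then obtain ws where "w y (b # ws) \<noteq> 0" using nonzero_local[OF y] by blast
  then show ?thesis by (rule form_inner_pos[OF alt(1)[OF y]])
qed

lemma contr_local:
  assumes X: "mvf_on M (points M) m X" and Y: "\<And>p as. p \<in> fst c \<Longrightarrow> local_mvf M c X (snd c p) as = Y (snd c p) as"
    and \<eta>: "form_on M (points M) r \<eta>" and y: "y \<in> V"
  shows "local_form M c (contr m X \<eta>) y ws = contr m Y (local_form M c \<eta>) y ws"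
proof -
  obtain q where q: "q \<in> fst c" "y = snd c q" using y by auto
  have qM: "q \<in> points M" using q chart_subset[OF M c] by blast
  have "local_form M c (contr m X \<eta>) y ws = contr m (local_mvf M c X) (local_form M c \<eta>) y ws"
    unfolding q(2) by (rule local_form_contr[of M c q m X r \<eta>, OF M c q(1) mvf_on_alternating[OF X qM] form_on_alternating[OF \<eta> qM]])
  also have "\<dots> = contr m Y (local_form M c \<eta>) y ws" by (rule contr_cong) (simp_all add: Y q)
  finally show ?thesis .
qed

lemma cball_in_V:
  assumes "y \<in> V" obtains \<rho> where "0 < \<rho>" "cball y \<rho> \<subseteq> V"
  using V assms open_contains_cball by blast

text \<open>The \<open>K\<close>-vector dual to \<open>A w' - B w\<close> with respect to the Euclidean inner product of the chart
  is annihilated by \<open>w\<close>; cut off by a bump function, it is a characteristic field. That it is also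
  annihilated by \<open>w'\<close> is the equality case of the Cauchy--Schwarz inequality.\<close>

lemma proportional:
  assumes y0: "y0 \<in> V" shows "A y0 * w' y0 vs = B y0 * w y0 vs"
proof -
  obtain \<rho> where \<rho>: "0 < \<rho>" "cball y0 \<rho> \<subseteq> V" using cball_in_V[OF y0] .
  define Y where "Y y as = bump y0 \<rho> y * (A y * w' y (rev as) - B y * w y (rev as))" for y as
  have bump: "smooth_on V (bump y0 \<rho>)" by (rule smooth_on_subset[OF smooth_on_bump]) simp
  have Yalt: "alternating K (Y y)" if "y \<in> V" for y
    unfolding Y_def by (intro alternating_cmult alternating_diff alternating_rev alt that)
  have Ysm: "smooth_on V (\<lambda>y. Y y as)" for as
    unfolding Y_def by (intro smooth_on_mult smooth_on_diff V bump smA smB sm)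
  have Yz: "Y y as = 0" if "y \<notin> cball y0 \<rho>" for y as
    using bump_outside[OF \<rho>(1) that] by (simp add: Y_def)
  obtain X W where X: "mvf_on M (points M) K X" "\<And>p as. p \<in> fst c \<Longrightarrow> local_mvf M c X (snd c p) as = Y (snd c p) as"
    and W: "openin (mtop M) W" "points M = fst c \<union> W" "\<And>p as. p \<in> W \<Longrightarrow> X p as = 0"
    using extend_by_zero[where Y=Y, OF M Hausdorff c Yalt Ysm compact_cball \<rho>(2) Yz] by blast
  have pair: "contr K Y (local_form M c \<eta>) y [] =
      bump y0 \<rho> y * (A y * form_inner K (w' y) (local_form M c \<eta> y) - B y * form_inner K (w y) (local_form M c \<eta> y)) / fact K" for \<eta> y
  proof -
    have "(\<Sum>bs\<in>basis_lists K. Y y bs * local_form M c \<eta> y (rev bs)) =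
        bump y0 \<rho> y * (A y * (\<Sum>bs\<in>basis_lists K. w' y (rev bs) * local_form M c \<eta> y (rev bs)) -
          B y * (\<Sum>bs\<in>basis_lists K. w y (rev bs) * local_form M c \<eta> y (rev bs)))"
      by (simp add: Y_def sum_distrib_left sum_subtractf[symmetric] algebra_simps)
    then show ?thesis
      using sum_basis_lists_rev[of "\<lambda>bs. w' y bs * local_form M c \<eta> y bs" K]
        sum_basis_lists_rev[of "\<lambda>bs. w y bs * local_form M c \<eta> y bs" K]
      by (simp add: contr_eq form_inner_def)
  qed
  have at: "contr K X \<eta> q [] = contr K Y (local_form M c \<eta>) (snd c q) []"
    if \<eta>: "form_on M (points M) K \<eta>" and q: "q \<in> fst c" for \<eta> q
    using contr_local[OF X \<eta>, of "snd c q" "[]"] q by (simp add: local_form_eq chart_inv_left[OF M c])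
  have "X \<in> characteristic M \<Omega> K"
    unfolding characteristic_def
  proof (intro CollectI conjI ballI allI)
    fix q ws assume q: "q \<in> points M"
    show "contr K X \<Omega> q ws = 0"
    proof (cases "ws = []")
      case True
      show ?thesis
      proof (cases "q \<in> fst c")
        case True
        then show ?thesis using \<open>ws = []\<close> at[OF \<Omega> True] pair[of \<Omega> "snd c q"]
          by (simp add: form_inner_commute[of K "w' _"] mult.commute)
      next
        case False
        then show ?thesis using W(2,3) q by (simp add: contr_eq)
      qed
    next
      case False
      then show ?thesis
        using alternating_wrong_length[OF alternating_contr[of K X q K \<Omega>, OF mvf_on_alternating[OF X(1) q] form_on_alternating[OF \<Omega> q]]]
        by simp
    qed
  qed (rule X(1))
  moreover obtain p where p: "p \<in> fst c" "y0 = snd c p" using y0 by auto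
  moreover have "p \<in> points M" using p chart_subset[OF M c] by blast
  ultimately have "contr K X \<Omega>' p [] = 0" using ch by blast
  then have "bump y0 \<rho> y0 * (A y0 * form_inner K (w' y0) (w' y0) - B y0 * B y0) = 0"
    using at[OF \<Omega>' p(1)] pair[of \<Omega>' y0] p by simp
  then have "A y0 * form_inner K (w' y0) (w' y0) = B y0 * B y0"
    using bump_center[OF \<rho>(1), of y0] by simp
  then show ?thesis by (rule form_inner_equality[OF alt(1)[OF y0] alt(2)[OF y0]])
qed

definition H where "H y = B y * inverse (A y)"

lemma smH: "smooth_on V H"
  unfolding H_def by (intro smooth_on_mult smooth_on_inverse V smA smB) (use A_pos in force)

lemma w'_eq: "y \<in> V \<Longrightarrow> w' y vs = H y * w y vs"
  using proportional[of y vs] A_pos[of y] by (simp add: H_def field_simps)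

text \<open>The Gram form of the vectors \<open>i(u) w\<close>; it is positive definite because \<open>\<Omega>\<close> is 1-nondegenerate.\<close>

definition G where "G y u v = (\<Sum>bs\<in>basis_lists (Suc k). w y (bs @ [u]) * w y (bs @ [v]))"

lemma G_smooth: "smooth_on V (\<lambda>y. G y u v)"
  unfolding G_def by (intro smooth_on_sum smooth_on_mult V sm)

lemma G_linear:
  assumes y: "y \<in> V" shows "linear (\<lambda>u. G y u v)"
proof -
  have "linear (\<lambda>u. w y (bs @ [u]) * w y (bs @ [v]))" for bs
    using linear_compose_scale_right[OF linear_snoc[OF alt(1)[OF y]], of "w y (bs @ [v])" bs]
    by (simp add: mult.commute)
  then show ?thesis unfolding G_def by (intro linear_compose_sum) simp
qed

lemma G_sym: "G y u v = G y v u"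
  by (simp add: G_def mult.commute)

lemma G_pos:
  assumes y: "y \<in> V" and u: "u \<noteq> 0" shows "0 < G y u u"
proof -
  obtain ws where ws: "w y (u # ws) \<noteq> 0" using nonzero_local[OF y u] .
  then have len: "length ws = Suc k" using alternating_wrong_length[OF alt(1)[OF y], of "u # ws"] by auto
  have "w y (ws @ [u]) \<noteq> 0" using alternating_cycle[OF alt(1)[OF y] len, of u] ws by simp
  from form_inner_pos[OF alternating_snoc[OF alt(1)[OF y]] this] show ?thesis by (simp add: form_inner_def G_def)
qed

text \<open>Every function \<open>g\<close> with compact support in the chart has a globally defined Hamiltonian
  \<open>(K-1)\<close>-vector field, because \<open>\<Omega>\<close> is 1-nondegenerate. As it is locally Hamiltonian for \<open>\<Omega>'\<close> as well,
  \<open>H dg\<close> is closed.\<close>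

lemma H_wedge:
  assumes g: "smooth_on UNIV g" and K: "compact C" "C \<subseteq> V" and zero: "\<And>y. y \<notin> C \<Longrightarrow> g y = 0" and y0: "y0 \<in> V"
  shows "frechet_derivative H (at y0) v0 * frechet_derivative g (at y0) v1 =
    frechet_derivative H (at y0) v1 * frechet_derivative g (at y0) v0"
proof -
  let ?\<theta> = "\<lambda>y. frechet_derivative g (at y)"
  have smg: "smooth_on V g" by (rule smooth_on_subset[OF g]) simp
  have \<theta>: "smooth_on V (\<lambda>y. ?\<theta> y v)" for v by (rule smooth_on_deriv[OF smg])
  have \<theta>l: "linear (?\<theta> y)" for y by (rule linear_frechet_derivative[OF smooth_on_differentiable[OF g UNIV_I]])
  have \<theta>z: "?\<theta> y v = 0" if "y \<notin> C" for y v
  proof -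
    have "?\<theta> y = frechet_derivative (\<lambda>z. 0::real) (at y)"
      by (rule frechet_derivative_cong_open[of "- C"]) (use that zero K(1) compact_imp_closed in \<open>auto intro: open_Compl\<close>)
    then show ?thesis by simp
  qed
  obtain u where u: "smooth_on V u" "\<And>y v. y \<in> V \<Longrightarrow> G y (u y) v = ?\<theta> y v"
    using smooth_solve[where G=G and \<theta>="?\<theta>", OF V G_smooth G_linear G_sym G_pos \<theta> \<theta>l] by blast
  have uz: "u y = 0" if "y \<in> V" "y \<notin> C" for y
    using G_pos[OF that(1), of "u y"] u(2)[OF that(1), of "u y"] \<theta>z[OF that(2)] by force
  \<comment> \<open>the dual of \<open>i(u) w\<close>, scaled so that its contraction with \<open>w\<close> is \<open>G y (u y) = dg\<close>\<close>
  define Y where "Y y as = fact (Suc k) * w y (rev as @ [u y])" for y as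
  have Yalt: "alternating (Suc k) (Y y)" if "y \<in> V" for y
    unfolding Y_def
    by (intro alternating_cmult alternating_rev[where t="\<lambda>as. w y (as @ [u y])"] alternating_snoc alt that)
  have Ysm: "smooth_on V (\<lambda>y. Y y as)" for as
  proof (cases "length as = Suc k")
    case True
    have "smooth_on V (\<lambda>y. w y (map (\<lambda>l. l y) (map (\<lambda>a y. a) (rev as) @ [u])))"
      by (rule smooth_on_multilinear[OF V alternating_multilinear[OF alt(1)] sm(1)]) (use True u(1) in auto)
    then show ?thesis unfolding Y_def by (intro smooth_on_mult smooth_on_const V) (simp add: o_def)
  next
    case False
    show ?thesis
      by (rule smooth_on_cong[OF V _ smooth_on_const[of _ 0]])
        (use False in \<open>simp add: Y_def alternating_wrong_length[OF alt(1)]\<close>)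
  qed
  have Yz: "Y y as = 0" if "y \<in> V" "y \<notin> C" for y as
    using uz[OF that] linear_0[OF linear_snoc[OF alt(1)[OF that(1)]]] by (simp add: Y_def)
  obtain X W where X: "mvf_on M (points M) (Suc k) X" "\<And>p as. p \<in> fst c \<Longrightarrow> local_mvf M c X (snd c p) as = Y (snd c p) as"
    and W: "openin (mtop M) W" "points M = fst c \<union> W" "\<And>p as. p \<in> W \<Longrightarrow> X p as = 0"
    using extend_by_zero[where Y=Y, OF M Hausdorff c Yalt Ysm K Yz] by blast
  have Yw: "contr (Suc k) Y w y [v] = ?\<theta> y v" if "y \<in> V" for y v
  proof -
    have "contr (Suc k) Y w y [v] = (\<Sum>bs\<in>basis_lists (Suc k). w y (rev bs @ [u y]) * w y (rev bs @ [v]))"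
      by (simp add: contr_eq Y_def sum_distrib_left[symmetric] mult.assoc del: fact_Suc)
    also have "\<dots> = G y (u y) v"
      using sum_basis_lists_rev[of "\<lambda>bs. w y (bs @ [u y]) * w y (bs @ [v])" "Suc k"] by (simp add: G_def)
    finally show ?thesis using u(2)[OF that] by simp
  qed
  let ?\<eta> = "contr (Suc k) X \<Omega>" and ?\<eta>' = "contr (Suc k) X \<Omega>'"
  have f: "form_on M (points M) 1 ?\<eta>" "form_on M (points M) 1 ?\<eta>'"
    using form_on_contr[OF M openin_topspace X(1) \<Omega>] form_on_contr[OF M openin_topspace X(1) \<Omega>'] by simp_all
  have loc: "local_form M c ?\<eta> y [v] = ?\<theta> y v" if "y \<in> V" for y v
    using contr_local[OF X \<Omega> that, of "[v]"] Yw[OF that] by simp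
  have loc': "local_form M c ?\<eta>' y [v] = H y * ?\<theta> y v" if "y \<in> V" for y v
  proof -
    have "local_form M c ?\<eta>' y [v] = contr (Suc k) Y w' y [v]" by (rule contr_local[OF X \<Omega>' that])
    also have "\<dots> = H y * contr (Suc k) Y w y [v]"
      by (simp add: contr_eq w'_eq[OF that] sum_distrib_left mult.left_commute del: fact_Suc)
    finally show ?thesis using Yw[OF that] by simp
  qed
  have d_local: "local_form M c (ext_deriv M \<eta>) y vs = ext_deriv_flat (local_form M c \<eta>) y vs"
    if "form_on M (points M) 1 \<eta>" "y \<in> V" for \<eta> y vs
    by (rule local_form_ext_deriv[OF M c openin_topspace that(1)]) (use that(2) in \<open>simp add: V_eq\<close>)
  have sym: "frechet_derivative (\<lambda>z. ?\<theta> z v) (at y) v' = frechet_derivative (\<lambda>z. ?\<theta> z v') (at y) v" for y v v'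
    by (rule mixed_derivatives_symmetric_real[OF open_UNIV UNIV_I g])
  have flat0: "ext_deriv_flat (local_form M c ?\<eta>) y vs = 0" if y: "y \<in> V" for y vs
  proof (cases "length vs = 2")
    case True
    then obtain v v' where vs: "vs = [v, v']" by (auto simp: numeral_2_eq_2 length_Suc_conv)
    have "frechet_derivative (\<lambda>z. local_form M c ?\<eta> z [x]) (at y) = frechet_derivative (\<lambda>z. ?\<theta> z x) (at y)" for x
      by (rule frechet_derivative_cong_open[OF V y loc])
    then show ?thesis unfolding vs ext_deriv_flat_two using sym by simp
  next
    case False
    then show ?thesis
      using ext_deriv_flat_wrong_length[OF V _ y, of 1] local_form_flat[OF M c openin_topspace f(1)] by (simp add: V_eq)
  qed
  have "X \<in> locally_hamiltonian M \<Omega> (Suc k)"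
    unfolding locally_hamiltonian_def
  proof (intro CollectI conjI ballI allI)
    fix q ws assume "q \<in> points M"
    then consider "q \<in> fst c" | "q \<in> W" using W(2) by blast
    then show "ext_deriv M ?\<eta> q ws = 0"
    proof cases
      case 1
      have "ext_deriv M ?\<eta> q ws = local_form M c (ext_deriv M ?\<eta>) (snd c q) (map (mderiv M euclid (snd c) q) ws)"
        by (rule local_form_at[OF M c 1, symmetric])
      also have "\<dots> = 0" using d_local[OF f(1)] flat0 1 by simp
      finally show ?thesis .
    next
      case 2
      have "ext_deriv M ?\<eta> q ws = ext_deriv M (\<lambda>p ws. 0) q ws"
        by (rule ext_deriv_cong[OF M W(1) 2]) (simp add: contr_eq W(3))
      then show ?thesis by (simp add: ext_deriv_zero)
    qed
  qed (rule X(1))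
  then have d0: "ext_deriv M ?\<eta>' q ws = 0" if "q \<in> points M" for q ws
    using lh[of "Suc k"] that by simp
  have D: "frechet_derivative (\<lambda>z. local_form M c ?\<eta>' z [x]) (at y0) v =
      H y0 * frechet_derivative (\<lambda>z. ?\<theta> z x) (at y0) v + frechet_derivative H (at y0) v * ?\<theta> y0 x" for x v
  proof -
    have "frechet_derivative (\<lambda>z. local_form M c ?\<eta>' z [x]) (at y0) = frechet_derivative (\<lambda>z. H z * ?\<theta> z x) (at y0)"
      by (rule frechet_derivative_cong_open[OF V y0 loc'])
    then show ?thesis
      using frechet_derivative_eqI[OF has_derivative_mult[OF smooth_on_has_derivative[OF smH y0]
          smooth_on_has_derivative[OF \<theta>[of x] y0]]] by simp
  qed
  have "ext_deriv_flat (local_form M c ?\<eta>') y0 [v0, v1] = 0"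
  proof -
    have "chart_inv c y0 \<in> points M" using chart_inv_mem[OF M c y0] chart_subset[OF M c] by blast
    then show ?thesis using d_local[OF f(2) y0, of "[v0, v1]"] d0 by (simp add: local_form_eq)
  qed
  then show ?thesis unfolding ext_deriv_flat_two D using sym[of v1 y0 v0] by simp
qed

text \<open>A vector \<open>v\<close> is tested against a function \<open>g\<close> whose differential at the point is a multiple of a
  covector \<open>a\<close> that vanishes on \<open>v\<close> but not on some \<open>x\<close>. Such an \<open>x\<close> exists since \<open>\<Omega>\<close> has degree at
  least 2.\<close>

lemma H_derivative:
  assumes y0: "y0 \<in> V" shows "frechet_derivative H (at y0) v = 0"
proof (cases "v = 0")
  case True
  then show ?thesis using linear_0[OF linear_frechet_derivative[OF smooth_on_differentiable[OF smH y0]]] by simp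
next
  case False
  obtain \<rho> where \<rho>: "0 < \<rho>" "cball y0 \<rho> \<subseteq> V" using cball_in_V[OF y0] .
  obtain ws where ws: "w y0 (v # ws) \<noteq> 0" using nonzero_local[OF y0 False] .
  have a: "alternating K (w y0)" by (rule alt(1)[OF y0])
  have "length (v # ws) = K" using alternating_wrong_length[OF a] ws by blast
  then obtain x ws' where x: "ws = x # ws'" "length ws' = k" by (auto simp: length_Suc_conv)
  \<comment> \<open>as \<open>w\<close> is alternating, \<open>x\<close> is not a multiple of \<open>v\<close>; \<open>a\<close> is its component orthogonal to \<open>v\<close>\<close>
  define a where "a = x - ((x \<bullet> v) / (v \<bullet> v)) *\<^sub>R v"
  have av: "a \<bullet> v = 0" using False by (simp add: a_def inner_diff_left)
  have "a \<noteq> 0"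
  proof
    assume "a = 0"
    then obtain s where s: "x = s *\<^sub>R v" by (auto simp: a_def)
    have "linear (\<lambda>x. w y0 ((v # 0 # ws')[1 := x]))"
      by (rule alternating_slot[OF \<open>alternating K (w y0)\<close>]) (use x in auto)
    then have "linear (\<lambda>x. w y0 (v # x # ws'))" by simp
    then have "w y0 (v # x # ws') = s * w y0 (v # v # ws')" using s linear_scale by fastforce
    also have "w y0 (v # v # ws') = 0" by (rule alternating_not_distinct[OF \<open>alternating K (w y0)\<close>]) simp
    finally show False using ws x by simp
  qed
  moreover have "a \<bullet> x = a \<bullet> a" using av by (simp add: a_def inner_diff_right inner_commute)
  ultimately have ax: "a \<bullet> x \<noteq> 0" by simp
  define g where "g y = bump y0 \<rho> y * (a \<bullet> (y + (- y0)))" for y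
  have g: "smooth_on UNIV g" unfolding g_def
    by (intro smooth_on_mult smooth_on_bump smooth_on_inner smooth_on_const smooth_on_add smooth_on_ident open_UNIV)
  have gz: "g y = 0" if "y \<notin> cball y0 \<rho>" for y using bump_outside[OF \<rho>(1) that] by (simp add: g_def)
  have "(g has_derivative (\<lambda>h. bump y0 \<rho> y0 * (a \<bullet> h) + frechet_derivative (bump y0 \<rho>) (at y0) h * (a \<bullet> (y0 + (- y0))))) (at y0)"
    unfolding g_def
    by (rule has_derivative_mult[OF smooth_on_has_derivative[OF smooth_on_bump UNIV_I]])
      (auto intro!: derivative_eq_intros)
  then have dg: "frechet_derivative g (at y0) h = bump y0 \<rho> y0 * (a \<bullet> h)" for h
    by (simp add: frechet_derivative_eqI)
  have "frechet_derivative H (at y0) v * frechet_derivative g (at y0) x =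
      frechet_derivative H (at y0) x * frechet_derivative g (at y0) v"
    by (rule H_wedge[OF g compact_cball \<rho>(2) gz y0])
  then show ?thesis using ax av bump_center[OF \<rho>(1), of y0] by (simp add: dg)
qed

text \<open>The proportionality factor \<open>H\<close> has zero derivative in the chart, hence is constant on a ball.\<close>

lemma locally_constant:
  assumes p: "p \<in> fst c"
  obtains U C where "openin (mtop M) U" "p \<in> U" "\<And>q vs. q \<in> U \<Longrightarrow> \<Omega>' q vs = C * \<Omega> q vs"
proof -
  let ?y = "snd c p"
  have y: "?y \<in> V" using p by simp
  obtain \<rho> where \<rho>: "0 < \<rho>" "cball ?y \<rho> \<subseteq> V" using cball_in_V[OF y] .
  have "\<exists>C. \<forall>z\<in>ball ?y \<rho>. H z = C"
  proof (rule has_derivative_zero_constant[OF convex_ball])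
    fix z assume "z \<in> ball ?y \<rho>"
    then have z: "z \<in> V" using \<rho>(2) ball_subset_cball by blast
    have "frechet_derivative H (at z) = (\<lambda>h. 0)" using H_derivative[OF z] by blast
    then show "(H has_derivative (\<lambda>h. 0)) (at z within ball ?y \<rho>)"
      using smooth_on_has_derivative[OF smH z] has_derivative_at_withinI by metis
  qed
  then obtain C where C: "\<And>z. z \<in> ball ?y \<rho> \<Longrightarrow> H z = C" by blast
  let ?U = "{q \<in> fst c. snd c q \<in> ball ?y \<rho>}"
  have "openin (mtop M) ?U"
    by (rule openin_preimage[OF openin_chart[OF M c] continuous_chart[OF M c]]) simp
  moreover have "p \<in> ?U" using p \<rho>(1) by simp
  moreover have "\<Omega>' q vs = C * \<Omega> q vs" if "q \<in> ?U" for q vs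
  proof -
    have q: "q \<in> fst c" "snd c q \<in> V" "H (snd c q) = C" using that C by auto
    show ?thesis
      using w'_eq[OF q(2), of "map (mderiv M euclid (snd c) q) vs"] by (simp add: local_form_at[OF M c q(1)] q(3))
  qed
  ultimately show ?thesis by (rule that)
qed

end

context shared_hamiltonian
begin

text \<open>The points at which \<open>\<Omega>' = C \<Omega>\<close> form an open set with open complement, for every \<open>C\<close>.\<close>

lemma conformal:
  assumes con: "connected_space (mtop M)"
  shows "\<exists>C. \<forall>p\<in>points M. \<forall>vs. \<Omega>' p vs = C * \<Omega> p vs"
proof (cases "points M = {}")
  case False
  have loc: "\<exists>U C. openin (mtop M) U \<and> p \<in> U \<and> (\<forall>q\<in>U. \<forall>vs. \<Omega>' q vs = C * \<Omega> q vs)"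
    if p: "p \<in> points M" for p
  proof -
    note chart = chart_at[OF M p]
    interpret shared_hamiltonian_chart M \<Omega> \<Omega>' k "chart_at M p"
      by (intro shared_hamiltonian_chart.intro shared_hamiltonian_axioms shared_hamiltonian_chart_axioms.intro chart(1))
    show ?thesis using locally_constant[OF chart(2)] by metis
  qed
  have unique: "C = C'" if p: "p \<in> points M" and eq: "\<And>vs. C * \<Omega> p vs = C' * \<Omega> p vs" for p and C C' :: real
  proof -
    obtain b :: 'v where "b \<in> Basis" using nonempty_Basis by blast
    then have "b \<noteq> 0" by auto
    then obtain ws where "\<Omega> p (b # ws) \<noteq> 0" using nonzero_at[OF p] by blast
    then show ?thesis using eq[of "b # ws"] by simp
  qed
  obtain p0 where p0: "p0 \<in> points M" using False by blast
  obtain U0 C where C: "p0 \<in> U0" "\<And>q vs. q \<in> U0 \<Longrightarrow> \<Omega>' q vs = C * \<Omega> q vs" using loc[OF p0] by blast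
  define T where "T = {p \<in> points M. \<forall>vs. \<Omega>' p vs = C * \<Omega> p vs}"
  have dich: "\<exists>U. openin (mtop M) U \<and> p \<in> U \<and> (U \<subseteq> T \<or> U \<inter> T = {})" if p: "p \<in> points M" for p
  proof -
    obtain U D where U: "openin (mtop M) U" "p \<in> U" "\<And>q vs. q \<in> U \<Longrightarrow> \<Omega>' q vs = D * \<Omega> q vs" using loc[OF p] by blast
    have "D = C" if "q \<in> U \<inter> T" for q
      by (rule unique[of q]) (use that U(3) in \<open>auto simp: T_def\<close>)
    moreover have "q \<in> points M" if "q \<in> U" for q using that openin_subset[OF U(1)] by auto
    ultimately have "U \<subseteq> T" if "U \<inter> T \<noteq> {}" using that U(3) by (auto simp: T_def)
    then show ?thesis using U(1,2) by (intro exI[of _ U]) auto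
  qed
  have TM: "T \<subseteq> points M" by (auto simp: T_def)
  have "openin (mtop M) T"
  proof (subst openin_subopen, rule ballI)
    fix p assume p: "p \<in> T"
    obtain U where "openin (mtop M) U" "p \<in> U" "U \<subseteq> T \<or> U \<inter> T = {}" using dich p TM by blast
    then show "\<exists>U. openin (mtop M) U \<and> p \<in> U \<and> U \<subseteq> T" using p by (intro exI[of _ U]) auto
  qed
  moreover have "openin (mtop M) (points M - T)"
  proof (subst openin_subopen, rule ballI)
    fix p assume p: "p \<in> points M - T"
    obtain U where U: "openin (mtop M) U" "p \<in> U" "U \<subseteq> T \<or> U \<inter> T = {}" using dich p by blast
    then have "U \<subseteq> points M - T" using p openin_subset[OF U(1)] by auto
    then show "\<exists>U. openin (mtop M) U \<and> p \<in> U \<and> U \<subseteq> points M - T" using U by (intro exI[of _ U]) auto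
  qed
  ultimately have "T = {} \<or> T = points M"
    using con TM unfolding connected_space_clopen_in by (simp add: closedin_def)
  moreover have "p0 \<in> T" using p0 C by (simp add: T_def)
  ultimately have "T = points M" by auto
  then show ?thesis unfolding T_def by blast
qed simp

end

section \<open>Special conformal diffeomorphisms and infinitesimal automorphisms\<close>

lemma conformal_pairI:
  fixes M1 :: "('a, 'v::euclidean_space) manifold" and M2 :: "('b, 'v) manifold"
  assumes 1: "multisymplectic M1 k \<Omega>1" and 2: "multisymplectic M2 k \<Omega>2" and \<phi>: "diffeomorphism M1 M2 \<phi>"
    and c: "conformal_with M1 M2 \<Omega>1 \<Omega>2 \<phi> c"
  shows "conformal_pair M1 M2 \<phi> \<Omega>1 \<Omega>2 k c"
proof -
  have M: "charted M1" "charted M2" using 1 2 by (auto simp: multisymplectic_def intro: smooth_manifold_charted)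
  interpret diffeo_pair M1 M2 \<phi> using M \<phi> by unfold_locales
  show ?thesis
  proof
    show "form_on M1 (points M1) k \<Omega>1" "form_on M2 (points M2) k \<Omega>2" using 1 2 by (auto simp: multisymplectic_def)
    show conf: "pull \<Omega>2 p vs = c * \<Omega>1 p vs" if "p \<in> points M1" for p vs
      using c that by (simp add: conformal_with_def)
    show "c \<noteq> 0" if p: "p \<in> points M1" for p
    proof
      \<comment> \<open>then \<open>\<Omega>2\<close> vanishes at \<open>\<phi> p\<close>, which contradicts nondegeneracy in positive dimension\<close>
      assume "c = 0"
      have q: "\<phi> p \<in> points M2" by (rule mem[OF p])
      have "\<Omega>2 (\<phi> p) vs = 0" for vs
        using pull_inject[OF q, of \<Omega>2 "\<lambda>q vs. 0"] conf \<open>c = 0\<close> by (simp add: pullback_def)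
      moreover have "inj (\<lambda>v ws. \<Omega>2 (\<phi> p) (v # ws))" using 2 q by (simp add: multisymplectic_def)
      moreover obtain b :: 'v where "b \<in> Basis" using nonempty_Basis by blast
      ultimately have "b = 0" unfolding inj_def by simp
      then show False using \<open>b \<in> Basis\<close> by simp
    qed
  qed
qed

lemma VH_iso_conformal:
  fixes M1 :: "('a, 'v::euclidean_space) manifold" and M2 :: "('b, 'v) manifold"
  assumes 1: "multisymplectic M1 k \<Omega>1" and 2: "multisymplectic M2 k \<Omega>2" and \<phi>: "diffeomorphism M1 M2 \<phi>"
    and iso: "induces_VH_iso M1 M2 k \<Omega>1 \<Omega>2 \<phi>"
  shows "\<exists>c. conformal_with M1 M2 \<Omega>1 \<Omega>2 \<phi> c"
proof -
  have M: "charted M1" "charted M2" using 1 2 by (auto simp: multisymplectic_def intro: smooth_manifold_charted)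
  interpret diffeo_pair M1 M2 \<phi> using M \<phi> by unfold_locales
  have f1: "form_on M1 (points M1) k \<Omega>1" and f2: "form_on M2 (points M2) k \<Omega>2"
    using 1 2 by (auto simp: multisymplectic_def)
  have "2 \<le> k" using 1 by (simp add: multisymplectic_def)
  then have l: "k = Suc (Suc (k - 2))" by simp
  have lh: "push X \<in> locally_hamiltonian M2 \<Omega>2 m" if "m \<le> k" "X \<in> locally_hamiltonian M1 \<Omega>1 m" for m X
    using iso that unfolding induces_VH_iso_def Let_def by blast
  have ch: "push X \<in> characteristic M2 \<Omega>2 m" if "m \<le> k" "X \<in> characteristic M1 \<Omega>1 m" for m X
    using iso that unfolding induces_VH_iso_def Let_def by blast
  have "shared_hamiltonian M1 \<Omega>1 (pull \<Omega>2) (k - 2)"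
  proof
    show "charted M1" by (rule M)
    show "Hausdorff_space (mtop M1)" using 1 by (simp add: multisymplectic_def smooth_manifold_def)
    show "form_on M1 (points M1) (Suc (Suc (k - 2))) \<Omega>1" using f1 l by simp
    show "form_on M1 (points M1) (Suc (Suc (k - 2))) (pull \<Omega>2)"
      by (rule form_on_pull) (simp_all add: points_image f2 flip: l)
    show "inj (\<lambda>v ws. \<Omega>1 p (v # ws))" if "p \<in> points M1" for p using 1 that by (simp add: multisymplectic_def)
    fix m X p ws assume m: "m \<le> Suc (Suc (k - 2))" and p: "p \<in> points M1"
    show "ext_deriv M1 (contr m X (pull \<Omega>2)) p ws = 0" if X: "X \<in> locally_hamiltonian M1 \<Omega>1 m"
    proof -
      have Xm: "mvf_on M1 (points M1) m X" using X by (simp add: locally_hamiltonian_def)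
      have "push X \<in> locally_hamiltonian M2 \<Omega>2 m" using lh m X l by simp
      then have d: "\<And>q ws. q \<in> points M2 \<Longrightarrow> ext_deriv M2 (contr m (push X) \<Omega>2) q ws = 0"
        by (simp add: locally_hamiltonian_def)
      have f: "form_on M2 (\<phi> ` points M1) (k - m) (contr m (push X) \<Omega>2)"
        unfolding points_image by (rule form_on_contr[OF N openin_topspace mvf_on_push[OF Xm] f2])
      have "ext_deriv M1 (contr m X (pull \<Omega>2)) p ws = ext_deriv M1 (pull (contr m (push X) \<Omega>2)) p ws"
        by (rule ext_deriv_cong[OF M openin_topspace p]) (rule contr_pull[OF Xm f2])
      also have "\<dots> = pull (ext_deriv M2 (contr m (push X) \<Omega>2)) p ws"
        by (rule ext_deriv_pull[OF openin_topspace f p])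
      also have "\<dots> = 0" using d[OF mem[OF p]] by (simp add: pullback_def)
      finally show ?thesis .
    qed
    show "contr m X (pull \<Omega>2) p ws = 0" if X: "X \<in> characteristic M1 \<Omega>1 m"
    proof -
      have Xm: "mvf_on M1 (points M1) m X" using X by (simp add: characteristic_def)
      have "push X \<in> characteristic M2 \<Omega>2 m" using ch m X l by simp
      then show ?thesis using contr_pull[OF Xm f2 p] mem[OF p] by (simp add: characteristic_def pullback_def)
    qed
  qed
  then interpret shared_hamiltonian M1 \<Omega>1 "pull \<Omega>2" "k - 2" .
  have "connected_space (mtop M1)" using 1 by (simp add: multisymplectic_def smooth_manifold_def)
  from conformal[OF this] show ?thesis by (simp add: conformal_with_def)
qed

theorem theorem6p2:
  fixes M1 :: "('a, 'v::euclidean_space) manifold" and M2 :: "('b, 'v) manifold"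
    and \<Omega>1 :: "('a, 'v) tfield" and \<Omega>2 :: "('b, 'v) tfield"
    and \<phi> :: "'a \<Rightarrow> 'b" and k :: nat
  assumes "lh_multisymplectic M1 k \<Omega>1" and "lh_multisymplectic M2 k \<Omega>2"
    and "diffeomorphism M1 M2 \<phi>"
  shows "((\<exists>c. conformal_with M1 M2 \<Omega>1 \<Omega>2 \<phi> c) \<longleftrightarrow> induces_VH_iso M1 M2 k \<Omega>1 \<Omega>2 \<phi>) \<and>
    (\<forall>c. conformal_with M1 M2 \<Omega>1 \<Omega>2 \<phi> c \<longrightarrow>
      (let push = pushforward M1 (points M1) M2 \<phi>;
           pull = pullback M1 M2 \<phi>;
           pull_inv = pullback M2 M1 (inv_into (points M1) \<phi>)
       in
        \<comment> \<open>(a)\<close>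
        (\<forall>m<k. \<forall>X \<xi>. mvf_on M1 (points M1) m X \<and>
           hamiltonian_form M1 k \<Omega>1 (points M1) m X \<xi> \<longrightarrow>
           (\<exists>Y. mvf_on M2 (points M2) m Y \<and>
              hamiltonian_form M2 k \<Omega>2 (points M2) m Y (pull_inv \<xi>)) \<and>
           (\<forall>Y. mvf_on M2 (points M2) m Y \<and>
              hamiltonian_form M2 k \<Omega>2 (points M2) m Y (pull_inv \<xi>) \<longrightarrow>
              (\<lambda>q as. push X q as - c * Y q as) \<in> characteristic M2 \<Omega>2 m)) \<and>
        \<comment> \<open>(b), Hamiltonian case\<close>
        (\<forall>m<k. \<forall>X1 \<xi>1 \<xi>2. mvf_on M1 (points M1) m X1 \<and>
           hamiltonian_form M1 k \<Omega>1 (points M1) m X1 \<xi>1 \<and>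
           hamiltonian_form M2 k \<Omega>2 (points M2) m (push X1) \<xi>2 \<longrightarrow>
           push X1 \<in> locally_hamiltonian M2 \<Omega>2 m \<and>
           (\<exists>\<eta>. closed_form_on M1 (points M1) (k - m - 1) \<eta> \<and>
              (\<forall>p\<in>points M1. \<forall>ws. c * \<xi>1 p ws = pull \<xi>2 p ws + \<eta> p ws))) \<and>
        \<comment> \<open>(b), locally Hamiltonian case\<close>
        (\<forall>m\<le>k. \<forall>X1\<in>locally_hamiltonian M1 \<Omega>1 m. push X1 \<in> locally_hamiltonian M2 \<Omega>2 m) \<and>
        (\<forall>m<k. \<forall>U1 X1 \<xi>1 \<xi>2. openin (mtop M1) U1 \<and> X1 \<in> locally_hamiltonian M1 \<Omega>1 m \<and>
           hamiltonian_form M1 k \<Omega>1 U1 m X1 \<xi>1 \<and>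
           hamiltonian_form M2 k \<Omega>2 (\<phi> ` U1) m (push X1) \<xi>2 \<longrightarrow>
           (\<exists>\<eta>. closed_form_on M1 U1 (k - m - 1) \<eta> \<and>
              (\<forall>p\<in>U1. \<forall>ws. c * \<xi>1 p ws = pull \<xi>2 p ws + \<eta> p ws))) \<and>
        \<comment> \<open>classes of Hamiltonian forms\<close>
        (\<forall>m<k. \<forall>U1. openin (mtop M1) U1 \<longrightarrow> induces_form_iso M1 M2 k \<Omega>1 \<Omega>2 \<phi> U1 m)))"
proof -
  have ms: "multisymplectic M1 k \<Omega>1" "multisymplectic M2 k \<Omega>2"
    using assms(1,2) by (auto simp: lh_multisymplectic_def)
  note pair = conformal_pairI[OF ms assms(3)]
  have iff: "(\<exists>c. conformal_with M1 M2 \<Omega>1 \<Omega>2 \<phi> c) \<longleftrightarrow> induces_VH_iso M1 M2 k \<Omega>1 \<Omega>2 \<phi>"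
    using conformal_pair.VH_iso[OF pair] VH_iso_conformal[OF ms assms(3)] by blast
  show ?thesis
    unfolding Let_def
  proof (intro conjI allI impI ballI iff; (elim conjE)?)
    fix c assume "conformal_with M1 M2 \<Omega>1 \<Omega>2 \<phi> c"
    then interpret conformal_pair M1 M2 \<phi> \<Omega>1 \<Omega>2 k c by (rule pair)
    fix m
    show "\<exists>Y. mvf_on M2 (points M2) m Y \<and> hamiltonian_form M2 k \<Omega>2 (points M2) m Y (pull_inv \<xi>)"
      if X: "mvf_on M1 (points M1) m X" "hamiltonian_form M1 k \<Omega>1 (points M1) m X \<xi>" for X \<xi>
      using push_hamiltonian[OF X] mvf_on_lincomb[OF N openin_topspace mvf_on_push[OF X(1)] mvf_on_push[OF X(1)], of "inverse c" 0]
      by auto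
    show "(\<lambda>q as. push X q as - c * Y q as) \<in> characteristic M2 \<Omega>2 m"
      if "mvf_on M1 (points M1) m X" "hamiltonian_form M1 k \<Omega>1 (points M1) m X \<xi>"
        "mvf_on M2 (points M2) m Y" "hamiltonian_form M2 k \<Omega>2 (points M2) m Y (pull_inv \<xi>)" for X \<xi> Y
      by (rule hamiltonian_unique[OF that])
    show "push X1 \<in> locally_hamiltonian M2 \<Omega>2 m"
      if "mvf_on M1 (points M1) m X1" "hamiltonian_form M1 k \<Omega>1 (points M1) m X1 \<xi>1" for X1 \<xi>1
      by (rule push_locally_hamiltonian[OF hamiltonian_locally_hamiltonian[OF that]])
    show "push X1 \<in> locally_hamiltonian M2 \<Omega>2 m" if "X1 \<in> locally_hamiltonian M1 \<Omega>1 m" for X1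
      by (rule push_locally_hamiltonian[OF that])
    have local: "\<exists>\<eta>. closed_form_on M1 U (k - m - 1) \<eta> \<and> (\<forall>p\<in>U. \<forall>ws. c * \<xi>1 p ws = pull \<xi>2 p ws + \<eta> p ws)"
      if "openin (mtop M1) U" "mvf_on M1 (points M1) m X1" "hamiltonian_form M1 k \<Omega>1 U m X1 \<xi>1"
        "hamiltonian_form M2 k \<Omega>2 (\<phi> ` U) m (push X1) \<xi>2" for U X1 \<xi>1 \<xi>2
      by (rule exI[of _ "\<lambda>p ws. c * \<xi>1 p ws - pull \<xi>2 p ws"]) (use difference_closed[OF that] in simp)
    show "\<exists>\<eta>. closed_form_on M1 (points M1) (k - m - 1) \<eta> \<and> (\<forall>p\<in>points M1. \<forall>ws. c * \<xi>1 p ws = pull \<xi>2 p ws + \<eta> p ws)"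
      if "mvf_on M1 (points M1) m X1" "hamiltonian_form M1 k \<Omega>1 (points M1) m X1 \<xi>1"
        "hamiltonian_form M2 k \<Omega>2 (points M2) m (push X1) \<xi>2" for X1 \<xi>1 \<xi>2
      by (rule local[OF openin_topspace that(1,2)]) (simp add: points_image that(3))
    show "\<exists>\<eta>. closed_form_on M1 U1 (k - m - 1) \<eta> \<and> (\<forall>p\<in>U1. \<forall>ws. c * \<xi>1 p ws = pull \<xi>2 p ws + \<eta> p ws)"
      if "openin (mtop M1) U1" "X1 \<in> locally_hamiltonian M1 \<Omega>1 m" "hamiltonian_form M1 k \<Omega>1 U1 m X1 \<xi>1"
        "hamiltonian_form M2 k \<Omega>2 (\<phi> ` U1) m (push X1) \<xi>2" for U1 X1 \<xi>1 \<xi>2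
      by (rule local[OF that(1) _ that(3,4)]) (use that(2) in \<open>simp add: locally_hamiltonian_def\<close>)
    show "induces_form_iso M1 M2 k \<Omega>1 \<Omega>2 \<phi> U1 m" if "openin (mtop M1) U1" for U1
      by (rule form_iso[OF that])
  qed
qed

end
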